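(* Let $I=I_2\sqcup I_3\sqcup I_4$ and let $(\mathbf{X}_n^{(i)})_{i\in I}$ be independent unnormalized Wigner matrices with uniformly controlled moments and real parameters $\beta_i\in\mathbb{R}$ (as defined in the context). Let $(b_n^{(i)})_n$ be band widths of slow growth for $i\in I_2$, of full proportion for $i\in I_3$, and of proper proportion for $i\in I_4$, and let $\mathcal{O}_n^{(k)}=(\mathbf{\Theta}_n^{(i)})_{i\in I_k}$, $k=2,3,4$, be the corresponding families of normalized random band matrices. Then: the families $\mathcal{O}_n^{(3)}$ and $\mathcal{O}_n^{(4)}$ are asymptotically traffic independent; the families $\mathcal{O}_n^{(3)}$ and $\mathcal{O}_n^{(2)}$ are asymptotically traffic independent; if $I_2$ and $I_4$ are non-empty, the families $\mathcal{O}_n^{(2)}$ and $\mathcal{O}_n^{(4)}$ are not asymptotically traffic independent; and if $\#(I_4)\ge2$, the matrices $\mathbf{\Theta}_n^{(i)}$, $i\in I_4$ (viewed as one-element families) are not asymptotically traffic independent.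
   Context: Wigner matrices: for each $n$, $(\mathbf{X}_n^{(i)})_{i\in I}$ are random Hermitian $n\times n$ matrices such that the entries $(\mathbf{X}_n^{(i)}(j,k):1\le j\le k\le n,\ i\in I)$ are independent; diagonal entries are real-valued; for $j<k$, $\mathbb{E}\mathbf{X}_n^{(i)}(j,k)=0$, $\mathbb{E}|\mathbf{X}_n^{(i)}(j,k)|^2=1$, $\mathbb{E}[\mathbf{X}_n^{(i)}(j,k)^2]=\beta_i$; and for every finite $I_0\subset I$ and $\ell\in\mathbb{N}$, $\sup_n\sup_{i\in I_0}\sup_{1\le j\le k\le n}\mathbb{E}|\mathbf{X}_n^{(i)}(j,k)|^\ell<\infty$. Random band matrices: with nonnegative integers $b_n$, $\mathbf{\Xi}_n(j,k)=\mathbf{1}\{|j-k|\le b_n\}\mathbf{X}_n(j,k)$. Slow growth: $b_n\to\infty$, $b_n=o(n)$, $\mathbf{\Theta}_n=(2b_n)^{-1/2}\mathbf{\Xi}_n$. Proportional growth: $b_n/n\to c\in(0,1]$, $\mathbf{\Theta}_n=(2c-c^2)^{-1/2}n^{-1/2}\mathbf{\Xi}_n$; full proportion means $c=1$, proper means $c\in(0,1)$. A test graph $T=(V,E,\mathrm{src},\mathrm{tar},\gamma)$ with labels in a set $J$ is a finite, connected directed multigraph (loops and multiple edges allowed, $V\ne\emptyset$) with $\gamma:E\to J$. For random matrices $\mathfrak{A}_n=(\mathbf{A}_n^{(i)})_{i\in J}$, $\tau^0[T(\mathfrak{A}_n)]=\mathbb{E}[\frac1n\sum_{\phi:V\hookrightarrow[n]}\prod_{e\in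 E}\mathbf{A}_n^{(\gamma(e))}(\phi(\mathrm{tar}(e)),\phi(\mathrm{src}(e)))]$, sum over injective maps. Asymptotic traffic independence of families $(\mathbf{A}_n^{(i)})_{i\in J_k}$, $k\in K$ (disjoint label sets, all matrices here Hermitian): for every test graph $T$ with labels in $\bigsqcup_kJ_k$ the limit $\tau^0[T]:=\lim_n\tau^0[T(\mathfrak{A}_n)]$ exists (equivalently, the joint family converges in traffic distribution), and $\tau^0[T]=\prod_k\prod_\ell\tau^0[T_{k,\ell}]$ if $T$ is a free product, $\tau^0[T]=0$ otherwise. Here $(T_{k,\ell})_\ell$ are the connected components of the subgraph of $T$ spanned by the edges with labels in $J_k$; $\chi(T)$ is the simple bipartite graph whose vertices are the components $T_{k,\ell}$ and the vertices of $T$ belonging to more than one component, with edges given by membership; $T$ is a free product if $\chi(T)$ is a tree (a one-vertex edgeless $T$ counts as a free product with empty product $1$). *)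

theory Defs
  imports
    "HOL-Probability.Probability"
    "HOL-Library.Landau_Symbols"
    "Graph_Theory.Graph_Theory"
begin

(* An n x n random matrix is given by its entries A j k, indexed by j, k in {1..n}. *)
type_synonym 'w random_matrix = "nat \<Rightarrow> nat \<Rightarrow> 'w \<Rightarrow> complex"

subsection \<open>Wigner matrices and random band matrices\<close>

(* The underlying probability space M n may change with the dimension n. Only the upper
   triangular entries are constrained explicitly; the Hermitian condition determines the
   others and makes the diagonal real. The moment bound gives the integrability behind the
   expectations. *)
definition wigner_family ::
  "(nat \<Rightarrow> 'w measure) \<Rightarrow> 'i set \<Rightarrow> ('i \<Rightarrow> real) \<Rightarrow> (nat \<Rightarrow> 'i \<Rightarrow> 'w random_matrix) \<Rightarrow> bool"
  where
  "wigner_family M I \<beta> X \<longleftrightarrow>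
     (\<forall>n. prob_space (M n)) \<and>
     (\<forall>n. \<forall>i\<in>I. \<forall>j\<in>{1..n}. \<forall>k\<in>{1..n}. \<forall>\<omega>\<in>space (M n). X n i k j \<omega> = cnj (X n i j k \<omega>)) \<and>
     (\<forall>n. prob_space.indep_vars (M n) (\<lambda>_. borel) (\<lambda>(i, j, k). X n i j k)
            (I \<times> {(j, k). 1 \<le> j \<and> j \<le> k \<and> k \<le> n})) \<and>
     (\<forall>n. \<forall>i\<in>I. \<forall>j k. 1 \<le> j \<and> j < k \<and> k \<le> n \<longrightarrow>
            (\<integral>\<omega>. X n i j k \<omega> \<partial>M n) = 0 \<and>
            (\<integral>\<omega>. (cmod (X n i j k \<omega>))\<^sup>2 \<partial>M n) = 1 \<and>
            (\<integral>\<omega>. (X n i j k \<omega>)\<^sup>2 \<partial>M n) = complex_of_real (\<beta> i)) \<and>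
     (\<forall>I\<^sub>0 l. finite I\<^sub>0 \<and> I\<^sub>0 \<subseteq> I \<longrightarrow>
            (SUP n. SUP i\<in>I\<^sub>0. SUP (j, k)\<in>{(j, k). 1 \<le> j \<and> j \<le> k \<and> k \<le> n}.
               \<integral>\<^sup>+\<omega>. ennreal ((cmod (X n i j k \<omega>)) ^ l) \<partial>M n) < \<infinity>)"

definition band_matrix :: "nat \<Rightarrow> 'w random_matrix \<Rightarrow> 'w random_matrix" where
  "band_matrix b X = (\<lambda>j k \<omega>. if \<bar>int j - int k\<bar> \<le> int b then X j k \<omega> else 0)"

definition slow_band :: "nat \<Rightarrow> 'w random_matrix \<Rightarrow> 'w random_matrix" where
  "slow_band b X =
     (\<lambda>j k \<omega>. complex_of_real ((2 * real b) powr (-1/2)) * band_matrix b X j k \<omega>)"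

definition proportional_band ::
  "nat \<Rightarrow> real \<Rightarrow> nat \<Rightarrow> 'w random_matrix \<Rightarrow> 'w random_matrix" where
  "proportional_band n c b X =
     (\<lambda>j k \<omega>. complex_of_real ((2 * c - c\<^sup>2) powr (-1/2) * real n powr (-1/2))
                * band_matrix b X j k \<omega>)"

definition slow_growth :: "(nat \<Rightarrow> nat) \<Rightarrow> bool" where
  "slow_growth b \<longleftrightarrow> filterlim b at_top sequentially \<and> (\<lambda>n. real (b n)) \<in> o(\<lambda>n. real n)"

definition proportional_growth :: "(nat \<Rightarrow> nat) \<Rightarrow> real \<Rightarrow> bool" where
  "proportional_growth b c \<longleftrightarrow> 0 < c \<and> c \<le> 1 \<and> (\<lambda>n. real (b n) / real n) \<longlonglongrightarrow> c"

subsection \<open>Test graphs and injective traffic states\<close>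

(* Connectedness is that of the underlying undirected graph, and includes nonemptiness. *)
definition test_graph :: "('v, 'e) pre_digraph \<Rightarrow> ('e \<Rightarrow> 'i) \<Rightarrow> 'i set \<Rightarrow> bool" where
  "test_graph T \<gamma> L \<longleftrightarrow>
     fin_digraph T \<and> Digraph_Component.connected T \<and> (\<forall>e\<in>arcs T. \<gamma> e \<in> L)"

(* Edges run from tail (src) to head (tar). *)
definition inj_traffic_state ::
  "(nat \<Rightarrow> 'w measure) \<Rightarrow> (nat \<Rightarrow> 'i \<Rightarrow> 'w random_matrix) \<Rightarrow>
   ('v, 'e) pre_digraph \<Rightarrow> ('e \<Rightarrow> 'i) \<Rightarrow> nat \<Rightarrow> complex" where
  "inj_traffic_state M A T \<gamma> n =
     (\<integral>\<omega>. (1 / of_nat n) *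
        (\<Sum>\<phi> \<in> {\<phi> \<in> PiE (verts T) (\<lambda>_. {1..n}). inj_on \<phi> (verts T)}.
           \<Prod>e\<in>arcs T. A n (\<gamma> e) (\<phi> (head T e)) (\<phi> (tail T e)) \<omega>) \<partial>M n)"

subsection \<open>Free products of test graphs\<close>

definition label_subgraph ::
  "('v, 'e) pre_digraph \<Rightarrow> ('e \<Rightarrow> 'i) \<Rightarrow> 'i set \<Rightarrow> ('v, 'e) pre_digraph" where
  "label_subgraph T \<gamma> L =
     (let E = {e \<in> arcs T. \<gamma> e \<in> L}
      in \<lparr>verts = tail T ` E \<union> head T ` E, arcs = E, tail = tail T, head = head T\<rparr>)"

(* All components for all colours k together. Each has at least one edge, so for pairwise
   disjoint label sets J k a component determines its colour. *)
definition color_components ::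
  "('v, 'e) pre_digraph \<Rightarrow> ('e \<Rightarrow> 'i) \<Rightarrow> 'k set \<Rightarrow> ('k \<Rightarrow> 'i set) \<Rightarrow> ('v, 'e) pre_digraph set"
  where
  "color_components T \<gamma> K J =
     (\<Union>k\<in>K. {C. pre_digraph.max_subgraph (label_subgraph T \<gamma> (J k)) Digraph_Component.connected C})"

definition component_graph ::
  "('v, 'e) pre_digraph \<Rightarrow> ('e \<Rightarrow> 'i) \<Rightarrow> 'k set \<Rightarrow> ('k \<Rightarrow> 'i set) \<Rightarrow>
   (('v, 'e) pre_digraph + 'v) pair_pre_digraph" where
  "component_graph T \<gamma> K J =
     (let \<C> = color_components T \<gamma> K J;
          S = {v \<in> verts T. \<exists>C\<in>\<C>. \<exists>C'\<in>\<C>. C \<noteq> C' \<and> v \<in> verts C \<and> v \<in> verts C'}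
      in \<lparr>pverts = Inl ` \<C> \<union> Inr ` S,
          parcs = (\<Union>C\<in>\<C>. \<Union>v\<in>S \<inter> verts C. {(Inl C, Inr v), (Inr v, Inl C)})\<rparr>)"

(* Simple undirected graphs are symmetric digraphs here. The library's notion of tree does
   not apply to them, since it already counts the back-and-forth walk u, v, u as a cycle. *)
definition undirected_tree :: "'a pair_pre_digraph \<Rightarrow> bool" where
  "undirected_tree G \<longleftrightarrow>
     Digraph_Component.connected (with_proj G) \<and>
     \<not> (\<exists>p. pre_digraph.cycle (with_proj G) p \<and> length p \<ge> 3)"

definition free_product ::
  "('v, 'e) pre_digraph \<Rightarrow> ('e \<Rightarrow> 'i) \<Rightarrow> 'k set \<Rightarrow> ('k \<Rightarrow> 'i set) \<Rightarrow> bool" where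
  "free_product T \<gamma> K J \<longleftrightarrow> arcs T = {} \<or> undirected_tree (component_graph T \<gamma> K J)"

subsection \<open>Asymptotic traffic independence\<close>

(* The families are (A n i), i in J k, for k in K, with the J k pairwise disjoint. Every
   finite graph has an isomorphic copy with vertices and edges in nat. The product is over
   the finite set of all components rather than over K, since K may be infinite. *)
definition asymp_traffic_independent ::
  "(nat \<Rightarrow> 'w measure) \<Rightarrow> (nat \<Rightarrow> 'i \<Rightarrow> 'w random_matrix) \<Rightarrow> 'k set \<Rightarrow> ('k \<Rightarrow> 'i set) \<Rightarrow> bool"
  where
  "asymp_traffic_independent M A K J \<longleftrightarrow>
     (\<forall>(T :: (nat, nat) pre_digraph) \<gamma>. test_graph T \<gamma> (\<Union>k\<in>K. J k) \<longrightarrow>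
        convergent (inj_traffic_state M A T \<gamma>) \<and>
        lim (inj_traffic_state M A T \<gamma>) =
          (if free_product T \<gamma> K J
           then \<Prod>C\<in>color_components T \<gamma> K J. lim (inj_traffic_state M A C \<gamma>)
           else 0))"

end

(* By independence, the expectation attached to an injective map of a test graph T factors over the
   classes of arcs with the same label and the same end points. It vanishes if some class consists
   of a single arc that is not a loop. If no class is of that kind, then T has at least
   2 (|V| - 1) arcs; keeping two parallel arcs along each edge of a spanning tree already uses up
   the normalization, and every further arc contributes a factor tending to 0. So only the double
   trees, i.e. those T with exactly 2 (|V| - 1) arcs, survive in the limit, and for these the traffic
   state is a weight (a product of parameters beta_i) times an average over maps of the product of
   the kernels s_i^2 1{|j - k| <= b_i} along the edges of the tree. Removing leaves one at a time
   shows that it converges: summing over a leaf applies to a continuous weight the identity (slow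
   growth) or a moving average over a window (proportional growth).

   Counting vertices and arcs, T is a double tree if and only if it is a free product and all its
   colored components are double trees. A full proportion kernel can be replaced by the constant
   1/n; this cuts the tree at the edges with labels in I_3 and yields both independence claims. On
   the path with edge labels j, i, j (i of slow growth), or i, j (both of proper proportion), the
   limit is the integral of a product of two windows applied to 1. Each window applied to 1 has mean
   1 and increases with the distance to the boundary, so by Chebyshev's inequality this integral
   exceeds 1, the value which independence would require. *)
theory Submission
  imports Defs
begin


section \<open>Trees grown leaf by leaf, and connectedness expressed by cuts\<close>

section \<open>Rooted trees and connectedness\<close>

text \<open>Injectivity of the maps cuts both ways. It lets expectations factor, since under an
  injective map only parallel arcs of equal label share a matrix entry; but it couples the leaves of
  the tree, so the sums are enlarged to all maps, at the cost of a collision estimate, before leaves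
  are removed. The kernels cannot converge uniformly: under slow growth, positions at the boundary
  see only about half of the mass. Deviations are therefore averaged over positions, and the basic
  estimate for tree sums allows an arbitrary weight at one vertex and is linear in its total.

  The constant 2c - c^2 is the area of the band |x - y| <= c in the unit square. It gives a single
  edge mass 1, so independence would require the value 1 on every path of alternating labels whose
  twin arcs have opposite directions. For a slow label i and a proper label j, the path i, j is too
  short to tell: the slow edge acts as the identity, and the limit is the mean 1 of one window. In
  j, i, j the edge i keeps the two edges j in different components while their windows still
  meet.\<close>

inductive rooted_tree :: "'v \<Rightarrow> ('v \<Rightarrow> 'v) \<Rightarrow> 'v set \<Rightarrow> bool" for r p where
  root: "rooted_tree r p {r}"
| leaf: "rooted_tree r p V \<Longrightarrow> w \<notin> V \<Longrightarrow> p w \<in> V \<Longrightarrow> rooted_tree r p (insert w V)"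

lemma rooted_tree_finite: "rooted_tree r p V \<Longrightarrow> finite V"
  by (induction rule: rooted_tree.induct) auto

lemma rooted_tree_root: "rooted_tree r p V \<Longrightarrow> r \<in> V"
  by (induction rule: rooted_tree.induct) auto

lemma rooted_tree_parent:
  "rooted_tree r p V \<Longrightarrow> v \<in> V - {r} \<Longrightarrow> p v \<in> V \<and> p v \<noteq> v"
  by (induction rule: rooted_tree.induct) auto

text \<open>Changing \<open>p\<close> outside \<open>V - {r}\<close> keeps the tree, which lets a
  spanning tree be extended by redefining the parent of a new leaf.\<close>

lemma rooted_tree_cong:
  "rooted_tree r p V \<Longrightarrow> (\<And>v. v \<in> V - {r} \<Longrightarrow> p v = q v) \<Longrightarrow> rooted_tree r q V"
proof (induction rule: rooted_tree.induct)
  case (leaf V w)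
  have "w \<noteq> r" using rooted_tree_root[OF leaf.hyps(1)] leaf.hyps(2) by blast
  show ?case
  proof (rule rooted_tree.leaf)
    show "rooted_tree r q V" using leaf.IH leaf.prems by blast
    show "q w \<in> V" using leaf.hyps(3) leaf.prems[of w] \<open>w \<noteq> r\<close> by simp
  qed fact
qed (rule rooted_tree.root)

text \<open>The edge of a new leaf contains that leaf, older edges do not. The vertices other than
  the root thereby index the edges, which is how products over edges are written later.\<close>

lemma rooted_tree_edge_inj:
  "rooted_tree r p V \<Longrightarrow> inj_on (\<lambda>v. {v, p v}) (V - {r})"
proof (induction rule: rooted_tree.induct)
  case (leaf V w)
  have "w \<noteq> r" using rooted_tree_root[OF leaf.hyps(1)] leaf.hyps(2) by blast
  then have eq: "insert w V - {r} = insert w (V - {r})" by auto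
  have "{w, p w} \<noteq> {v, p v}" if "v \<in> V - {r}" for v
  proof -
    have "w \<noteq> v" "w \<noteq> p v" using rooted_tree_parent[OF leaf.hyps(1) that] leaf.hyps(2) that by blast+
    then show ?thesis by blast
  qed
  then show ?case unfolding eq using leaf by (auto simp: inj_on_insert)
qed auto

lemma not_strongly_connectedD:
  assumes "strongly_connected G" "U \<subset> verts G" "U \<noteq> {}"
  shows "\<exists>(u, v) \<in> arcs_ends G. u \<in> U \<and> v \<in> verts G - U"
proof -
  obtain x y where xy: "x \<in> U" "y \<in> verts G - U" using assms by blast
  then have "(x, y) \<in> rtrancl_on (verts G) (arcs_ends G)"
    using assms by (auto simp: strongly_connected_def reachable_def)
  from this xy(1) have "y \<in> U \<or> ?thesis"
  proof (induction rule: rtrancl_on_induct)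
    case (step y z)
    then show ?case by auto
  qed auto
  then show ?thesis using xy by auto
qed

lemma strongly_connectedI_cut:
  assumes "wf_digraph G" "verts G \<noteq> {}"
    "\<And>U. U \<subset> verts G \<Longrightarrow> U \<noteq> {} \<Longrightarrow> \<exists>(u, v) \<in> arcs_ends G. u \<in> U \<and> v \<in> verts G - U"
  shows "strongly_connected G"
proof (rule strongly_connectedI)
  interpret wf_digraph G by fact
  fix u v assume uv: "u \<in> verts G" "v \<in> verts G"
  define U where "U = {w \<in> verts G. u \<rightarrow>\<^sup>*\<^bsub>G\<^esub> w}"
  have "u \<in> U" using uv by (simp add: U_def)
  have "U = verts G"
  proof (rule ccontr)
    assume "U \<noteq> verts G"
    then have "U \<subset> verts G" by (auto simp: U_def)
    from assms(3)[OF this] \<open>u \<in> U\<close> obtain x y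
      where "(x, y) \<in> arcs_ends G" "x \<in> U" "y \<in> verts G - U" by blast
    then show False using U_def reachable_adj_trans by blast
  qed
  then show "u \<rightarrow>\<^sup>*\<^bsub>G\<^esub> v" using uv by (auto simp: U_def)
qed fact

text \<open>Connectedness is strong connectedness of the symmetrized graph. The cut criterion
  dispenses with walks, and the later arguments about connectedness go through it.\<close>

lemma connected_iff_cut:
  assumes "wf_digraph G"
  shows "Digraph_Component.connected G \<longleftrightarrow> verts G \<noteq> {} \<and>
    (\<forall>U. U \<subset> verts G \<and> U \<noteq> {} \<longrightarrow> (\<exists>e\<in>arcs G. (tail G e \<in> U) \<noteq> (head G e \<in> U)))"
    (is "?L \<longleftrightarrow> ?R")
proof
  interpret wf_digraph G by fact
  let ?S = "with_proj (mk_symmetric G)"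
  have ends: "parcs (mk_symmetric G) = (\<Union>e\<in>arcs G. {(tail G e, head G e), (head G e, tail G e)})"
    by (simp add: mk_symmetric_def)
  {
    assume ?L
    then have sc: "strongly_connected ?S" by (simp add: connected_def)
    show ?R
    proof (intro conjI allI impI)
      show "verts G \<noteq> {}" using sc by (auto simp: strongly_connected_def)
      fix U assume "U \<subset> verts G \<and> U \<noteq> {}"
      then show "\<exists>e\<in>arcs G. (tail G e \<in> U) \<noteq> (head G e \<in> U)"
        using not_strongly_connectedD[OF sc, of U] by (auto simp: ends)
    qed
  }
  {
    assume R: ?R
    have "wf_digraph ?S"
      using wellformed_mk_symmetric by (simp add: pair_wf_digraph_def wf_digraph_def)
    then have "strongly_connected ?S"
    proof (rule strongly_connectedI_cut)
      fix U assume "U \<subset> verts ?S" "U \<noteq> {}"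
      then obtain e where "e \<in> arcs G" "(tail G e \<in> U) \<noteq> (head G e \<in> U)" using R by auto
      then show "\<exists>(u, v) \<in> arcs_ends ?S. u \<in> U \<and> v \<in> verts ?S - U"
        by (cases "tail G e \<in> U") (auto simp: ends intro!: bexI[of _ e])
    qed (use R in auto)
    then show ?L by (simp add: connected_def)
  }
qed

lemma connected_cutE:
  assumes "wf_digraph G" "Digraph_Component.connected G" "U \<subseteq> verts G" "U \<noteq> {}" "U \<noteq> verts G"
  obtains e where "e \<in> arcs G" "(tail G e \<in> U) \<noteq> (head G e \<in> U)"
  using connected_iff_cut[OF assms(1)] assms by (metis psubsetI)

text \<open>A largest subtree already covers all vertices: otherwise an arc across the cut would
  attach one more leaf.\<close>

lemma ex_spanning_rooted_tree:
  assumes "wf_digraph G" "finite (verts G)" "Digraph_Component.connected G" "r \<in> verts G"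
  shows "\<exists>p. rooted_tree r p (verts G) \<and>
    (\<forall>v\<in>verts G - {r}. \<exists>e\<in>arcs G. {tail G e, head G e} = {v, p v})"
proof -
  interpret wf_digraph G by fact
  define P where "P V \<longleftrightarrow> V \<subseteq> verts G \<and> (\<exists>p. rooted_tree r p V \<and>
    (\<forall>v\<in>V - {r}. \<exists>e\<in>arcs G. {tail G e, head G e} = {v, p v}))" for V
  have "P {r}" using assms(4) by (auto simp: P_def intro: rooted_tree.root)
  moreover have "\<forall>V. P V \<longrightarrow> card V < Suc (card (verts G))"
    using assms(2) by (auto simp: P_def less_Suc_eq_le intro: card_mono)
  ultimately obtain V where V: "P V" "\<And>V'. P V' \<Longrightarrow> card V' \<le> card V"
    using ex_has_greatest_nat[of P "{r}" card "Suc (card (verts G))"] by blast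
  obtain p where p: "V \<subseteq> verts G" "rooted_tree r p V"
    "\<And>v. v \<in> V - {r} \<Longrightarrow> \<exists>e\<in>arcs G. {tail G e, head G e} = {v, p v}"
    using V(1) by (auto simp: P_def)
  have rV: "r \<in> V" and fV: "finite V"
    using p rooted_tree_root rooted_tree_finite by metis+
  have "V = verts G"
  proof (rule ccontr)
    assume "V \<noteq> verts G"
    then obtain e where e: "e \<in> arcs G" "(tail G e \<in> V) \<noteq> (head G e \<in> V)"
      using connected_cutE[OF assms(1,3) p(1)] rV by blast
    obtain w u where wu: "{tail G e, head G e} = {w, u}" "w \<notin> V" "u \<in> V" "w \<in> verts G"
      using e by (metis head_in_verts insert_commute tail_in_verts)
    have "rooted_tree r (p(w := u)) (insert w V)"
      by (rule rooted_tree.leaf[OF rooted_tree_cong[OF p(2)]]) (use wu in auto)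
    moreover have "\<exists>e\<in>arcs G. {tail G e, head G e} = {v, (p(w := u)) v}"
      if "v \<in> insert w V - {r}" for v
      using that p(3)[of v] e wu by (cases "v = w") auto
    ultimately have "P (insert w V)"
      unfolding P_def using p(1) wu(4) by blast
    from V(2)[OF this] show False using wu fV by simp
  qed
  then show ?thesis using p by blast
qed

section \<open>Trees among the connected graphs, recognized by their number of edges\<close>

subsection \<open>Counting edges of undirected graphs\<close>

lemma with_proj_wf: "pair_wf_digraph G \<longleftrightarrow> wf_digraph (with_proj G)"
  by (simp add: pair_wf_digraph_def wf_digraph_def)

lemma card_tree_arcs:
  assumes "rooted_tree r p V"
  shows "card ((\<lambda>v. (v, p v)) ` (V - {r}) \<union> (\<lambda>v. (p v, v)) ` (V - {r})) = 2 * (card V - 1)"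
proof -
  let ?A = "(\<lambda>v. (v, p v)) ` (V - {r})" and ?B = "(\<lambda>v. (p v, v)) ` (V - {r})"
  have fin: "finite V" and r: "r \<in> V"
    using assms rooted_tree_finite rooted_tree_root by metis+
  have inj: "inj_on (\<lambda>v. {v, p v}) (V - {r})" by (rule rooted_tree_edge_inj[OF assms])
  have "?A \<inter> ?B = {}"
  proof (rule equals0I)
    fix x assume "x \<in> ?A \<inter> ?B"
    then obtain v v' where *: "v \<in> V - {r}" "v' \<in> V - {r}" "(v, p v) = (p v', v')" by blast
    then have "{v, p v} = {v', p v'}" by auto
    with inj * have "v = v'" by (auto dest: inj_onD)
    then show False using * rooted_tree_parent[OF assms *(1)] by auto
  qed
  moreover have "card ?A = card V - 1" "card ?B = card V - 1"
    using fin r by (auto simp: card_image inj_on_def card_Diff_subset)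
  ultimately show ?thesis using fin by (simp add: card_Un_disjoint)
qed

lemma undirected_spanning_tree:
  assumes "wf_digraph (with_proj G)" "finite (pverts G)" "sym (parcs G)"
    "Digraph_Component.connected (with_proj G)"
  shows "\<exists>r p. rooted_tree r p (pverts G) \<and>
    (\<lambda>v. (v, p v)) ` (pverts G - {r}) \<union> (\<lambda>v. (p v, v)) ` (pverts G - {r}) \<subseteq> parcs G"
proof -
  obtain r where "r \<in> pverts G"
    using assms(4) connected_iff_cut[OF assms(1)] by auto
  then obtain p where p: "rooted_tree r p (pverts G)"
    "\<And>v. v \<in> pverts G - {r} \<Longrightarrow> \<exists>e\<in>parcs G. {fst e, snd e} = {v, p v}"
    using ex_spanning_rooted_tree[OF assms(1), of r] assms(2,4) by auto
  have "(v, p v) \<in> parcs G \<and> (p v, v) \<in> parcs G" if v: "v \<in> pverts G - {r}" for v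
  proof -
    obtain a b where "(a, b) \<in> parcs G" "{a, b} = {v, p v}" using p(2)[OF v] by force
    moreover from this have "(b, a) \<in> parcs G" using assms(3) by (meson symD)
    ultimately show ?thesis by (auto simp: doubleton_eq_iff)
  qed
  then show ?thesis using p by blast
qed

lemma undirected_card_arcs_ge:
  assumes "wf_digraph (with_proj G)" "finite (pverts G)" "finite (parcs G)" "sym (parcs G)"
    "Digraph_Component.connected (with_proj G)"
  shows "2 * (card (pverts G) - 1) \<le> card (parcs G)"
proof -
  obtain r p where p: "rooted_tree r p (pverts G)"
    "(\<lambda>v. (v, p v)) ` (pverts G - {r}) \<union> (\<lambda>v. (p v, v)) ` (pverts G - {r}) \<subseteq> parcs G"
    using undirected_spanning_tree[OF assms(1,2,4,5)] by blast
  show ?thesis using card_mono[OF assms(3) p(2)] card_tree_arcs[OF p(1)] by simp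
qed

text \<open>The rest of the cycle bypasses its first arc. The bypass must avoid both orientations of
  the edge, since an undirected edge is a pair of opposite arcs; this is where length at least 3 and
  the distinctness of the vertices enter.\<close>

lemma cycle_imp_removable:
  assumes wf: "wf_digraph (with_proj G)" and "pre_digraph.cycle (with_proj G) c" "length c \<ge> 3"
  shows "\<exists>u v. (u, v) \<in> parcs G \<and> u \<noteq> v \<and> (v, u) \<in> (parcs G - {(u, v), (v, u)})\<^sup>*"
proof -
  interpret pair_wf_digraph G using wf by (simp add: with_proj_wf)
  obtain u where aw: "awalk u c u" and dist: "distinct (tl (pawalk_verts u c))" and "c \<noteq> []"
    using assms(2) by (auto simp: cycle_def)
  obtain v q where c: "c = (u, v) # q"
    using aw \<open>c \<noteq> []\<close> by (cases c) (auto simp: awalk_def)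
  have arc: "(u, v) \<in> parcs G" and awq: "awalk v q u" using aw c by (auto simp: awalk_Cons_iff)
  have dq: "distinct (pawalk_verts v q)" using dist c by simp
  have verts_q: "pawalk_verts v q = v # map snd q" if "pcas v q u" for v q
    using that by (induction q arbitrary: v) auto
  have cas: "pcas v q u" using awq by (auto simp: awalk_def)
  have dist_q: "distinct (v # map snd q)" using dq verts_q[OF cas] by simp
  have lq: "length q \<ge> 2" using assms(3) c by simp
  have last: "snd (last q) = u" if "pcas v q u" "q \<noteq> []" for v q
    using that by (induction q arbitrary: v) (auto split: if_splits)
  have uv: "u \<noteq> v" using dist_q last[OF cas] lq
    by (metis distinct.simps(2) image_eqI last_in_set list.size(3) not_numeral_le_zero set_map)
  have walk: "(v, u) \<in> (set q)\<^sup>*" if "pcas v q u" for v q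
    using that
  proof (induction q arbitrary: v)
    case (Cons e q)
    then have "(snd e, u) \<in> (set q)\<^sup>*" by auto
    then have "(snd e, u) \<in> (set (e # q))\<^sup>*" by (rule rtrancl_mono[THEN subsetD, rotated]) auto
    moreover have "(v, snd e) \<in> set (e # q)" using Cons(2) by (cases e) auto
    ultimately show ?case by (metis converse_rtrancl_into_rtrancl)
  qed auto
  have "(u, v) \<notin> set q" using dist_q by force
  \<comment> \<open>As the first arc of \<open>q\<close> it would reach \<open>u\<close>, which by
    distinctness occurs only at the end of \<open>q\<close>, while \<open>q\<close> has a second
    arc. Further on, its tail \<open>v\<close> would be the head of an earlier arc of
    \<open>q\<close>, a repetition of \<open>v\<close>.\<close>
  moreover have "(v, u) \<notin> set q"
  proof
    assume mem: "(v, u) \<in> set q"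
    obtain e q' where q: "q = e # q'" "q' \<noteq> []"
      using lq by (cases q; cases "tl q") auto
    have "fst e = v" using cas q by simp
    have "snd (last q') = u" using last[of "snd e" q'] cas q by simp
    then have "u \<in> set (map snd q')" using q(2) by (metis image_eqI last_in_set set_map)
    then have "snd e \<noteq> u" using dist_q q by auto
    then have "(v, u) \<in> set q'" using mem q by (cases e) auto
    have *: "v \<in> insert (snd e) (set (map snd q'))" if "pcas w q' u'" "(v, u) \<in> set q'" "w = snd e" for w u'
    proof -
      have "fst x \<in> insert w (set (map snd q'))" if "pcas w q' u'" "x \<in> set q'" for x w
        using that by (induction q' arbitrary: w) auto
      from this[OF that(1,2)] that(3) show ?thesis by simp
    qed
    have "v \<in> set (map snd q)" using *[OF _ \<open>(v, u) \<in> set q'\<close>, of "snd e" u] cas q by auto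
    then show False using dist_q by simp
  qed
  moreover have "set q \<subseteq> parcs G" using awq by (auto simp: awalk_def)
  ultimately have "set q \<subseteq> parcs G - {(u, v), (v, u)}" by auto
  then have "(v, u) \<in> (parcs G - {(u, v), (v, u)})\<^sup>*"
    using walk[OF cas] rtrancl_mono by blast
  then show ?thesis using arc uv by blast
qed

text \<open>A simple path from \<open>v\<close> to \<open>u\<close> that avoids both orientations of
  the edge has at least two arcs, so closing it with \<open>(u, v)\<close> gives a cycle of the
  required length.\<close>

lemma removable_imp_cycle:
  assumes wf: "wf_digraph (with_proj G)" and arc: "(u, v) \<in> parcs G" "u \<noteq> v"
    and reach: "(v, u) \<in> (parcs G - {(u, v), (v, u)})\<^sup>*"
  shows "\<exists>c. pre_digraph.cycle (with_proj G) c \<and> length c \<ge> 3"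
proof -
  interpret pair_wf_digraph G using wf by (simp add: with_proj_wf)
  let ?H = "\<lparr>pverts = pverts G, parcs = parcs G - {(u, v), (v, u)}\<rparr>"
  interpret H: pair_wf_digraph ?H
    by unfold_locales (auto dest: in_arcsD1 in_arcsD2)
  have "v \<in> pverts G" using arc in_arcsD2 by blast
  have "v \<rightarrow>\<^sup>*\<^bsub>with_proj ?H\<^esub> x" if "(v, x) \<in> (parcs ?H)\<^sup>*" for x
    using that
  proof (induction rule: rtrancl_induct)
    case base
    show ?case using \<open>v \<in> pverts G\<close> by (simp add: H.reachable_refl)
  next
    case (step y z)
    show ?case by (rule H.reachable_adj_trans[OF step.IH step.hyps(2)])
  qed
  with reach have "v \<rightarrow>\<^sup>*\<^bsub>with_proj ?H\<^esub> u" by simp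
  then obtain q where q: "H.apath v q u" using H.reachable_apath by blast
  have aq: "awalk v q u" using q by (auto simp: H.apath_def H.awalk_def awalk_def)
  have dq: "distinct (pawalk_verts v q)" using q by (auto simp: H.apath_def)
  have sub: "set q \<subseteq> parcs G - {(u, v), (v, u)}" using q by (auto simp: H.apath_def H.awalk_def)
  have "q \<noteq> []" using aq arc(2) by (auto simp: awalk_def)
  moreover have "\<nexists>e. q = [e]" using aq sub by (auto simp: awalk_def)
  ultimately have "length q \<ge> 2" by (cases q; cases "tl q") auto
  moreover have "cycle ((u, v) # q)"
    unfolding cycle_def using aq arc dq by (auto simp: awalk_Cons_iff intro!: exI[of _ u])
  ultimately show ?thesis by (intro exI[of _ "(u, v) # q"]) auto
qed

text \<open>Comparison with a spanning tree: an arc outside of it closes a cycle. Conversely, an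
  edge of a cycle can be deleted without losing connectedness, and the remaining graph would have
  too few arcs. Each edge counts as two arcs.\<close>

lemma undirected_tree_iff_card:
  assumes wf: "wf_digraph (with_proj G)" and fin: "finite (pverts G)" "finite (parcs G)"
    and sym: "sym (parcs G)" and irr: "irrefl (parcs G)"
    and conn: "Digraph_Component.connected (with_proj G)"
  shows "undirected_tree G \<longleftrightarrow> card (parcs G) = 2 * (card (pverts G) - 1)"
proof
  interpret pair_wf_digraph G using wf by (simp add: with_proj_wf)
  assume tree: "undirected_tree G"
  obtain r p where p: "rooted_tree r p (pverts G)"
    "(\<lambda>v. (v, p v)) ` (pverts G - {r}) \<union> (\<lambda>v. (p v, v)) ` (pverts G - {r}) \<subseteq> parcs G"
    (is "?E \<subseteq> _") using undirected_spanning_tree[OF wf fin(1) sym conn] by blast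
  have symE: "(x, y) \<in> ?E\<^sup>* \<Longrightarrow> (y, x) \<in> ?E\<^sup>*" for x y
    by (rule symD[OF sym_rtrancl]) (auto simp: sym_def)
  have reach: "(v, r) \<in> ?E\<^sup>*" if "v \<in> pverts G" for v
  proof -
    have "V \<subseteq> pverts G \<Longrightarrow> v \<in> V \<Longrightarrow> (v, r) \<in> ?E\<^sup>*" if "rooted_tree r p V" for V v
      using that
    proof (induction arbitrary: v rule: rooted_tree.induct)
      case (leaf V w)
      have "w \<noteq> r" using rooted_tree_root[OF leaf.hyps(1)] leaf.hyps(2) by blast
      then show ?case using leaf by (cases "v = w") (auto intro: converse_rtrancl_into_rtrancl)
    qed auto
    then show ?thesis using p(1) that by blast
  qed
  have "?E = parcs G"
  proof (rule ccontr)
    assume "?E \<noteq> parcs G"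
    then obtain u v where uv: "(u, v) \<in> parcs G" "(u, v) \<notin> ?E" using p(2) by auto
    then have vu: "(v, u) \<notin> ?E" by auto
    have "(v, r) \<in> ?E\<^sup>*" "(r, u) \<in> ?E\<^sup>*"
      using uv reach symE by (auto dest: in_arcsD1 in_arcsD2)
    then have "(v, u) \<in> ?E\<^sup>*" by simp
    moreover have "?E \<subseteq> parcs G - {(u, v), (v, u)}" using p(2) uv vu by blast
    ultimately have "(v, u) \<in> (parcs G - {(u, v), (v, u)})\<^sup>*" using rtrancl_mono by blast
    moreover have "u \<noteq> v" using irr uv by (auto simp: irrefl_def)
    ultimately show False
      using removable_imp_cycle[OF wf uv(1)] tree by (auto simp: undirected_tree_def)
  qed
  then show "card (parcs G) = 2 * (card (pverts G) - 1)"
    using card_tree_arcs[OF p(1)] by simp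
next
  assume card: "card (parcs G) = 2 * (card (pverts G) - 1)"
  interpret pair_wf_digraph G using wf by (simp add: with_proj_wf)
  show "undirected_tree G"
  proof (rule ccontr)
    assume "\<not> undirected_tree G"
    then obtain c where "pre_digraph.cycle (with_proj G) c" "length c \<ge> 3"
      using conn by (auto simp: undirected_tree_def)
    from cycle_imp_removable[OF wf this] obtain u v
      where uv: "(u, v) \<in> parcs G" "u \<noteq> v" "(v, u) \<in> (parcs G - {(u, v), (v, u)})\<^sup>*" by blast
    let ?H = "\<lparr>pverts = pverts G, parcs = parcs G - {(u, v), (v, u)}\<rparr>"
    have wfH: "wf_digraph (with_proj ?H)"
      by unfold_locales (auto simp: in_arcsD1 in_arcsD2)
    have "Digraph_Component.connected (with_proj ?H)"
      unfolding connected_iff_cut[OF wfH]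
    proof (intro conjI allI impI)
      show "verts (with_proj ?H) \<noteq> {}" using uv in_arcsD1 by auto
      fix U assume U: "U \<subset> verts (with_proj ?H) \<and> U \<noteq> {}"
      show "\<exists>e\<in>arcs (with_proj ?H).
          (tail (with_proj ?H) e \<in> U) \<noteq> (head (with_proj ?H) e \<in> U)"
      proof (rule ccontr)
        assume no: "\<not> ?thesis"
        \<comment> \<open>The bypass keeps \<open>u\<close> and \<open>v\<close> on the same side of
          a set that no remaining arc crosses, so the deleted edge does not cross it either.\<close>
        have inv: "(x \<in> U) = (y \<in> U)" if "(x, y) \<in> (parcs G - {(u, v), (v, u)})\<^sup>*" for x y
          using that by (induction rule: rtrancl_induct) (use no in force)+
        obtain e where "e \<in> parcs G" "(fst e \<in> U) \<noteq> (snd e \<in> U)"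
          using connected_cutE[OF wf conn, of U] U by auto
        then have "e \<in> {(u, v), (v, u)}" using no by force
        then show False using inv[OF uv(3)] \<open>(fst e \<in> U) \<noteq> (snd e \<in> U)\<close> by auto
      qed
    qed
    moreover have "sym (parcs ?H)" using sym by (auto simp: sym_def)
    ultimately have "2 * (card (pverts G) - 1) \<le> card (parcs ?H)"
      using undirected_card_arcs_ge[OF wfH] fin by simp
    moreover have "card (parcs ?H) < card (parcs G)"
      using uv fin psubset_card_mono[OF fin(2), of "parcs ?H"] by auto
    ultimately show False using card by simp
  qed
qed


section \<open>Components of one colour, and the vertex and edge count of the component
  graph\<close>

section \<open>Colored components and double trees\<close>

lemma connected_single_arc:
  assumes "wf_digraph G" "e \<in> arcs G"
  shows "Digraph_Component.connected \<lparr>verts = {tail G e, head G e}, arcs = {e}, tail = tail G, head = head G\<rparr>"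
    (is "Digraph_Component.connected ?H")
proof -
  have "wf_digraph ?H" by unfold_locales auto
  then show ?thesis unfolding connected_iff_cut[OF \<open>wf_digraph ?H\<close>] by auto
qed

lemma connected_union:
  assumes "wf_digraph G" "wf_digraph H" "tail G = tail H" "head G = head H"
    "Digraph_Component.connected G" "Digraph_Component.connected H" "verts G \<inter> verts H \<noteq> {}"
  shows "wf_digraph (union G H)" "Digraph_Component.connected (union G H)"
proof -
  interpret G: wf_digraph G by fact
  interpret H: wf_digraph H by fact
  have th: "tail (union G H) = tail G" "head (union G H) = head G"
    "verts (union G H) = verts G \<union> verts H" "arcs (union G H) = arcs G \<union> arcs H"
    by (simp_all add: union_def)
  show wf: "wf_digraph (union G H)"
    by unfold_locales
      (use G.tail_in_verts G.head_in_verts H.tail_in_verts H.head_in_verts th assms(3,4) in auto)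
  show "Digraph_Component.connected (union G H)"
    unfolding connected_iff_cut[OF wf]
  proof (intro conjI allI impI)
    fix U assume U: "U \<subset> verts (union G H) \<and> U \<noteq> {}"
    show "\<exists>e\<in>arcs (union G H). (tail (union G H) e \<in> U) \<noteq> (head (union G H) e \<in> U)"
    proof (rule ccontr)
      assume no: "\<not> ?thesis"
      have 1: "U \<inter> verts G = {} \<or> U \<inter> verts G = verts G"
      proof (rule ccontr)
        assume "\<not> ?thesis"
        then obtain e where "e \<in> arcs G" "(tail G e \<in> U \<inter> verts G) \<noteq> (head G e \<in> U \<inter> verts G)"
          using connected_cutE[OF assms(1,5), of "U \<inter> verts G"] by blast
        then show False using no th by auto
      qed
      have 2: "U \<inter> verts H = {} \<or> U \<inter> verts H = verts H"
      proof (rule ccontr)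
        assume "\<not> ?thesis"
        then obtain e where "e \<in> arcs H" "(tail H e \<in> U \<inter> verts H) \<noteq> (head H e \<in> U \<inter> verts H)"
          using connected_cutE[OF assms(2,6), of "U \<inter> verts H"] by blast
        then show False using no th assms(3,4) by auto
      qed
      from 1 2 U assms(7) show False unfolding th by blast
    qed
  qed (use assms(7) th in auto)
qed

locale colored_graph =
  fixes T :: "('v, 'e) pre_digraph" and \<gamma> :: "'e \<Rightarrow> 'i" and K :: "'k set" and J :: "'k \<Rightarrow> 'i set"
  assumes T: "test_graph T \<gamma> (\<Union>k\<in>K. J k)" and disj: "disjoint_family_on J K"
begin

sublocale fin_digraph T using T by (simp add: test_graph_def)

lemma connected_T: "Digraph_Component.connected T" using T by (simp add: test_graph_def)

abbreviation "Lab k \<equiv> label_subgraph T \<gamma> (J k)"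
abbreviation "comps \<equiv> color_components T \<gamma> K J"

definition component_of :: "'k \<Rightarrow> ('v, 'e) pre_digraph \<Rightarrow> bool" where
  "component_of k C \<longleftrightarrow> pre_digraph.max_subgraph (Lab k) Digraph_Component.connected C"

lemma comps_iff: "C \<in> comps \<longleftrightarrow> (\<exists>k\<in>K. component_of k C)"
  by (auto simp: color_components_def component_of_def)

lemma Lab_simps [simp]:
  "verts (Lab k) = tail T ` {e \<in> arcs T. \<gamma> e \<in> J k} \<union> head T ` {e \<in> arcs T. \<gamma> e \<in> J k}"
  "arcs (Lab k) = {e \<in> arcs T. \<gamma> e \<in> J k}" "tail (Lab k) = tail T" "head (Lab k) = head T"
  by (auto simp: label_subgraph_def Let_def)

lemma wf_Lab: "wf_digraph (Lab k)"
  by unfold_locales auto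

lemma subgraph_LabD:
  assumes "subgraph H (Lab k)"
  shows "verts H \<subseteq> verts T" "arcs H \<subseteq> arcs T" "tail H = tail T" "head H = head T"
    "\<And>e. e \<in> arcs H \<Longrightarrow> \<gamma> e \<in> J k" "fin_digraph H" "wf_digraph H"
proof -
  have "verts (Lab k) \<subseteq> verts T" by auto
  then show "verts H \<subseteq> verts T" using assms unfolding subgraph_def by blast
  show "arcs H \<subseteq> arcs T" "tail H = tail T" "head H = head T"
    "\<And>e. e \<in> arcs H \<Longrightarrow> \<gamma> e \<in> J k" and wf: "wf_digraph H"
    using assms by (auto simp: subgraph_def compatible_def)
  note \<open>verts H \<subseteq> verts T\<close> \<open>arcs H \<subseteq> arcs T\<close>
  then have "finite (verts H)" "finite (arcs H)" by (auto intro: finite_subset)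
  then show "fin_digraph H" using wf by (simp add: fin_digraph_def fin_digraph_axioms_def)
qed

lemma component_ofD:
  assumes "component_of k C"
  shows "subgraph C (Lab k)" "Digraph_Component.connected C"
    "\<And>H. subgraph H (Lab k) \<Longrightarrow> Digraph_Component.connected H \<Longrightarrow> subgraph C H \<Longrightarrow> H = C"
  using assms by (auto simp: component_of_def pre_digraph.max_subgraph_def)

text \<open>The union of two connected subgraphs of one colour that meet is connected and of the
  same colour, so maximality of \<open>C\<close> leaves nothing to add.\<close>

lemma component_of_absorb:
  assumes "component_of k C" "subgraph H (Lab k)" "Digraph_Component.connected H"
    "verts H \<inter> verts C \<noteq> {}"
  shows "verts H \<subseteq> verts C \<and> arcs H \<subseteq> arcs C"
proof -
  note C = component_ofD[OF assms(1)]
  note sC = subgraph_LabD[OF C(1)] and sH = subgraph_LabD[OF assms(2)]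
  have U: "wf_digraph (union C H)" "Digraph_Component.connected (union C H)"
    using connected_union[of C H] C(2) sC sH assms(3,4) by auto
  have un: "verts (union C H) = verts C \<union> verts H" "arcs (union C H) = arcs C \<union> arcs H"
    "tail (union C H) = tail C" "head (union C H) = head C" by (simp_all add: union_def)
  have "subgraph (union C H) (Lab k)"
    using C(1) assms(2) U(1) un unfolding subgraph_def compatible_def by auto
  moreover have "subgraph C (union C H)"
    using C(1) U(1) un unfolding subgraph_def compatible_def by auto
  ultimately have "union C H = C" using C(3) U(2) by blast
  then show ?thesis using un by auto
qed

lemma digraph_eqI:
  "verts G = verts H \<Longrightarrow> arcs G = arcs H \<Longrightarrow> tail G = tail H \<Longrightarrow> head G = head H \<Longrightarrow>
    (G :: ('v, 'e) pre_digraph) = H"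
  by simp

lemma component_of_eqI:
  assumes "component_of k C" "component_of k C'" "verts C \<inter> verts C' \<noteq> {}"
  shows "C = C'"
proof -
  note C = component_ofD[OF assms(1)] and C' = component_ofD[OF assms(2)]
  have "verts C' \<subseteq> verts C \<and> arcs C' \<subseteq> arcs C"
    using component_of_absorb[OF assms(1) C'(1,2)] assms(3) by blast
  moreover have "verts C \<subseteq> verts C' \<and> arcs C \<subseteq> arcs C'"
    using component_of_absorb[OF assms(2) C(1,2)] assms(3) by blast
  ultimately show ?thesis
    using subgraph_LabD[OF C(1)] subgraph_LabD[OF C'(1)] by (intro digraph_eqI) auto
qed

text \<open>Among the connected subgraphs of this colour that contain \<open>e\<close>, one with the
  largest number of vertices and arcs together is maximal; both are counted because the subgraph
  order compares both.\<close>

lemma ex_component_of: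
  assumes e: "e \<in> arcs T" "\<gamma> e \<in> J k"
  shows "\<exists>C. component_of k C \<and> e \<in> arcs C"
proof -
  define P where "P H \<longleftrightarrow> subgraph H (Lab k) \<and> Digraph_Component.connected H \<and> e \<in> arcs H" for H
  define m where "m H = card (verts H) + card (arcs H)" for H :: "('v, 'e) pre_digraph"
  let ?H = "\<lparr>verts = {tail T e, head T e}, arcs = {e}, tail = tail T, head = head T\<rparr>"
  have "wf_digraph ?H" by unfold_locales auto
  then have "subgraph ?H (Lab k)"
    using e wf_Lab[of k] by (auto simp: subgraph_def compatible_def)
  then have "P ?H" using connected_single_arc[OF wf_digraph e(1)] by (simp add: P_def)
  moreover have "m H < Suc (card (verts T) + card (arcs T))" if "P H" for H
  proof -
    have "verts H \<subseteq> verts T" "arcs H \<subseteq> arcs T"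
      using that subgraph_LabD(1,2)[of H k] by (auto simp: P_def)
    then have "card (verts H) \<le> card (verts T)" "card (arcs H) \<le> card (arcs T)"
      by (auto intro: card_mono)
    then show ?thesis by (simp add: m_def)
  qed
  ultimately obtain C where C: "P C" "\<And>H. P H \<Longrightarrow> m H \<le> m C"
    using ex_has_greatest_nat[of P ?H m "Suc (card (verts T) + card (arcs T))"] by blast
  have "H = C" if H: "subgraph H (Lab k)" "Digraph_Component.connected H" "subgraph C H" for H
  proof -
    have sub: "verts C \<subseteq> verts H" "arcs C \<subseteq> arcs H" using H(3) by (auto simp: subgraph_def)
    then have "P H" using H C(1) by (auto simp: P_def)
    from C(2)[OF this] have le: "m H \<le> m C" .
    interpret H: fin_digraph H by (rule subgraph_LabD(6)[OF H(1)])
    have "card (verts C) \<le> card (verts H)" "card (arcs C) \<le> card (arcs H)"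
      using sub by (auto intro: card_mono)
    then have "card (verts C) = card (verts H)" "card (arcs C) = card (arcs H)"
      using le by (auto simp: m_def)
    then have "verts C = verts H" "arcs C = arcs H"
      using sub card_subset_eq[OF H.finite_verts] card_subset_eq[OF H.finite_arcs] by blast+
    then show ?thesis
      using subgraph_LabD[OF H(1)] subgraph_LabD[of C k] C(1) by (intro digraph_eqI) (auto simp: P_def)
  qed
  then have "component_of k C"
    using C(1) by (auto simp: component_of_def pre_digraph.max_subgraph_def P_def)
  then show ?thesis using C(1) by (auto simp: P_def)
qed

lemma compsE:
  assumes "C \<in> comps"
  obtains k where "k \<in> K" "component_of k C" "verts C \<subseteq> verts T" "arcs C \<subseteq> arcs T"
    "tail C = tail T" "head C = head T" "test_graph C \<gamma> (J k)"
proof -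
  obtain k where k: "k \<in> K" "component_of k C" using assms comps_iff by blast
  note C = component_ofD[OF k(2)]
  show ?thesis
    by (rule that[OF k]) (use C subgraph_LabD[OF C(1)] in \<open>auto simp: test_graph_def\<close>)
qed

lemma color_unique: "i \<in> J k \<Longrightarrow> i \<in> J k' \<Longrightarrow> k \<in> K \<Longrightarrow> k' \<in> K \<Longrightarrow> k = k'"
  using disj by (auto simp: disjoint_family_on_def)

lemma arc_in_comp:
  assumes "e \<in> arcs T" shows "\<exists>C\<in>comps. e \<in> arcs C"
proof -
  obtain k where "k \<in> K" "\<gamma> e \<in> J k" using T assms by (auto simp: test_graph_def)
  then show ?thesis using ex_component_of[OF assms] comps_iff by blast
qed

text \<open>Hence parallel arcs of equal label never lie in different components: arc classes, and
  with them twins, are inherited by the components.\<close>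

lemma comp_absorbs_arc:
  assumes "C \<in> comps" "e \<in> arcs C" "e' \<in> arcs T" "\<gamma> e' = \<gamma> e"
    "{tail T e', head T e'} \<inter> verts C \<noteq> {}"
  shows "e' \<in> arcs C"
proof -
  obtain k where k: "k \<in> K" "component_of k C" "test_graph C \<gamma> (J k)" using compsE[OF assms(1)] by metis
  then have "\<gamma> e' \<in> J k" using assms by (auto simp: test_graph_def)
  then obtain C' where C': "component_of k C'" "e' \<in> arcs C'"
    using ex_component_of[OF assms(3)] by blast
  then have "{tail T e', head T e'} \<subseteq> verts C'"
    using subgraph_LabD(3,4,7)[OF component_ofD(1)[OF C'(1)]]
    by (metis empty_subsetI insert_subset wf_digraph.head_in_verts wf_digraph.tail_in_verts)
  then have "C' = C" using component_of_eqI[OF C'(1) k(2)] assms(5) by blast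
  then show ?thesis using C' by simp
qed

lemma comps_arcs_disjoint:
  assumes "C \<in> comps" "C' \<in> comps" "e \<in> arcs C" "e \<in> arcs C'"
  shows "C = C'"
proof -
  obtain k where k: "k \<in> K" "component_of k C" "test_graph C \<gamma> (J k)" "tail C = tail T"
    using compsE[OF assms(1)] by metis
  obtain k' where k': "k' \<in> K" "component_of k' C'" "test_graph C' \<gamma> (J k')" "tail C' = tail T"
    using compsE[OF assms(2)] by metis
  have "k = k'" using color_unique k k' assms(3,4) by (auto simp: test_graph_def)
  moreover have "tail T e \<in> verts C \<inter> verts C'"
    using k k' assms(3,4) unfolding test_graph_def fin_digraph_def
    by (metis IntI wf_digraph.tail_in_verts)
  ultimately show ?thesis using component_of_eqI k k' by blast
qed

lemma comp_vert_arc: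
  assumes "C \<in> comps" "v \<in> verts C" shows "\<exists>e\<in>arcs C. v \<in> {tail T e, head T e}"
proof -
  obtain k where k: "k \<in> K" "component_of k C" using assms comps_iff by blast
  have "v \<in> verts (Lab k)" using component_ofD(1)[OF k(2)] assms(2) by (auto simp: subgraph_def)
  then obtain e where e: "e \<in> arcs T" "\<gamma> e \<in> J k" "v \<in> {tail T e, head T e}" by auto
  obtain C' where C': "component_of k C'" "e \<in> arcs C'" using ex_component_of[OF e(1,2)] by blast
  then have "v \<in> verts C'"
    using subgraph_LabD(3,4,7)[OF component_ofD(1)[OF C'(1)]] e(3)
    by (metis empty_iff insert_iff wf_digraph.head_in_verts wf_digraph.tail_in_verts)
  then have "C' = C" using component_of_eqI[OF C'(1) k(2)] assms(2) by blast
  then show ?thesis using C' e by blast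
qed

lemma finite_comps: "finite comps"
proof (rule finite_subset)
  show "comps \<subseteq> (\<lambda>(V, E). \<lparr>verts = V, arcs = E, tail = tail T, head = head T\<rparr>) `
    (Pow (verts T) \<times> Pow (arcs T))"
  proof
    fix C assume "C \<in> comps"
    then have "C = \<lparr>verts = verts C, arcs = arcs C, tail = tail T, head = head T\<rparr>"
      "verts C \<subseteq> verts T" "arcs C \<subseteq> arcs T"
      by (auto elim!: compsE)
    then show "C \<in> (\<lambda>(V, E). \<lparr>verts = V, arcs = E, tail = tail T, head = head T\<rparr>) `
      (Pow (verts T) \<times> Pow (arcs T))" by (intro image_eqI[of _ _ "(verts C, arcs C)"]) auto
  qed
qed simp

lemma comp_arcs_nonempty: "C \<in> comps \<Longrightarrow> arcs C \<noteq> {} \<and> verts C \<noteq> {}"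
proof -
  assume C: "C \<in> comps"
  then obtain k where "test_graph C \<gamma> (J k)" by (metis compsE)
  then have "verts C \<noteq> {}" using connected_iff_cut[of C] by (auto simp: test_graph_def fin_digraph_def)
  then show ?thesis using comp_vert_arc[OF C] by blast
qed

lemma vert_in_comp:
  assumes "arcs T \<noteq> {}" "v \<in> verts T" shows "\<exists>C\<in>comps. v \<in> verts C"
proof -
  have "\<exists>e\<in>arcs T. v \<in> {tail T e, head T e}"
  proof (cases "{v} = verts T")
    case True
    then show ?thesis using assms(1) tail_in_verts by (metis ex_in_conv insertI1 singletonD)
  next
    case False
    then obtain e where "e \<in> arcs T" "(tail T e \<in> {v}) \<noteq> (head T e \<in> {v})"
      using connected_cutE[OF wf_digraph connected_T, of "{v}"] assms(2) by auto
    then show ?thesis by auto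
  qed
  then obtain e where e: "e \<in> arcs T" "v \<in> {tail T e, head T e}" by blast
  then obtain C where C: "C \<in> comps" "e \<in> arcs C" using arc_in_comp by blast
  then have "v \<in> verts C"
    using e by (elim compsE) (auto simp: test_graph_def fin_digraph_def
      dest: wf_digraph.head_in_verts wf_digraph.tail_in_verts)
  then show ?thesis using C by blast
qed

lemma sum_card_arcs: "(\<Sum>C\<in>comps. card (arcs C)) = card (arcs T)"
proof -
  have "arcs T = (\<Union>C\<in>comps. arcs C)" using arc_in_comp by (auto elim!: compsE)
  moreover have "card (\<Union>C\<in>comps. arcs C) = (\<Sum>C\<in>comps. card (arcs C))"
  proof (rule card_UN_disjoint[OF finite_comps])
    show "\<forall>C\<in>comps. finite (arcs C)"
      by (auto elim!: compsE intro: finite_subset[OF _ finite_arcs])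
    show "\<forall>C\<in>comps. \<forall>C'\<in>comps. C \<noteq> C' \<longrightarrow> arcs C \<inter> arcs C' = {}"
      using comps_arcs_disjoint by blast
  qed
  ultimately show ?thesis by simp
qed

definition "shared = {v \<in> verts T. \<exists>C\<in>comps. \<exists>C'\<in>comps. C \<noteq> C' \<and> v \<in> verts C \<and> v \<in> verts C'}"

abbreviation "cgraph \<equiv> component_graph T \<gamma> K J"

lemma pverts_cgraph: "pverts cgraph = Inl ` comps \<union> Inr ` shared"
  and parcs_cgraph: "parcs cgraph = (\<Union>C\<in>comps. \<Union>v\<in>shared \<inter> verts C. {(Inl C, Inr v), (Inr v, Inl C)})"
  by (simp_all add: component_graph_def shared_def Let_def)

lemma finite_shared: "finite shared" by (simp add: shared_def)

lemma wf_cgraph: "wf_digraph (with_proj cgraph)"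
  by unfold_locales (auto simp: pverts_cgraph parcs_cgraph)

lemma sym_cgraph: "sym (parcs cgraph)"
  by (auto simp: sym_def parcs_cgraph)

lemma irrefl_cgraph: "irrefl (parcs cgraph)"
  by (auto simp: irrefl_def parcs_cgraph)

lemma card_pverts_cgraph: "card (pverts cgraph) = card comps + card shared"
  unfolding pverts_cgraph using finite_comps finite_shared
  by (subst card_Un_disjoint) (auto simp: card_image)

lemma card_parcs_cgraph:
  "finite (parcs cgraph)" "card (parcs cgraph) = 2 * (\<Sum>C\<in>comps. card (shared \<inter> verts C))"
proof -
  let ?P = "Sigma comps (\<lambda>C. shared \<inter> verts C)"
  have eq: "parcs cgraph = (\<lambda>(C, v). (Inl C, Inr v)) ` ?P \<union> (\<lambda>(C, v). (Inr v, Inl C)) ` ?P"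
    by (auto simp: parcs_cgraph image_iff)
  have fin: "finite ?P" using finite_comps finite_shared by blast
  then show "finite (parcs cgraph)" unfolding eq by simp
  have "card (parcs cgraph) = card ?P + card ?P"
    unfolding eq using fin
    by (subst card_Un_disjoint) (auto simp: card_image inj_on_def split: prod.splits)
  also have "card ?P = (\<Sum>C\<in>comps. card (shared \<inter> verts C))"
    using finite_comps finite_shared by (simp add: card_SigmaI)
  finally show "card (parcs cgraph) = 2 * (\<Sum>C\<in>comps. card (shared \<inter> verts C))" by simp
qed

text \<open>A cut of the component graph would give a cut of \<open>T\<close>. Components that meet
  lie on the same side, as their common vertex is shared, so no arc of \<open>T\<close>, lying
  inside one component, can leave the set of vertices covered by one side.\<close>

lemma connected_cgraph:
  assumes "arcs T \<noteq> {}" shows "Digraph_Component.connected (with_proj cgraph)"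
  unfolding connected_iff_cut[OF wf_cgraph]
proof (intro conjI allI impI)
  show "verts (with_proj cgraph) \<noteq> {}" using assms arc_in_comp by (auto simp: pverts_cgraph)
  fix U assume U: "U \<subset> verts (with_proj cgraph) \<and> U \<noteq> {}"
  show "\<exists>e\<in>arcs (with_proj cgraph).
    (tail (with_proj cgraph) e \<in> U) \<noteq> (head (with_proj cgraph) e \<in> U)"
  proof (rule ccontr)
    assume no: "\<not> ?thesis"
    have same: "Inl C \<in> U \<longleftrightarrow> Inr v \<in> U" if "C \<in> comps" "v \<in> shared" "v \<in> verts C" for C v
    proof -
      have "(Inl C, Inr v) \<in> parcs cgraph" using that by (auto simp: parcs_cgraph)
      then show ?thesis using no by force
    qed
    have meet: "Inl C \<in> U \<longleftrightarrow> Inl C' \<in> U"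
      if "C \<in> comps" "C' \<in> comps" "v \<in> verts C" "v \<in> verts C'" for C C' v
    proof (cases "C = C'")
      case False
      have "v \<in> verts T" using that(1,3) by (auto elim!: compsE)
      then have "v \<in> shared" using that False by (auto simp: shared_def)
      then show ?thesis using same that by metis
    qed simp
    define VU where "VU = (\<Union>C\<in>{C \<in> comps. Inl C \<in> U}. verts C)"
    have sub: "VU \<subseteq> verts T" by (auto simp: VU_def elim!: compsE)
    have shD: "v \<in> shared \<Longrightarrow> \<exists>C\<in>comps. v \<in> verts C" for v by (auto simp: shared_def)
    \<comment> \<open>Each side of the cut contains a component: a shared vertex on that side brings
      along the components through it.\<close>
    obtain C0 where C0: "C0 \<in> comps" "Inl C0 \<in> U"
    proof -
      obtain x where x: "x \<in> U" "x \<in> Inl ` comps \<union> Inr ` shared"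
        using U unfolding with_proj_simps pverts_cgraph by blast
      from x(2) show ?thesis
      proof
        assume "x \<in> Inr ` shared"
        then obtain v where v: "v \<in> shared" "x = Inr v" by blast
        then obtain C where "C \<in> comps" "v \<in> verts C" using shD by blast
        then show ?thesis using that same v x(1) by blast
      qed (use x(1) that in blast)
    qed
    obtain C1 where C1: "C1 \<in> comps" "Inl C1 \<notin> U"
    proof -
      obtain x where x: "x \<notin> U" "x \<in> Inl ` comps \<union> Inr ` shared"
        using U unfolding with_proj_simps pverts_cgraph by blast
      from x(2) show ?thesis
      proof
        assume "x \<in> Inr ` shared"
        then obtain v where v: "v \<in> shared" "x = Inr v" by blast
        then obtain C where "C \<in> comps" "v \<in> verts C" using shD by blast
        then show ?thesis using that same v x(1) by blast
      qed (use x(1) that in blast)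
    qed
    have "VU \<noteq> {}" using C0 comp_arcs_nonempty by (auto simp: VU_def)
    moreover have "VU \<noteq> verts T"
    proof
      assume "VU = verts T"
      obtain v where "v \<in> verts C1" using comp_arcs_nonempty C1 by blast
      then have "v \<in> VU" using C1 \<open>VU = verts T\<close> by (auto elim!: compsE)
      then obtain C where "C \<in> comps" "Inl C \<in> U" "v \<in> verts C" by (auto simp: VU_def)
      then show False using meet[of C C1 v] C1 \<open>v \<in> verts C1\<close> by simp
    qed
    ultimately obtain e where e: "e \<in> arcs T" "(tail T e \<in> VU) \<noteq> (head T e \<in> VU)"
      using connected_cutE[OF wf_digraph connected_T sub] by blast
    obtain C where C: "C \<in> comps" "e \<in> arcs C" using arc_in_comp[OF e(1)] by blast
    then have ends: "tail T e \<in> verts C" "head T e \<in> verts C"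
      by (elim compsE, simp add: test_graph_def fin_digraph_def,
          metis wf_digraph.head_in_verts wf_digraph.tail_in_verts)+
    have *: "w \<in> VU \<longleftrightarrow> Inl C \<in> U" if "w \<in> verts C" for w
      using that C(1) meet unfolding VU_def by blast
    show False using e(2) *[OF ends(1)] *[OF ends(2)] by simp
  qed
qed

text \<open>Unshared vertices lie in exactly one component, shared ones are counted with
  multiplicity on both sides. Adding \<open>card shared\<close> on the left avoids a subtraction of
  natural numbers.\<close>

lemma sum_card_verts:
  assumes "arcs T \<noteq> {}"
  shows "(\<Sum>C\<in>comps. card (verts C)) + card shared = (\<Sum>C\<in>comps. card (shared \<inter> verts C)) + card (verts T)"
proof -
  have fin: "finite (verts C)" if "C \<in> comps" for C
    using that by (auto elim!: compsE intro: finite_subset[OF _ finite_verts])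
  have "(\<Sum>C\<in>comps. card (verts C)) = (\<Sum>C\<in>comps. card (shared \<inter> verts C) + card (verts C - shared))"
  proof (rule sum.cong[OF refl])
    fix C assume "C \<in> comps"
    then have "card (shared \<inter> verts C) + card (verts C - shared) =
        card ((shared \<inter> verts C) \<union> (verts C - shared))"
      using fin by (intro card_Un_disjoint[symmetric]) auto
    also have "(shared \<inter> verts C) \<union> (verts C - shared) = verts C" by blast
    finally show "card (verts C) = card (shared \<inter> verts C) + card (verts C - shared)" by simp
  qed
  also have "\<dots> = (\<Sum>C\<in>comps. card (shared \<inter> verts C)) + (\<Sum>C\<in>comps. card (verts C - shared))"
    by (rule sum.distrib)
  also have "(\<Sum>C\<in>comps. card (verts C - shared)) = card (\<Union>C\<in>comps. verts C - shared)"
  proof (rule card_UN_disjoint[OF finite_comps, symmetric])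
    show "\<forall>C\<in>comps. finite (verts C - shared)" using fin by blast
    show "\<forall>C\<in>comps. \<forall>C'\<in>comps. C \<noteq> C' \<longrightarrow> (verts C - shared) \<inter> (verts C' - shared) = {}"
      using compsE unfolding shared_def by blast
  qed
  also have "(\<Union>C\<in>comps. verts C - shared) = verts T - shared"
    using vert_in_comp[OF assms] by (auto elim!: compsE)
  also have "card (verts T - shared) = card (verts T) - card shared"
    by (rule card_Diff_subset[OF finite_shared]) (auto simp: shared_def)
  also have "(\<Sum>C\<in>comps. card (shared \<inter> verts C)) + (card (verts T) - card shared) + card shared =
      (\<Sum>C\<in>comps. card (shared \<inter> verts C)) + card (verts T)"
    using card_mono[OF finite_verts, of shared] by (auto simp: shared_def)
  finally show ?thesis by simp
qed

text \<open>The edges of the component graph are the incidences of shared vertices with components.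
  A connected graph has at least as many edges as vertices minus one, with equality for trees; the
  count of vertices above turns this into a relation between \<open>T\<close> and its
  components.\<close>

lemma card_verts_le_comps:
  assumes "arcs T \<noteq> {}"
  shows "card (verts T) - 1 \<le> (\<Sum>C\<in>comps. card (verts C) - 1)"
    and "undirected_tree cgraph \<longleftrightarrow> card (verts T) - 1 = (\<Sum>C\<in>comps. card (verts C) - 1)"
proof -
  have finp: "finite (pverts cgraph)" unfolding pverts_cgraph using finite_comps finite_shared by simp
  let ?D = "\<Sum>C\<in>comps. card (shared \<inter> verts C)"
  have ne: "1 \<le> card (verts C)" if "C \<in> comps" for C
    using that comp_arcs_nonempty[OF that]
    by (auto elim!: compsE simp: Suc_le_eq card_gt_0_iff intro: finite_subset[OF _ finite_verts])
  have s: "(\<Sum>C\<in>comps. card (verts C) - 1) + card comps = (\<Sum>C\<in>comps. card (verts C))"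
  proof -
    have "(\<Sum>C\<in>comps. card (verts C) - 1) + card comps = (\<Sum>C\<in>comps. (card (verts C) - 1) + 1)"
      by (simp only: sum.distrib sum_constant of_nat_id mult_1_right)
    also have "\<dots> = (\<Sum>C\<in>comps. card (verts C))" 
      by (rule sum.cong[OF refl]) (use ne in \<open>metis le_add_diff_inverse2\<close>)
    finally show ?thesis .
  qed
  have c1: "card comps \<ge> 1"
    using arc_in_comp assms finite_comps by (metis all_not_in_conv card_0_eq less_one not_le)
  have v1: "card (verts T) \<ge> 1"
    using assms tail_in_verts by (metis all_not_in_conv card_0_eq finite_verts less_one not_le)
  have ge: "2 * (card comps + card shared - 1) \<le> 2 * ?D"
    using undirected_card_arcs_ge[OF wf_cgraph finp card_parcs_cgraph(1) sym_cgraph connected_cgraph[OF assms]]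
    unfolding card_pverts_cgraph card_parcs_cgraph(2) .
  show "card (verts T) - 1 \<le> (\<Sum>C\<in>comps. card (verts C) - 1)"
    using ge s sum_card_verts[OF assms] c1 v1 by linarith
  have "undirected_tree cgraph \<longleftrightarrow> 2 * ?D = 2 * (card comps + card shared - 1)"
    using undirected_tree_iff_card[OF wf_cgraph finp card_parcs_cgraph(1) sym_cgraph irrefl_cgraph connected_cgraph[OF assms]]
    unfolding card_pverts_cgraph card_parcs_cgraph(2) .
  then show "undirected_tree cgraph \<longleftrightarrow> card (verts T) - 1 = (\<Sum>C\<in>comps. card (verts C) - 1)"
    using s sum_card_verts[OF assms] c1 v1 by linarith
qed

end

section \<open>Graphs in which every arc other than a loop has a twin\<close>

subsection \<open>Double trees\<close>

text \<open>Under an injective map, two arcs have the same class exactly when they use the same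
  matrix entry up to complex conjugation.\<close>

definition arc_class :: "('v, 'e) pre_digraph \<Rightarrow> ('e \<Rightarrow> 'i) \<Rightarrow> 'e \<Rightarrow> 'i \<times> 'v set" where
  "arc_class T \<gamma> e = (\<gamma> e, {tail T e, head T e})"

text \<open>Loops are exempt because diagonal entries are not assumed to be centred.\<close>

definition no_lone_arcs :: "('v, 'e) pre_digraph \<Rightarrow> ('e \<Rightarrow> 'i) \<Rightarrow> bool" where
  "no_lone_arcs T \<gamma> \<longleftrightarrow> (\<forall>e\<in>arcs T. tail T e \<noteq> head T e \<longrightarrow>
     (\<exists>e'\<in>arcs T. e' \<noteq> e \<and> arc_class T \<gamma> e' = arc_class T \<gamma> e))"

text \<open>The number of arcs is the least possible one in a connected graph without lone arcs, see
  \<open>card_arcs_ge\<close>; in particular there are no loops.\<close>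

definition double_tree :: "('v, 'e) pre_digraph \<Rightarrow> ('e \<Rightarrow> 'i) \<Rightarrow> bool" where
  "double_tree T \<gamma> \<longleftrightarrow> no_lone_arcs T \<gamma> \<and> card (arcs T) = 2 * (card (verts T) - 1)"

text \<open>Every edge of a spanning tree is carried by an arc \<open>f v\<close>, which has a twin
  \<open>g v\<close>. Different edges have different end points, so all these arcs are distinct. In
  a double tree they exhaust the arcs; otherwise some arc is left over and supplies a small
  factor.\<close>

lemma spanning_twins:
  assumes "fin_digraph T" "Digraph_Component.connected T" "no_lone_arcs T \<gamma>"
  shows "\<exists>r p f g. rooted_tree r p (verts T) \<and>
    (\<forall>v\<in>verts T - {r}. f v \<in> arcs T \<and> g v \<in> arcs T \<and> f v \<noteq> g v \<and>
      arc_class T \<gamma> (f v) = (\<gamma> (f v), {v, p v}) \<and> arc_class T \<gamma> (g v) = (\<gamma> (f v), {v, p v})) \<and>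
    inj_on f (verts T - {r}) \<and> inj_on g (verts T - {r}) \<and>
    f ` (verts T - {r}) \<inter> g ` (verts T - {r}) = {} \<and>
    card (f ` (verts T - {r}) \<union> g ` (verts T - {r})) = 2 * (card (verts T) - 1)"
proof -
  interpret fin_digraph T by fact
  obtain r where r: "r \<in> verts T"
    using connected_iff_cut[OF wf_digraph] assms(2) by blast
  from ex_spanning_rooted_tree[OF wf_digraph finite_verts assms(2) r]
  obtain p where p: "rooted_tree r p (verts T)"
    "\<forall>v\<in>verts T - {r}. \<exists>e\<in>arcs T. {tail T e, head T e} = {v, p v}"
    by blast
  from bchoice[OF p(2)[unfolded Bex_def]]
  obtain f where f: "\<And>v. v \<in> verts T - {r} \<Longrightarrow> f v \<in> arcs T \<and> {tail T (f v), head T (f v)} = {v, p v}"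
    by blast
  have "\<exists>e'\<in>arcs T. e' \<noteq> f v \<and> arc_class T \<gamma> e' = arc_class T \<gamma> (f v)" if v: "v \<in> verts T - {r}" for v
  proof -
    have "p v \<noteq> v" using rooted_tree_parent[OF p(1) v] by blast
    then have "tail T (f v) \<noteq> head T (f v)" using f[OF v] by (auto simp: doubleton_eq_iff)
    then show ?thesis using assms(3) f[OF v] by (auto simp: no_lone_arcs_def)
  qed
  then have "\<forall>v\<in>verts T - {r}. \<exists>e'. e' \<in> arcs T \<and> e' \<noteq> f v \<and> arc_class T \<gamma> e' = arc_class T \<gamma> (f v)"
    by blast
  from bchoice[OF this] obtain g where g: "\<And>v. v \<in> verts T - {r} \<Longrightarrow>
    g v \<in> arcs T \<and> g v \<noteq> f v \<and> arc_class T \<gamma> (g v) = arc_class T \<gamma> (f v)" by blast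
  have inj: "inj_on (\<lambda>v. {v, p v}) (verts T - {r})" by (rule rooted_tree_edge_inj[OF p(1)])
  have cl: "{tail T (f v), head T (f v)} = {v, p v}" "{tail T (g v), head T (g v)} = {v, p v}"
    if "v \<in> verts T - {r}" for v using f[OF that] g[OF that] by (auto simp: arc_class_def)
  have eqI: "v = w" if "v \<in> verts T - {r}" "w \<in> verts T - {r}" "x \<in> {f v, g v}" "x \<in> {f w, g w}" for v w x
  proof -
    have "{v, p v} = {w, p w}" using that cl[OF that(1)] cl[OF that(2)] by auto
    with inj that(1,2) show ?thesis by (auto dest: inj_onD)
  qed
  have injs: "inj_on f (verts T - {r})" "inj_on g (verts T - {r})"
    using eqI by (auto intro!: inj_onI)
  have dis: "f ` (verts T - {r}) \<inter> g ` (verts T - {r}) = {}"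
  proof (rule equals0I)
    fix x assume "x \<in> f ` (verts T - {r}) \<inter> g ` (verts T - {r})"
    then obtain v w where vw: "v \<in> verts T - {r}" "w \<in> verts T - {r}" "x = f v" "x = g w" by blast
    then have "v = w" using eqI[of v w x] by simp
    then show False using vw g[OF vw(1)] by simp
  qed
  have "card (f ` (verts T - {r}) \<union> g ` (verts T - {r})) = 2 * (card (verts T) - 1)"
    using injs dis r by (subst card_Un_disjoint) (auto simp: card_image card_Diff_subset)
  moreover have "\<forall>v\<in>verts T - {r}. f v \<in> arcs T \<and> g v \<in> arcs T \<and> f v \<noteq> g v \<and>
      arc_class T \<gamma> (f v) = (\<gamma> (f v), {v, p v}) \<and> arc_class T \<gamma> (g v) = (\<gamma> (f v), {v, p v})"
  proof
    fix v assume v: "v \<in> verts T - {r}"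
    show "f v \<in> arcs T \<and> g v \<in> arcs T \<and> f v \<noteq> g v \<and>
      arc_class T \<gamma> (f v) = (\<gamma> (f v), {v, p v}) \<and> arc_class T \<gamma> (g v) = (\<gamma> (f v), {v, p v})"
      using f[OF v] g[OF v] unfolding arc_class_def by auto
  qed
  ultimately show ?thesis using p(1) injs dis by blast
qed

lemma card_arcs_ge:
  assumes "fin_digraph T" "Digraph_Component.connected T" "no_lone_arcs T \<gamma>"
  shows "2 * (card (verts T) - 1) \<le> card (arcs T)"
proof -
  interpret fin_digraph T by fact
  from spanning_twins[OF assms] obtain r f g where fg:
    "\<forall>v\<in>verts T - {r}. f v \<in> arcs T \<and> g v \<in> arcs T"
    "card (f ` (verts T - {r}) \<union> g ` (verts T - {r})) = 2 * (card (verts T) - 1)" by metis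
  from fg(1) have "f ` (verts T - {r}) \<union> g ` (verts T - {r}) \<subseteq> arcs T" by blast
  from card_mono[OF finite_arcs this] show ?thesis using fg(2) by simp
qed

context colored_graph
begin

lemma arc_class_comp:
  assumes "C \<in> comps" shows "arc_class C \<gamma> = arc_class T \<gamma>"
  using assms by (auto simp: arc_class_def fun_eq_iff elim!: compsE)

text \<open>A twin has the label and the end points of its arc, hence lies in the same
  component.\<close>

lemma no_lone_arcs_comps: "no_lone_arcs T \<gamma> \<longleftrightarrow> (\<forall>C\<in>comps. no_lone_arcs C \<gamma>)"
proof safe
  fix C assume C: "C \<in> comps" and nl: "no_lone_arcs T \<gamma>"
  obtain k where k: "arcs C \<subseteq> arcs T" "tail C = tail T" "head C = head T" "test_graph C \<gamma> (J k)"
    using compsE[OF C] by metis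
  show "no_lone_arcs C \<gamma>" unfolding no_lone_arcs_def arc_class_comp[OF C]
  proof (intro ballI impI)
    fix e assume e: "e \<in> arcs C" "tail C e \<noteq> head C e"
    then obtain e' where e': "e' \<in> arcs T" "e' \<noteq> e" "arc_class T \<gamma> e' = arc_class T \<gamma> e"
      using nl k by (metis no_lone_arcs_def subsetD)
    have "tail T e \<in> verts C" using e(1) k
      by (metis fin_digraph_def test_graph_def wf_digraph.tail_in_verts)
    then have "e' \<in> arcs C"
      by (intro comp_absorbs_arc[OF C e(1) e'(1)]) (use e'(3) in \<open>auto simp: arc_class_def\<close>)
    then show "\<exists>e'\<in>arcs C. e' \<noteq> e \<and> arc_class T \<gamma> e' = arc_class T \<gamma> e" using e' by blast
  qed
next
  assume nl: "\<forall>C\<in>comps. no_lone_arcs C \<gamma>"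
  show "no_lone_arcs T \<gamma>" unfolding no_lone_arcs_def
  proof (intro ballI impI)
    fix e assume e: "e \<in> arcs T" "tail T e \<noteq> head T e"
    then obtain C where C: "C \<in> comps" "e \<in> arcs C" using arc_in_comp by blast
    have k: "arcs C \<subseteq> arcs T" "tail C = tail T" "head C = head T" using compsE[OF C(1)] by metis+
    from nl C e k obtain e' where "e' \<in> arcs C" "e' \<noteq> e" "arc_class C \<gamma> e' = arc_class C \<gamma> e"
      by (metis no_lone_arcs_def)
    then show "\<exists>e'\<in>arcs T. e' \<noteq> e \<and> arc_class T \<gamma> e' = arc_class T \<gamma> e"
      using k arc_class_comp[OF C(1)] by auto
  qed
qed

lemma comp_test_graph: "C \<in> comps \<Longrightarrow> fin_digraph C" "C \<in> comps \<Longrightarrow> Digraph_Component.connected C"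
  by (auto elim!: compsE simp: test_graph_def)

text \<open>Without lone arcs, \<open>2 * (card (verts T) - 1)\<close> is at most the sum of the
  same expressions over the components, with equality exactly for free products, and this sum is at
  most the number of arcs, with equality exactly if all components are double trees.\<close>

lemma double_tree_iff_comps:
  "double_tree T \<gamma> \<longleftrightarrow> free_product T \<gamma> K J \<and> (\<forall>C\<in>comps. double_tree C \<gamma>)"
proof (cases "arcs T = {}")
  \<comment> \<open>A connected graph without arcs is a single vertex: a double tree, and by
    convention a free product without components.\<close>
  case True
  then have "comps = {}" using comp_arcs_nonempty compsE by blast
  moreover have "card (verts T) = 1"
  proof -
    obtain r where r: "r \<in> verts T" using connected_T connected_iff_cut[OF wf_digraph] by blast
    have "verts T = {r}"
      using connected_cutE[OF wf_digraph connected_T, of "{r}"] r True by auto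
    then show ?thesis by simp
  qed
  ultimately show ?thesis using True by (simp add: double_tree_def free_product_def no_lone_arcs_def)
next
  case False
  note cv = card_verts_le_comps[OF False]
  have fp: "free_product T \<gamma> K J \<longleftrightarrow> card (verts T) - 1 = (\<Sum>C\<in>comps. card (verts C) - 1)"
    using cv(2) False by (simp add: free_product_def)
  show ?thesis
  proof (cases "no_lone_arcs T \<gamma>")
    case nl: True
    then have nlC: "\<And>C. C \<in> comps \<Longrightarrow> no_lone_arcs C \<gamma>" using no_lone_arcs_comps by blast
    have ge: "2 * (card (verts C) - 1) \<le> card (arcs C)" if "C \<in> comps" for C
      using card_arcs_ge[OF comp_test_graph nlC] that by blast
    show ?thesis
    proof
      assume dt: "double_tree T \<gamma>"
      then have "(\<Sum>C\<in>comps. card (arcs C)) = 2 * (card (verts T) - 1)"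
        using sum_card_arcs by (simp add: double_tree_def)
      also have "\<dots> \<le> (\<Sum>C\<in>comps. 2 * (card (verts C) - 1))"
        using cv(1) by (simp add: sum_distrib_left[symmetric])
      finally have le: "(\<Sum>C\<in>comps. card (arcs C)) \<le> (\<Sum>C\<in>comps. 2 * (card (verts C) - 1))" .
      have eq: "card (arcs C) = 2 * (card (verts C) - 1)" if "C \<in> comps" for C
      proof (rule ccontr)
        assume "card (arcs C) \<noteq> 2 * (card (verts C) - 1)"
        then have "2 * (card (verts C) - 1) < card (arcs C)" using ge[OF that] by simp
        then have "(\<Sum>C\<in>comps. 2 * (card (verts C) - 1)) < (\<Sum>C\<in>comps. card (arcs C))"
          by (intro sum_strict_mono_ex1[OF finite_comps]) (use ge that in blast)+
        then show False using le by simp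
      qed
      then have "(\<Sum>C\<in>comps. card (arcs C)) = (\<Sum>C\<in>comps. 2 * (card (verts C) - 1))" by simp
      then have "card (verts T) - 1 = (\<Sum>C\<in>comps. card (verts C) - 1)"
        using dt sum_card_arcs by (simp add: double_tree_def sum_distrib_left[symmetric])
      then show "free_product T \<gamma> K J \<and> (\<forall>C\<in>comps. double_tree C \<gamma>)"
        using fp eq nlC by (simp add: double_tree_def)
    next
      assume A: "free_product T \<gamma> K J \<and> (\<forall>C\<in>comps. double_tree C \<gamma>)"
      then have "(\<Sum>C\<in>comps. card (arcs C)) = (\<Sum>C\<in>comps. 2 * (card (verts C) - 1))"
        by (intro sum.cong) (auto simp: double_tree_def)
      then have "card (arcs T) = 2 * (card (verts T) - 1)"
        using A fp sum_card_arcs by (simp add: sum_distrib_left[symmetric])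
      then show "double_tree T \<gamma>" using nl by (simp add: double_tree_def)
    qed
  next
    case False
    then show ?thesis using no_lone_arcs_comps by (auto simp: double_tree_def)
  qed
qed

end


section \<open>Estimates and limits of sums indexed by the maps of a tree\<close>

section \<open>Sums of products of kernels over the maps of a tree\<close>

lemma sum_PiE_insert:
  assumes "w \<notin> V"
  shows "(\<Sum>\<phi>\<in>PiE (insert w V) (\<lambda>_. A). F \<phi>) = (\<Sum>\<phi>\<in>PiE V (\<lambda>_. A). \<Sum>x\<in>A. F (\<phi>(w := x)))"
proof -
  have "(\<Sum>\<phi>\<in>PiE (insert w V) (\<lambda>_. A). F \<phi>) = (\<Sum>(x, \<phi>)\<in>A \<times> PiE V (\<lambda>_. A). F (\<phi>(w := x)))"
    unfolding PiE_insert_eq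
    by (subst sum.reindex[OF inj_combinator[OF assms]]) (simp add: case_prod_unfold)
  also have "\<dots> = (\<Sum>x\<in>A. \<Sum>\<phi>\<in>PiE V (\<lambda>_. A). F (\<phi>(w := x)))"
    by (simp add: sum.cartesian_product)
  also have "\<dots> = (\<Sum>\<phi>\<in>PiE V (\<lambda>_. A). \<Sum>x\<in>A. F (\<phi>(w := x)))" by (rule sum.swap)
  finally show ?thesis .
qed

definition tree_prod :: "'v \<Rightarrow> ('v \<Rightarrow> 'v) \<Rightarrow> 'v set \<Rightarrow> ('v \<Rightarrow> 'a \<Rightarrow> 'a \<Rightarrow> real) \<Rightarrow> ('v \<Rightarrow> 'a) \<Rightarrow> real" where
  "tree_prod r p V k \<phi> = (\<Prod>v\<in>V - {r}. k v (\<phi> v) (\<phi> (p v)))"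

lemma tree_prod_root [simp]: "tree_prod r p {r} k \<phi> = 1"
  by (simp add: tree_prod_def)

lemma tree_prod_leaf:
  assumes "rooted_tree r p V" "w \<notin> V" "p w \<in> V"
  shows "tree_prod r p (insert w V) k (\<phi>(w := x)) = k w x (\<phi> (p w)) * tree_prod r p V k \<phi>"
proof -
  have "w \<noteq> r" using rooted_tree_root[OF assms(1)] assms(2) by blast
  then have "insert w V - {r} = insert w (V - {r})" by auto
  moreover have "k v ((\<phi>(w := x)) v) ((\<phi>(w := x)) (p v)) = k v (\<phi> v) (\<phi> (p v))" if v: "v \<in> V - {r}" for v
    using rooted_tree_parent[OF assms(1) v] v assms(2) by auto
  ultimately show ?thesis
    using assms rooted_tree_finite[OF assms(1)] by (auto simp: tree_prod_def)
qed

lemma tree_prod_nonneg: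
  assumes "rooted_tree r p V" "\<And>v x y. v \<in> V - {r} \<Longrightarrow> x \<in> A \<Longrightarrow> y \<in> A \<Longrightarrow> 0 \<le> k v x y"
    "\<phi> \<in> PiE V (\<lambda>_. A)"
  shows "0 \<le> tree_prod r p V k \<phi>"
  unfolding tree_prod_def
proof (rule prod_nonneg, rule assms(2))
  fix v assume v: "v \<in> V - {r}"
  then show "v \<in> V - {r}" "\<phi> v \<in> A" "\<phi> (p v) \<in> A"
    using assms(3) rooted_tree_parent[OF assms(1) v] by auto
qed

text \<open>Leaf removal: if the weight \<open>h\<close> sits elsewhere, the sum over the leaf costs
  a column bound; if it sits at the leaf, it moves to the parent and costs a row bound. Linearity in
  the total of \<open>h\<close> is the point: an error that is small only on average can be placed
  at any vertex.\<close>

lemma tree_sum_bound: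
  assumes "rooted_tree r p V" and A: "finite A"
    and k0: "\<And>v x y. v \<in> V - {r} \<Longrightarrow> x \<in> A \<Longrightarrow> y \<in> A \<Longrightarrow> 0 \<le> k v x y"
    and row: "\<And>v x. v \<in> V - {r} \<Longrightarrow> x \<in> A \<Longrightarrow> (\<Sum>y\<in>A. k v x y) \<le> C v"
    and col: "\<And>v y. v \<in> V - {r} \<Longrightarrow> y \<in> A \<Longrightarrow> (\<Sum>x\<in>A. k v x y) \<le> C v"
    and C0: "\<And>v. v \<in> V - {r} \<Longrightarrow> 0 \<le> C v"
    and u: "u \<in> V" and h: "\<And>x. x \<in> A \<Longrightarrow> 0 \<le> h x"
  shows "(\<Sum>\<phi>\<in>PiE V (\<lambda>_. A). tree_prod r p V k \<phi> * h (\<phi> u)) \<le> (\<Prod>v\<in>V - {r}. C v) * (\<Sum>x\<in>A. h x)"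
  using assms(1) k0 row col C0 u h
proof (induction arbitrary: u h rule: rooted_tree.induct)
  case root
  then have ur: "u = r" by simp
  have "(\<Sum>\<phi>\<in>PiE {r} (\<lambda>_. A). h (\<phi> r)) = (\<Sum>x\<in>A. h x)"
    using sum_PiE_insert[of r "{}" "\<lambda>\<phi>. h (\<phi> r)" A] by simp
  then show ?case
    by (simp only: ur tree_prod_root mult_1_left Diff_cancel prod.empty order_refl)
next
  case (leaf V w)
  have wr: "w \<noteq> r" using rooted_tree_root[OF leaf.hyps(1)] leaf.hyps(2) by blast
  have w: "w \<in> insert w V - {r}" using wr by simp
  have fin: "finite V" by (rule rooted_tree_finite[OF leaf.hyps(1)])
  have sub: "v \<in> insert w V - {r}" if "v \<in> V - {r}" for v using that by auto
  have IH: "(\<Sum>\<phi>\<in>PiE V (\<lambda>_. A). tree_prod r p V k \<phi> * h (\<phi> u)) \<le> (\<Prod>v\<in>V - {r}. C v) * (\<Sum>x\<in>A. h x)"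
    if "u \<in> V" "\<And>x. x \<in> A \<Longrightarrow> 0 \<le> h x" for u h
    by (rule leaf.IH[OF leaf.prems(1)[OF sub] leaf.prems(2)[OF sub] leaf.prems(3)[OF sub]
          leaf.prems(4)[OF sub] that])
  have nn: "0 \<le> tree_prod r p V k \<phi>" if "\<phi> \<in> PiE V (\<lambda>_. A)" for \<phi>
    by (rule tree_prod_nonneg[OF leaf.hyps(1) _ that]) (use leaf.prems(1) sub in blast)
  have pw: "\<phi> (p w) \<in> A" if "\<phi> \<in> PiE V (\<lambda>_. A)" for \<phi> using that leaf.hyps(3) by auto
  have PC: "(\<Prod>v\<in>insert w V - {r}. C v) = C w * (\<Prod>v\<in>V - {r}. C v)"
    using wr leaf.hyps(2) fin by (simp add: insert_Diff_if)
  have PC0: "0 \<le> (\<Prod>v\<in>V - {r}. C v)" by (rule prod_nonneg) (use leaf.prems(4) sub in blast)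
  have "(\<Sum>\<phi>\<in>PiE (insert w V) (\<lambda>_. A). tree_prod r p (insert w V) k \<phi> * h (\<phi> u)) =
      (\<Sum>\<phi>\<in>PiE V (\<lambda>_. A). \<Sum>x\<in>A. k w x (\<phi> (p w)) * tree_prod r p V k \<phi> * h ((\<phi>(w := x)) u))"
    by (simp only: sum_PiE_insert[OF leaf.hyps(2)] tree_prod_leaf[OF leaf.hyps])
  also have "\<dots> \<le> C w * (\<Prod>v\<in>V - {r}. C v) * (\<Sum>x\<in>A. h x)"
  proof (cases "u = w")
    case False
    then have uV: "u \<in> V" using leaf.prems(5) by blast
    have "(\<Sum>\<phi>\<in>PiE V (\<lambda>_. A). \<Sum>x\<in>A. k w x (\<phi> (p w)) * tree_prod r p V k \<phi> * h ((\<phi>(w := x)) u))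
        = (\<Sum>\<phi>\<in>PiE V (\<lambda>_. A). (\<Sum>x\<in>A. k w x (\<phi> (p w))) * (tree_prod r p V k \<phi> * h (\<phi> u)))"
      using False by (simp add: sum_distrib_right mult.assoc)
    also have "\<dots> \<le> (\<Sum>\<phi>\<in>PiE V (\<lambda>_. A). C w * (tree_prod r p V k \<phi> * h (\<phi> u)))"
    proof (intro sum_mono mult_right_mono)
      fix \<phi> assume \<phi>: "\<phi> \<in> PiE V (\<lambda>_. A)"
      show "(\<Sum>x\<in>A. k w x (\<phi> (p w))) \<le> C w" by (rule leaf.prems(3)[OF w pw[OF \<phi>]])
      have "\<phi> u \<in> A" using \<phi> uV by auto
      then show "0 \<le> tree_prod r p V k \<phi> * h (\<phi> u)" using nn[OF \<phi>] leaf.prems(6) by simp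
    qed
    also have "\<dots> = C w * (\<Sum>\<phi>\<in>PiE V (\<lambda>_. A). tree_prod r p V k \<phi> * h (\<phi> u))"
      by (simp add: sum_distrib_left)
    also have "\<dots> \<le> C w * ((\<Prod>v\<in>V - {r}. C v) * (\<Sum>x\<in>A. h x))"
      by (rule mult_left_mono[OF IH[OF uV leaf.prems(6)] leaf.prems(4)[OF w]])
    finally show ?thesis by (simp add: mult.assoc)
  next
    case True
    \<comment> \<open>The weight that the parent inherits from the removed leaf; exchanging the two
      sums shows its total to be at most \<open>C w\<close> times that of \<open>h\<close>.\<close>
    let ?h = "\<lambda>y. \<Sum>x\<in>A. k w x y * h x"
    have "(\<Sum>\<phi>\<in>PiE V (\<lambda>_. A). \<Sum>x\<in>A. k w x (\<phi> (p w)) * tree_prod r p V k \<phi> * h ((\<phi>(w := x)) u))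
        = (\<Sum>\<phi>\<in>PiE V (\<lambda>_. A). tree_prod r p V k \<phi> * ?h (\<phi> (p w)))"
      using True by (simp add: sum_distrib_left mult_ac)
    also have "\<dots> \<le> (\<Prod>v\<in>V - {r}. C v) * (\<Sum>y\<in>A. ?h y)"
      by (rule IH[OF leaf.hyps(3)]) (intro sum_nonneg mult_nonneg_nonneg leaf.prems(1)[OF w] leaf.prems(6))
    also have "(\<Sum>y\<in>A. ?h y) = (\<Sum>x\<in>A. (\<Sum>y\<in>A. k w x y) * h x)"
      by (subst sum.swap) (simp add: sum_distrib_right)
    also have "(\<Prod>v\<in>V - {r}. C v) * (\<Sum>x\<in>A. (\<Sum>y\<in>A. k w x y) * h x) \<le> (\<Prod>v\<in>V - {r}. C v) * (\<Sum>x\<in>A. C w * h x)"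
      by (intro mult_left_mono sum_mono mult_right_mono PC0 leaf.prems(2)[OF w] leaf.prems(6))
    also have "\<dots> = C w * (\<Prod>v\<in>V - {r}. C v) * (\<Sum>x\<in>A. h x)"
      by (simp only: sum_distrib_left[symmetric] mult_ac)
    finally show ?thesis .
  qed
  finally show ?case unfolding PC .
qed

text \<open>A collision removes one free summation: if the leaf is one of the two vertices, its
  position is prescribed, and a single kernel value, at most \<open>\<epsilon>\<close>, replaces a
  column sum. The product on the right still contains \<open>C w\<close> in that case, which is why
  the bounds are taken at least 1.\<close>

lemma tree_sum_collision:
  assumes "rooted_tree r p V" and A: "finite A"
    and k0: "\<And>v x y. v \<in> V - {r} \<Longrightarrow> x \<in> A \<Longrightarrow> y \<in> A \<Longrightarrow> 0 \<le> k v x y \<and> k v x y \<le> \<epsilon>"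
    and row: "\<And>v x. v \<in> V - {r} \<Longrightarrow> x \<in> A \<Longrightarrow> (\<Sum>y\<in>A. k v x y) \<le> C v"
    and col: "\<And>v y. v \<in> V - {r} \<Longrightarrow> y \<in> A \<Longrightarrow> (\<Sum>x\<in>A. k v x y) \<le> C v"
    and C1: "\<And>v. v \<in> V - {r} \<Longrightarrow> 1 \<le> C v" and e0: "0 \<le> \<epsilon>"
    and u: "u \<in> V" "u' \<in> V" "u \<noteq> u'"
  shows "(\<Sum>\<phi>\<in>PiE V (\<lambda>_. A). if \<phi> u = \<phi> u' then tree_prod r p V k \<phi> else 0)
    \<le> \<epsilon> * (\<Prod>v\<in>V - {r}. C v) * card A"
  using assms(1) k0 row col C1 u
proof (induction arbitrary: u u' rule: rooted_tree.induct)
  case root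
  then show ?case by simp
next
  case (leaf V w)
  have wr: "w \<noteq> r" using rooted_tree_root[OF leaf.hyps(1)] leaf.hyps(2) by blast
  have w: "w \<in> insert w V - {r}" using wr by simp
  have fin: "finite V" by (rule rooted_tree_finite[OF leaf.hyps(1)])
  have sub: "v \<in> insert w V - {r}" if "v \<in> V - {r}" for v using that by auto
  have nn: "0 \<le> tree_prod r p V k \<phi>" if "\<phi> \<in> PiE V (\<lambda>_. A)" for \<phi>
    by (rule tree_prod_nonneg[OF leaf.hyps(1) _ that]) (use leaf.prems(1) sub in blast)
  have pw: "\<phi> (p w) \<in> A" if "\<phi> \<in> PiE V (\<lambda>_. A)" for \<phi> using that leaf.hyps(3) by auto
  have PC: "(\<Prod>v\<in>insert w V - {r}. C v) = C w * (\<Prod>v\<in>V - {r}. C v)"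
    using wr leaf.hyps(2) fin by (simp add: insert_Diff_if)
  have PC0: "0 \<le> (\<Prod>v\<in>V - {r}. C v)"
    by (rule prod_nonneg) (use leaf.prems(4) sub in \<open>force intro: order_trans[of 0 1]\<close>)
  have Cw: "1 \<le> C w" by (rule leaf.prems(4)[OF w])
  have expand: "(\<Sum>\<phi>\<in>PiE (insert w V) (\<lambda>_. A). if \<phi> u = \<phi> u' then tree_prod r p (insert w V) k \<phi> else 0) =
      (\<Sum>\<phi>\<in>PiE V (\<lambda>_. A). \<Sum>x\<in>A. if (\<phi>(w := x)) u = (\<phi>(w := x)) u' then k w x (\<phi> (p w)) * tree_prod r p V k \<phi> else 0)"
    by (simp only: sum_PiE_insert[OF leaf.hyps(2)] tree_prod_leaf[OF leaf.hyps])
  have hit: "(\<Sum>\<phi>\<in>PiE V (\<lambda>_. A). \<Sum>x\<in>A. if \<phi> t = x then k w x (\<phi> (p w)) * tree_prod r p V k \<phi> else 0)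
    \<le> \<epsilon> * (C w * (\<Prod>v\<in>V - {r}. C v)) * card A" if t: "t \<in> V" for t
  proof -
    have "(\<Sum>\<phi>\<in>PiE V (\<lambda>_. A). \<Sum>x\<in>A. if \<phi> t = x then k w x (\<phi> (p w)) * tree_prod r p V k \<phi> else 0)
        \<le> (\<Sum>\<phi>\<in>PiE V (\<lambda>_. A). \<epsilon> * (tree_prod r p V k \<phi> * 1))"
    proof (rule sum_mono)
      fix \<phi> assume \<phi>: "\<phi> \<in> PiE V (\<lambda>_. A)"
      have "\<phi> t \<in> A" using \<phi> t by auto
      then have "(\<Sum>x\<in>A. if \<phi> t = x then k w x (\<phi> (p w)) * tree_prod r p V k \<phi> else 0)
          = k w (\<phi> t) (\<phi> (p w)) * tree_prod r p V k \<phi>" using A by simp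
      also have "\<dots> \<le> \<epsilon> * tree_prod r p V k \<phi>"
        using leaf.prems(1)[OF w \<open>\<phi> t \<in> A\<close> pw[OF \<phi>]] nn[OF \<phi>] by (intro mult_right_mono) auto
      finally show "(\<Sum>x\<in>A. if \<phi> t = x then k w x (\<phi> (p w)) * tree_prod r p V k \<phi> else 0)
        \<le> \<epsilon> * (tree_prod r p V k \<phi> * 1)" by simp
    qed
    also have "\<dots> = \<epsilon> * (\<Sum>\<phi>\<in>PiE V (\<lambda>_. A). tree_prod r p V k \<phi> * 1)"
      by (simp add: sum_distrib_left)
    also have "(\<Sum>\<phi>\<in>PiE V (\<lambda>_. A). tree_prod r p V k \<phi> * 1) \<le> (\<Prod>v\<in>V - {r}. C v) * (\<Sum>x\<in>A. 1)"
    proof (rule tree_sum_bound[OF leaf.hyps(1) A, where u = t])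
      show "0 \<le> C v" if "v \<in> V - {r}" for v using leaf.prems(4)[OF sub[OF that]] by linarith
    qed (use leaf.prems(1-3) sub t in auto)
    also have "(\<Prod>v\<in>V - {r}. C v) * (\<Sum>x\<in>A. 1) = 1 * ((\<Prod>v\<in>V - {r}. C v) * card A)" by simp
    also have "\<dots> \<le> C w * ((\<Prod>v\<in>V - {r}. C v) * card A)"
      by (rule mult_right_mono[OF Cw]) (use PC0 in simp)
    finally show ?thesis using e0 by (simp add: mult_left_mono mult.assoc)
  qed
  consider "u = w" "u' \<in> V" | "u' = w" "u \<in> V" | "u \<noteq> w" "u' \<noteq> w" "u \<in> V" "u' \<in> V"
    using leaf.prems(5-7) by blast
  then show ?case
  proof cases
    case 1
    then have "u' \<noteq> w" using leaf.hyps by blast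
    show ?thesis unfolding expand PC using hit[OF 1(2)] 1(1) \<open>u' \<noteq> w\<close>
      by (simp add: eq_commute)
  next
    case 2
    then have "u \<noteq> w" using leaf.hyps by blast
    show ?thesis unfolding expand PC using hit[OF 2(2)] 2(1) \<open>u \<noteq> w\<close> by simp
  next
    case 3
    have "(\<Sum>\<phi>\<in>PiE V (\<lambda>_. A). \<Sum>x\<in>A. if (\<phi>(w := x)) u = (\<phi>(w := x)) u' then k w x (\<phi> (p w)) * tree_prod r p V k \<phi> else 0)
        = (\<Sum>\<phi>\<in>PiE V (\<lambda>_. A). (\<Sum>x\<in>A. k w x (\<phi> (p w))) * (if \<phi> u = \<phi> u' then tree_prod r p V k \<phi> else 0))"
      using 3 by (auto simp: sum_distrib_right intro!: sum.cong)
    also have "\<dots> \<le> (\<Sum>\<phi>\<in>PiE V (\<lambda>_. A). C w * (if \<phi> u = \<phi> u' then tree_prod r p V k \<phi> else 0))"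
      by (intro sum_mono mult_right_mono leaf.prems(3)[OF w pw]) (auto simp: nn)
    also have "\<dots> = C w * (\<Sum>\<phi>\<in>PiE V (\<lambda>_. A). (if \<phi> u = \<phi> u' then tree_prod r p V k \<phi> else 0))"
      by (simp add: sum_distrib_left)
    also have "\<dots> \<le> C w * (\<epsilon> * (\<Prod>v\<in>V - {r}. C v) * card A)"
    proof (rule mult_left_mono)
      show "(\<Sum>\<phi>\<in>PiE V (\<lambda>_. A). (if \<phi> u = \<phi> u' then tree_prod r p V k \<phi> else 0))
        \<le> \<epsilon> * (\<Prod>v\<in>V - {r}. C v) * card A"
        by (rule leaf.IH) (use leaf.prems(1-4,7) sub 3 in blast)+
    qed (use Cw in simp)
    finally show ?thesis unfolding expand PC by (simp add: mult_ac)
  qed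
qed

subsection \<open>Limits by leaf removal\<close>

text \<open>Deviations are averaged over \<open>j\<close>: under slow growth, positions within a
  band width of the boundary receive too little mass, however large \<open>n\<close> is. The
  operator leads from a leaf, the first argument of the kernel, to its parent.\<close>

definition kernel_limit :: "(nat \<Rightarrow> nat \<Rightarrow> nat \<Rightarrow> real) \<Rightarrow> ((real \<Rightarrow> real) \<Rightarrow> real \<Rightarrow> real) \<Rightarrow> bool" where
  "kernel_limit k L \<longleftrightarrow> (\<forall>f. continuous_on {0..1} f \<longrightarrow> continuous_on {0..1} (L f) \<and>
     (\<lambda>n. (\<Sum>j=1..n. \<bar>(\<Sum>x=1..n. k n x j * f (x / n)) - L f (j / n)\<bar>) / n) \<longlonglongrightarrow> 0)"

definition bounded_kernel :: "(nat \<Rightarrow> nat \<Rightarrow> nat \<Rightarrow> real) \<Rightarrow> real \<Rightarrow> bool" where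
  "bounded_kernel k C \<longleftrightarrow> 0 \<le> C \<and> (\<forall>n x y. 0 \<le> k n x y) \<and>
     (\<forall>n. \<forall>x\<in>{1..n}. (\<Sum>y=1..n. k n x y) \<le> C) \<and> (\<forall>n. \<forall>y\<in>{1..n}. (\<Sum>x=1..n. k n x y) \<le> C)"

text \<open>Every vertex carries a weight because removing a leaf multiplies the weight of its
  parent by a new function; with all weights 1 this is the sum of interest.\<close>

definition weighted_tree_sum where
  "weighted_tree_sum r p V k f n = (\<Sum>\<phi>\<in>PiE V (\<lambda>_. {1..n}).
     tree_prod r p V (\<lambda>v. k v n) \<phi> * (\<Prod>v\<in>V. f v (\<phi> v / n))) / real n"

lemma continuous_imp_bounded_01:
  fixes f :: "real \<Rightarrow> real"
  assumes "continuous_on {0..1} f" shows "\<exists>M. \<forall>x\<in>{0..1}. \<bar>f x\<bar> \<le> M"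
proof -
  have "compact (f ` {0..1})" by (rule compact_continuous_image) (use assms in auto)
  then have "bounded (f ` {0..1})" by (rule compact_imp_bounded)
  then show ?thesis by (auto simp: bounded_iff)
qed

text \<open>The error made at the parent is \<open>h\<close>. Bounding the remaining vertex weights
  by constants leaves a tree sum with the absolute value of \<open>h n\<close> as weight at
  \<open>p w\<close>, hence a multiple of its average, which tends to 0 by the assumption on the
  kernel of \<open>w\<close>.\<close>

lemma weighted_tree_sum_leaf:
  fixes f :: "'v \<Rightarrow> real \<Rightarrow> real" and k :: "'v \<Rightarrow> nat \<Rightarrow> nat \<Rightarrow> nat \<Rightarrow> real"
  assumes tree: "rooted_tree r p V" and w: "w \<notin> V" "p w \<in> V"
    and k: "\<And>v. v \<in> V - {r} \<Longrightarrow> bounded_kernel (k v) (C v)" and L: "kernel_limit (k w) L"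
    and f: "\<And>v. v \<in> insert w V \<Longrightarrow> continuous_on {0..1} (f v)"
  shows "(\<lambda>n. weighted_tree_sum r p (insert w V) k f n
    - weighted_tree_sum r p V k (f(p w := (\<lambda>x. f (p w) x * L (f w) x))) n) \<longlonglongrightarrow> 0"
proof -
  define h where "h n j = (\<Sum>x=1..n. k w n x j * f w (x / n)) - L (f w) (j / n)" for n j :: nat
  have fin: "finite V" by (rule rooted_tree_finite[OF tree])
  have "\<forall>v\<in>V. \<exists>M. \<forall>x\<in>{0..1}. \<bar>f v x\<bar> \<le> M"
    using f continuous_imp_bounded_01 by blast
  from bchoice[OF this] obtain M where M: "\<And>v x. v \<in> V \<Longrightarrow> x \<in> {0..1} \<Longrightarrow> \<bar>f v x\<bar> \<le> M v" by blast
  define B where "B = (\<Prod>v\<in>V. M v) * (\<Prod>v\<in>V - {r}. C v)"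
  have M0: "0 \<le> (\<Prod>v\<in>V. M v)" by (rule prod_nonneg) (use M[of _ 0] in force)
  have bound: "\<bar>weighted_tree_sum r p (insert w V) k f n
    - weighted_tree_sum r p V k (f(p w := (\<lambda>x. f (p w) x * L (f w) x))) n\<bar>
    \<le> B * ((\<Sum>j=1..n. \<bar>h n j\<bar>) / n)" (is "?D n \<le> _") for n
  proof -
    let ?P = "PiE V (\<lambda>_. {1..n})" and ?t = "tree_prod r p V (\<lambda>v. k v n)"
    have ins: "(\<Prod>v\<in>insert w V. f v ((\<phi>(w := x)) v / n)) = f w (x / n) * (\<Prod>v\<in>V. f v (\<phi> v / n))" for \<phi> :: "'v \<Rightarrow> nat" and x
    proof -
      have "(\<Prod>v\<in>V. f v ((\<phi>(w := x)) v / n)) = (\<Prod>v\<in>V. f v (\<phi> v / n))"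
        using w(1) by (intro prod.cong) auto
      then show ?thesis using fin w(1) by simp
    qed
    have upd: "(\<Prod>v\<in>V. (f(p w := (\<lambda>x. f (p w) x * L (f w) x))) v (\<phi> v / n)) =
        L (f w) (\<phi> (p w) / n) * (\<Prod>v\<in>V. f v (\<phi> v / n))" for \<phi> :: "'v \<Rightarrow> nat"
    proof -
      have "(\<Prod>v\<in>V. (f(p w := (\<lambda>x. f (p w) x * L (f w) x))) v (\<phi> v / n)) =
        (\<Prod>v\<in>V. f v (\<phi> v / n) * (if v = p w then L (f w) (\<phi> (p w) / n) else 1))"
        by (intro prod.cong) auto
      then show ?thesis using fin w(2) by (simp add: prod.distrib prod.delta)
    qed
    have "weighted_tree_sum r p (insert w V) k f n =
      (\<Sum>\<phi>\<in>?P. \<Sum>x=1..n. k w n x (\<phi> (p w)) * ?t \<phi> * (f w (x / n) * (\<Prod>v\<in>V. f v (\<phi> v / n)))) / n"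
      unfolding weighted_tree_sum_def
      by (simp only: sum_PiE_insert[OF w(1)] tree_prod_leaf[OF tree w] ins)
    also have "(\<Sum>\<phi>\<in>?P. \<Sum>x=1..n. k w n x (\<phi> (p w)) * ?t \<phi> * (f w (x / n) * (\<Prod>v\<in>V. f v (\<phi> v / n))))
      = (\<Sum>\<phi>\<in>?P. ?t \<phi> * (\<Prod>v\<in>V. f v (\<phi> v / n)) * (\<Sum>x=1..n. k w n x (\<phi> (p w)) * f w (x / n)))"
      by (simp add: sum_distrib_left mult_ac)
    finally have e1: "weighted_tree_sum r p (insert w V) k f n = \<dots> / n" .
    have "weighted_tree_sum r p V k (f(p w := (\<lambda>x. f (p w) x * L (f w) x))) n =
      (\<Sum>\<phi>\<in>?P. ?t \<phi> * (\<Prod>v\<in>V. f v (\<phi> v / n)) * L (f w) (\<phi> (p w) / n)) / n"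
      unfolding weighted_tree_sum_def upd by (simp add: mult_ac)
    then have "?D n = \<bar>\<Sum>\<phi>\<in>?P. ?t \<phi> * (\<Prod>v\<in>V. f v (\<phi> v / n)) * h n (\<phi> (p w))\<bar> / n"
      unfolding e1
      by (simp only: h_def diff_divide_distrib[symmetric] sum_subtractf[symmetric] right_diff_distrib
        abs_divide abs_of_nat)
    also have "\<dots> \<le> (\<Sum>\<phi>\<in>?P. ?t \<phi> * ((\<Prod>v\<in>V. M v) * \<bar>h n (\<phi> (p w))\<bar>)) / n"
    proof (intro divide_right_mono order_trans[OF sum_abs] sum_mono)
      fix \<phi> assume \<phi>: "\<phi> \<in> ?P"
      have t0: "0 \<le> ?t \<phi>"
        by (rule tree_prod_nonneg[OF tree _ \<phi>]) (use k in \<open>auto simp: bounded_kernel_def\<close>)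
      have "\<bar>\<Prod>v\<in>V. f v (\<phi> v / n)\<bar> \<le> (\<Prod>v\<in>V. M v)"
        unfolding abs_prod
      proof (rule prod_mono)
        fix v assume v: "v \<in> V"
        then have "\<phi> v \<in> {1..n}" using \<phi> by auto
        then have "real (\<phi> v) / n \<in> {0..1}" by (auto simp: divide_le_eq)
        then show "0 \<le> \<bar>f v (\<phi> v / n)\<bar> \<and> \<bar>f v (\<phi> v / n)\<bar> \<le> M v" using M v by auto
      qed
      then have "\<bar>\<Prod>v\<in>V. f v (\<phi> v / n)\<bar> * \<bar>h n (\<phi> (p w))\<bar> \<le> (\<Prod>v\<in>V. M v) * \<bar>h n (\<phi> (p w))\<bar>"
        by (rule mult_right_mono) simp
      then show "\<bar>?t \<phi> * (\<Prod>v\<in>V. f v (\<phi> v / n)) * h n (\<phi> (p w))\<bar>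
        \<le> ?t \<phi> * ((\<Prod>v\<in>V. M v) * \<bar>h n (\<phi> (p w))\<bar>)"
        using t0 by (simp add: abs_mult mult.assoc mult_left_mono)
    qed simp
    also have "\<dots> \<le> (\<Prod>v\<in>V - {r}. C v) * (\<Sum>j=1..n. (\<Prod>v\<in>V. M v) * \<bar>h n j\<bar>) / n"
      by (intro divide_right_mono
          tree_sum_bound[OF tree _ _ _ _ _ w(2), where h = "\<lambda>j. (\<Prod>v\<in>V. M v) * \<bar>h n j\<bar>"])
        (use k M0 in \<open>auto simp: bounded_kernel_def\<close>)
    also have "\<dots> = B * ((\<Sum>j=1..n. \<bar>h n j\<bar>) / n)"
      by (simp add: B_def sum_distrib_left[symmetric])
    finally show ?thesis .
  qed
  have "(\<lambda>n. B * ((\<Sum>j=1..n. \<bar>h n j\<bar>) / n)) \<longlonglongrightarrow> B * 0"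
    using L f[of w] by (intro tendsto_mult tendsto_const) (auto simp: kernel_limit_def h_def)
  then have "(\<lambda>n. B * ((\<Sum>j=1..n. \<bar>h n j\<bar>) / n)) \<longlonglongrightarrow> 0" by simp
  then show ?thesis
    by (rule Lim_null_comparison[rotated]) (use bound in \<open>simp only: real_norm_def eventually_True\<close>)
qed


section \<open>Slow, proportional and full bands as kernels on the unit interval\<close>

section \<open>Band kernels and their limit operators\<close>

definition band_kernel :: "(nat \<Rightarrow> real) \<Rightarrow> (nat \<Rightarrow> nat) \<Rightarrow> nat \<Rightarrow> nat \<Rightarrow> nat \<Rightarrow> real" where
  "band_kernel a b n x y = (if \<bar>int x - int y\<bar> \<le> int (b n) then a n else 0)"

lemma band_kernel_sym: "band_kernel a b n x y = band_kernel a b n y x"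
  by (simp add: band_kernel_def abs_minus_commute)

lemma card_band_le: "card {y\<in>{1..n}. \<bar>int x - int y\<bar> \<le> int b} \<le> 2 * b + 1"
proof -
  have "{y\<in>{1..n}. \<bar>int x - int y\<bar> \<le> int b} \<subseteq> {x - b..x + b}" by auto
  from card_mono[OF _ this] show ?thesis by simp
qed

lemma band_kernel_row:
  "(\<Sum>y=1..n. band_kernel a b n x y) = a n * card {y\<in>{1..n}. \<bar>int x - int y\<bar> \<le> int (b n)}"
  by (simp add: band_kernel_def sum.If_cases Int_def)

lemma bounded_band_kernelI:
  fixes a :: "nat \<Rightarrow> real" and C :: real
  assumes "\<And>n. 0 \<le> a n" "0 \<le> C"
    "\<And>n x. 1 \<le> n \<Longrightarrow> a n * card {y\<in>{1..n}. \<bar>int x - int y\<bar> \<le> int (b n)} \<le> C"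
  shows "bounded_kernel (band_kernel a b) C"
proof -
  have row: "(\<Sum>y=1..n. band_kernel a b n x y) \<le> C" if "x \<in> {1..n}" for n x
    unfolding band_kernel_row using assms(3)[of n x] that by simp
  moreover have "(\<Sum>x=1..n. band_kernel a b n x y) \<le> C" if "y \<in> {1..n}" for n y
    using row[OF that] by (simp only: band_kernel_sym)
  ultimately show ?thesis using assms(1,2) by (auto simp: bounded_kernel_def band_kernel_def)
qed

text \<open>A row has at most \<open>2 * b n + 1\<close> entries, so 2 is enough as soon as the
  width is positive; for width 0 the kernel vanishes by the convention on division.\<close>

lemma bounded_slow_kernel: "bounded_kernel (band_kernel (\<lambda>n. 1 / (2 * real (b n))) b) 2"
proof (rule bounded_band_kernelI)
  fix n x
  have "real (card {y\<in>{1..n}. \<bar>int x - int y\<bar> \<le> int (b n)}) \<le> real (2 * b n + 1)"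
    using card_band_le[of n x "b n"] by (rule of_nat_mono)
  then show "1 / (2 * real (b n)) * card {y\<in>{1..n}. \<bar>int x - int y\<bar> \<le> int (b n)} \<le> 2"
    by (cases "b n = 0") (auto simp: divide_le_eq)
qed auto

lemma bounded_proportional_kernel:
  assumes "0 < s" shows "bounded_kernel (band_kernel (\<lambda>n. 1 / (s * real n)) b) (1 / s)"
proof (rule bounded_band_kernelI)
  fix n x assume "1 \<le> (n::nat)"
  have "card {y\<in>{1..n}. \<bar>int x - int y\<bar> \<le> int (b n)} \<le> card {1..n}"
    by (rule card_mono) auto
  then show "1 / (s * real n) * card {y\<in>{1..n}. \<bar>int x - int y\<bar> \<le> int (b n)} \<le> 1 / s"
    using assms \<open>1 \<le> n\<close> by (simp add: field_simps)
qed (use assms in auto)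

text \<open>The positions further than \<open>b n\<close> from \<open>y\<close> lie at the two ends,
  at most \<open>n - b n\<close> of them, and each deviates by 1/n. For full proportion the bound
  tends to 0, uniformly in \<open>y\<close>.\<close>

lemma full_kernel_deviation:
  assumes "y \<in> {1..n}"
  shows "(\<Sum>x=1..n. \<bar>band_kernel (\<lambda>n. 1 / real n) b n x y - 1 / n\<bar>) \<le> \<bar>1 - b n / n\<bar>"
proof -
  have "(\<Sum>x=1..n. \<bar>band_kernel (\<lambda>n. 1 / real n) b n x y - 1 / n\<bar>)
      = (\<Sum>x=1..n. if \<bar>int x - int y\<bar> \<le> int (b n) then 0 else 1 / n)"
    by (rule sum.cong) (auto simp: band_kernel_def)
  also have "\<dots> = card ({1..n} \<inter> - {x. \<bar>int x - int y\<bar> \<le> int (b n)}) / n"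
    by (simp add: sum.If_cases)
  finally have eq: "(\<Sum>x=1..n. \<bar>band_kernel (\<lambda>n. 1 / real n) b n x y - 1 / n\<bar>) = \<dots>" .
  have "card ({1..n} \<inter> - {x. \<bar>int x - int y\<bar> \<le> int (b n)}) \<le> card ({1..<y - b n} \<union> {y + b n<..n})"
    by (rule card_mono) auto
  also have "\<dots> \<le> (y - b n - 1) + (n - (y + b n))"
    by (rule order_trans[OF card_Un_le]) simp
  also have "\<dots> \<le> n - b n" using assms by auto
  finally have "real (card ({1..n} \<inter> - {x. \<bar>int x - int y\<bar> \<le> int (b n)})) \<le> real (n - b n)"
    by (rule of_nat_mono)
  also have "\<dots> \<le> \<bar>real n - real (b n)\<bar>" by auto
  finally have "(\<Sum>x=1..n. \<bar>band_kernel (\<lambda>n. 1 / real n) b n x y - 1 / n\<bar>) \<le> \<bar>real n - real (b n)\<bar> / n"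
    unfolding eq by (rule divide_right_mono) simp
  also have "\<dots> = \<bar>(real n - real (b n)) / n\<bar>" by simp
  also have "(real n - real (b n)) / n = 1 - b n / n" using assms by (simp add: diff_divide_distrib)
  finally show ?thesis .
qed

subsection \<open>Moduli of continuity and Riemann sums\<close>

text \<open>One error sequence serves all pairs of points: the largest oscillation at distance
  \<open>d n\<close>, which tends to 0 by uniform continuity. The distance will be
  \<open>b n / n\<close> for slow growth and the mesh 1/n for Riemann sums.\<close>

lemma ex_modulus:
  fixes f :: "real \<Rightarrow> real"
  assumes f: "continuous_on {0..1} f" and d: "d \<longlonglongrightarrow> 0" and d0: "\<And>n. 0 \<le> d n"
  shows "\<exists>\<omega> :: nat \<Rightarrow> real. \<omega> \<longlonglongrightarrow> 0 \<and> (\<forall>n. 0 \<le> \<omega> n) \<and>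
    (\<forall>n. \<forall>x\<in>{0..1}. \<forall>y\<in>{0..1}. \<bar>x - y\<bar> \<le> d n \<longrightarrow> \<bar>f x - f y\<bar> \<le> \<omega> n)"
proof -
  obtain M where M: "\<And>x. x \<in> {0..1} \<Longrightarrow> \<bar>f x\<bar> \<le> M"
    using continuous_imp_bounded_01[OF f] by blast
  define S where "S n = {(x, y). x \<in> {0..1} \<and> y \<in> {0..1} \<and> \<bar>x - y\<bar> \<le> d n}" for n
  define \<omega> where "\<omega> n = (SUP (x, y)\<in>S n. \<bar>f x - f y\<bar>)" for n
  have bdd: "bdd_above ((\<lambda>(x, y). \<bar>f x - f y\<bar>) ` S n)" for n
  proof (rule bdd_aboveI2)
    fix z assume "z \<in> S n"
    then have "\<bar>f (fst z)\<bar> \<le> M" "\<bar>f (snd z)\<bar> \<le> M" using M by (auto simp: S_def)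
    then show "(case z of (x, y) \<Rightarrow> \<bar>f x - f y\<bar>) \<le> M + M" by (auto simp: case_prod_unfold)
  qed
  have zero: "(0, 0) \<in> S n" for n using d0 by (auto simp: S_def)
  have up: "\<bar>f x - f y\<bar> \<le> \<omega> n" if "(x, y) \<in> S n" for x y n
    unfolding \<omega>_def using cSUP_upper[OF that bdd] by simp
  have "\<omega> \<longlonglongrightarrow> 0"
  proof (rule LIMSEQ_I)
    fix e :: real assume "0 < e"
    have "uniformly_continuous_on {0..1} f" using f by (intro compact_uniformly_continuous) auto
    then obtain \<delta> where \<delta>: "0 < \<delta>"
      "\<And>x y. x \<in> {0..1} \<Longrightarrow> y \<in> {0..1} \<Longrightarrow> \<bar>x - y\<bar> < \<delta> \<Longrightarrow> \<bar>f x - f y\<bar> < e / 2"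
      unfolding uniformly_continuous_on_def dist_real_def using \<open>0 < e\<close> half_gt_zero
      by (metis abs_minus_commute)
    obtain N where N: "\<And>n. n \<ge> N \<Longrightarrow> \<bar>d n\<bar> < \<delta>" using LIMSEQ_D[OF d \<delta>(1)] by auto
    have "norm (\<omega> n - 0) < e" if "n \<ge> N" for n
    proof -
      have "\<omega> n \<le> e / 2" unfolding \<omega>_def
      proof (rule cSUP_least)
        show "S n \<noteq> {}" using zero by blast
        fix z assume "z \<in> S n"
        then have "fst z \<in> {0..1}" "snd z \<in> {0..1}" "\<bar>fst z - snd z\<bar> < \<delta>"
          using N[OF that] by (auto simp: S_def)
        from \<delta>(2)[OF this] show "(case z of (x, y) \<Rightarrow> \<bar>f x - f y\<bar>) \<le> e / 2"
          by (simp add: case_prod_unfold)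
      qed
      moreover have "0 \<le> \<omega> n" using up[OF zero] by simp
      ultimately show ?thesis using \<open>0 < e\<close> by simp
    qed
    then show "\<exists>N. \<forall>n\<ge>N. norm (\<omega> n - 0) < e" by blast
  qed
  moreover have "0 \<le> \<omega> n" for n using up[OF zero] by simp
  ultimately show ?thesis using up by (intro exI[of _ \<omega>]) (auto simp: S_def)
qed

lemma integral_le_const:
  fixes f :: "real \<Rightarrow> real"
  assumes "f integrable_on {a..b}" "a \<le> b" "\<And>x. x \<in> {a..b} \<Longrightarrow> \<bar>f x\<bar> \<le> M"
  shows "\<bar>integral {a..b} f\<bar> \<le> M * (b - a)"
proof -
  have "norm (integral {a..b} f) \<le> integral {a..b} (\<lambda>_. M)"
    by (rule integral_norm_bound_integral) (use assms in auto)
  then show ?thesis using assms(2) by (simp add: mult.commute)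
qed

text \<open>Induction over the cells, each of which adds an error \<open>\<omega> / n\<close>. The
  integral appears as a difference of values of the primitive from 0, so that its two end points can
  later be moved separately.\<close>

lemma riemann_sum_error:
  fixes f :: "real \<Rightarrow> real" and n p q :: nat
  assumes f: "continuous_on {0..1} f" and n: "1 \<le> n" and pq: "p \<le> q" "q \<le> n"
    and \<omega>: "\<And>x y. x \<in> {0..1} \<Longrightarrow> y \<in> {0..1} \<Longrightarrow> \<bar>x - y\<bar> \<le> 1 / n \<Longrightarrow> \<bar>f x - f y\<bar> \<le> \<omega>"
  shows "\<bar>(\<Sum>k\<in>{p<..q}. f (k / n)) / n - (integral {0..q / n} f - integral {0..p / n} f)\<bar>
    \<le> \<omega> * (real q - real p) / n"
  using pq
proof (induction q rule: dec_induct)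
  case base
  show ?case by simp
next
  case (step q)
  let ?F = "\<lambda>x. integral {0..x} f"
  let ?a = "real q / n" and ?b = "real (Suc q) / n"
  have ab: "0 \<le> ?a" "?a \<le> ?b" "?b \<le> 1" "?b - ?a = 1 / n"
    using step n by (auto simp: field_simps)
  have int: "f integrable_on {u..v}" if "0 \<le> u" "v \<le> 1" for u v
    by (rule integrable_continuous_interval) (use f that in \<open>auto intro: continuous_on_subset\<close>)
  have "?F ?a + integral {?a..?b} f = ?F ?b"
    by (rule Henstock_Kurzweil_Integration.integral_combine) (use ab int in auto)
  then have "f ?b / n - (?F ?b - ?F ?a) = integral {?a..?b} (\<lambda>x. f ?b - f x)"
    using ab int by (subst Henstock_Kurzweil_Integration.integral_diff) (auto simp: mult.commute)
  also have "\<bar>\<dots>\<bar> \<le> \<omega> * (?b - ?a)"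
  proof (rule integral_le_const)
    show "(\<lambda>x. f ?b - f x) integrable_on {?a..?b}"
      by (intro integrable_diff int) (use ab in auto)
    fix x assume "x \<in> {?a..?b}"
    then show "\<bar>f ?b - f x\<bar> \<le> \<omega>"
      using ab(3,4) order_trans[OF ab(1), of x] order_trans[OF ab(1) ab(2)] by (intro \<omega>) auto
  qed (use ab in auto)
  finally have 1: "\<bar>f ?b / n - (?F ?b - ?F ?a)\<bar> \<le> \<omega> * (1 / n)" unfolding ab(4) .
  have "{p<..Suc q} = insert (Suc q) {p<..q}" using step by auto
  then have "(\<Sum>k\<in>{p<..Suc q}. f (k / n)) / n - (?F ?b - ?F (p / n)) =
      ((\<Sum>k\<in>{p<..q}. f (k / n)) / n - (?F ?a - ?F (p / n))) + (f ?b / n - (?F ?b - ?F ?a))"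
    by (simp add: add_divide_distrib)
  also have "\<bar>\<dots>\<bar> \<le> \<omega> * (real q - real p) / n + \<omega> * (1 / n)"
  proof (rule order_trans[OF abs_triangle_ineq add_mono[OF _ 1]])
    show "\<bar>(\<Sum>k\<in>{p<..q}. f (k / n)) / n - (?F ?a - ?F (p / n))\<bar> \<le> \<omega> * (real q - real p) / n"
      using step by simp
  qed
  also have "\<dots> = \<omega> * (real (Suc q) - real p) / n"
    by (simp add: add_divide_distrib[symmetric] algebra_simps)
  finally show ?case .
qed

lemma riemann_sum_tendsto:
  fixes f :: "real \<Rightarrow> real"
  assumes f: "continuous_on {0..1} f"
  shows "(\<lambda>n::nat. (\<Sum>k=1..n. f (k / n)) / real n) \<longlonglongrightarrow> integral {0..1} f"
proof -
  have "(\<lambda>n. 1 / real n) \<longlonglongrightarrow> 0" by (rule lim_1_over_n)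
  from ex_modulus[OF f this] obtain \<omega> where \<omega>: "\<omega> \<longlonglongrightarrow> 0" "\<And>n. 0 \<le> \<omega> n"
    "\<And>n x y. x \<in> {0..1} \<Longrightarrow> y \<in> {0..1} \<Longrightarrow> \<bar>x - y\<bar> \<le> 1 / real n \<Longrightarrow> \<bar>f x - f y\<bar> \<le> \<omega> n" by auto
  have "\<bar>(\<Sum>k=1..n. f (k / n)) / real n - integral {0..1} f\<bar> \<le> \<omega> n" if "n \<ge> 1" for n :: nat
    using riemann_sum_error[OF f that, of 0 n "\<omega> n"] \<omega>(3) that
    by (simp add: atLeastSucAtMost_greaterThanAtMost)
  then have "(\<lambda>n::nat. (\<Sum>k=1..n. f (k / n)) / real n - integral {0..1} f) \<longlonglongrightarrow> 0"
    by (intro Lim_null_comparison[OF _ \<omega>(1)] eventually_sequentiallyI[of 1]) simp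
  then show ?thesis by (simp add: LIM_zero_iff)
qed

lemma weighted_tree_sum_root:
  assumes "continuous_on {0..1} (f r)"
  shows "weighted_tree_sum r p {r} k f \<longlonglongrightarrow> integral {0..1} (f r)"
proof -
  have "(\<Sum>\<phi>\<in>PiE {r} (\<lambda>_. {1..n}). f r (\<phi> r / n)) = (\<Sum>k=1..n. f r (k / n))" for n :: nat
    using sum_PiE_insert[of r "{}" "\<lambda>\<phi>. f r (\<phi> r / n)" "{1..n}"] by simp
  then have "weighted_tree_sum r p {r} k f = (\<lambda>n::nat. (\<Sum>k=1..n. f r (k / n)) / real n)"
    by (simp add: weighted_tree_sum_def fun_eq_iff)
  then show ?thesis using riemann_sum_tendsto[OF assms] by simp
qed

lemma average_le:
  fixes g :: "nat \<Rightarrow> real"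
  assumes "\<And>j. j \<in> {1..n} \<Longrightarrow> g j \<le> e" "0 \<le> e" shows "(\<Sum>j=1..n. g j) / n \<le> e"
proof (cases "n = 0")
  case False
  have "(\<Sum>j=1..n. g j) \<le> of_nat (card {1..n}) * e" by (rule sum_bounded_above[OF assms(1)])
  then show ?thesis using False by (simp add: field_simps)
qed (use assms in simp)

subsection \<open>Slow growth\<close>

text \<open>Away from the boundary the band is complete and \<open>f\<close> varies little on it.
  Close to the boundary only a crude bound holds, but these positions form a vanishing fraction,
  which is enough for an average.\<close>

lemma slow_kernel_limit:
  assumes b: "slow_growth b"
  shows "kernel_limit (band_kernel (\<lambda>n. 1 / (2 * real (b n))) b) (\<lambda>f. f)"
  unfolding kernel_limit_def
proof (intro allI impI conjI)
  fix f :: "real \<Rightarrow> real" assume f: "continuous_on {0..1} f"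
  let ?k = "band_kernel (\<lambda>n. 1 / (2 * real (b n))) b"
  have btop: "filterlim (\<lambda>n. real (b n)) at_top sequentially"
    using b filterlim_compose[OF filterlim_real_sequentially] by (auto simp: slow_growth_def)
  have bn: "(\<lambda>n. real (b n) / real n) \<longlonglongrightarrow> 0"
    using b by (auto simp: slow_growth_def dest: smalloD_tendsto)
  from ex_modulus[OF f bn] obtain \<omega> where \<omega>: "\<omega> \<longlonglongrightarrow> 0" "\<And>n. 0 \<le> \<omega> n"
    "\<And>n x y. x \<in> {0..1} \<Longrightarrow> y \<in> {0..1} \<Longrightarrow> \<bar>x - y\<bar> \<le> b n / real n \<Longrightarrow> \<bar>f x - f y\<bar> \<le> \<omega> n" by auto
  obtain M where M: "\<And>x. x \<in> {0..1} \<Longrightarrow> \<bar>f x\<bar> \<le> M"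
    using continuous_imp_bounded_01[OF f] by blast
  have M0: "0 \<le> M" using M[of 0] by simp
  \<comment> \<open>The column sums are at most 2, whence \<open>2 * \<omega> n\<close>. An interior
    column has \<open>2 * b n + 1\<close> entries of size \<open>1 / (2 * b n)\<close>, so its sum
    exceeds 1 by \<open>1 / (2 * b n)\<close>.\<close>
  define e where "e n = 2 * \<omega> n + M / (2 * real (b n))" for n
  let ?g = "\<lambda>n j. \<bar>(\<Sum>x=1..n. ?k n x j * f (x / n)) - f (j / n)\<bar>"
  have unit: "real x / real n \<in> {0..1}" if "x \<in> {1..n}" for x n :: nat
    using that by (auto simp: divide_le_eq)
  have kn: "0 \<le> ?k n x j" for n x j by (simp add: band_kernel_def)
  have col: "(\<Sum>x=1..n. ?k n x j) \<le> 2" if "j \<in> {1..n}" for n j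
    using bounded_slow_kernel[of b] that by (auto simp: bounded_kernel_def)
  have rough: "?g n j \<le> 3 * M" if j: "j \<in> {1..n}" for n j
  proof -
    have "\<bar>\<Sum>x=1..n. ?k n x j * f (x / n)\<bar> \<le> (\<Sum>x=1..n. ?k n x j * M)"
      by (rule order_trans[OF sum_abs sum_mono])
        (use kn M unit in \<open>auto simp: abs_mult intro!: mult_left_mono\<close>)
    also have "\<dots> \<le> 2 * M" using mult_right_mono[OF col[OF j] M0] by (simp add: sum_distrib_right)
    finally show ?thesis using M[OF unit[OF j]] by linarith
  qed
  have fine: "?g n j \<le> e n" if j: "b n < j" "j + b n \<le> n" and b1: "1 \<le> b n" for n j
  proof -
    have jn: "j \<in> {1..n}" using j by auto
    have set: "{x\<in>{1..n}. \<bar>int x - int j\<bar> \<le> int (b n)} = {j - b n..j + b n}" using j by auto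
    have sumk: "(\<Sum>x=1..n. ?k n x j * h x) = (\<Sum>x=j - b n..j + b n. h x) / (2 * real (b n))" for h
    proof -
      have "(\<Sum>x=1..n. ?k n x j * h x) = (\<Sum>x=1..n. if \<bar>int x - int j\<bar> \<le> int (b n) then h x / (2 * b n) else 0)"
        by (rule sum.cong) (auto simp: band_kernel_def)
      also have "\<dots> = (\<Sum>x\<in>{x\<in>{1..n}. \<bar>int x - int j\<bar> \<le> int (b n)}. h x / (2 * b n))"
        by (rule sum.inter_filter[symmetric]) simp
      finally show ?thesis unfolding set by (simp add: sum_divide_distrib)
    qed
    have cardj: "card {j - b n..j + b n} = 2 * b n + 1" using j by simp
    have "(\<Sum>x=1..n. ?k n x j * f (x / n)) - f (j / n)
        = (\<Sum>x=1..n. ?k n x j * (f (x / n) - f (j / n))) + f (j / n) * ((\<Sum>x=1..n. ?k n x j * 1) - 1)"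
    proof -
      have "(\<Sum>x=1..n. ?k n x j * (f (x / n) - f (j / n))) =
          (\<Sum>x=1..n. ?k n x j * f (x / n)) - (\<Sum>x=1..n. ?k n x j * 1) * f (j / n)"
        by (simp only: right_diff_distrib sum_subtractf sum_distrib_right mult_1_right)
      then show ?thesis by (simp only: right_diff_distrib mult.commute[of "f (j / n)"])
    qed
    also have "(\<Sum>x=1..n. ?k n x j * 1) - 1 = 1 / (2 * b n)"
      unfolding sumk using cardj b1 by (simp add: field_simps)
    also have "\<bar>(\<Sum>x=1..n. ?k n x j * (f (x / n) - f (j / n))) + f (j / n) * (1 / (2 * b n))\<bar>
      \<le> 2 * \<omega> n + M * (1 / (2 * b n))"
    proof (rule order_trans[OF abs_triangle_ineq add_mono])
      have "\<bar>\<Sum>x=1..n. ?k n x j * (f (x / n) - f (j / n))\<bar> \<le> (\<Sum>x=1..n. ?k n x j * \<omega> n)"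
      proof (rule order_trans[OF sum_abs sum_mono])
        fix x assume x: "x \<in> {1..n}"
        have "\<bar>f (x / n) - f (j / n)\<bar> \<le> \<omega> n" if "\<bar>int x - int j\<bar> \<le> int (b n)"
        proof (rule \<omega>(3)[OF unit[OF x] unit[OF jn]])
          have "\<bar>real x - real j\<bar> \<le> real (b n)" using that by linarith
          then show "\<bar>x / n - j / n\<bar> \<le> b n / real n"
            by (simp add: diff_divide_distrib[symmetric] abs_divide divide_right_mono)
        qed
        then show "\<bar>?k n x j * (f (x / n) - f (j / n))\<bar> \<le> ?k n x j * \<omega> n"
          by (auto simp: band_kernel_def abs_mult divide_right_mono)
      qed
      also have "\<dots> \<le> 2 * \<omega> n" using mult_right_mono[OF col[OF jn] \<omega>(2)] by (simp add: sum_distrib_right)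
      finally show "\<bar>\<Sum>x=1..n. ?k n x j * (f (x / n) - f (j / n))\<bar> \<le> 2 * \<omega> n" .
      show "\<bar>f (j / n) * (1 / (2 * b n))\<bar> \<le> M * (1 / (2 * b n))"
        unfolding abs_mult using M[OF unit[OF jn]] by (intro mult_mono) auto
    qed
    finally show ?thesis by (simp add: e_def)
  qed
  have bound: "norm ((\<Sum>j=1..n. ?g n j) / n) \<le> e n + 6 * M * (b n / n)" if b1: "1 \<le> b n" for n
  proof -
    \<comment> \<open>At most \<open>b n\<close> positions at either end see a truncated band, so
      the crude bound \<open>3 * M\<close> costs \<open>6 * M * (b n / n)\<close> on
      average.\<close>
    let ?B = "{j\<in>{1..n}. j \<le> b n \<or> n < j + b n}"
    have e0: "0 \<le> e n" using \<omega>(2) M0 by (simp add: e_def)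
    have "?g n j \<le> e n + (if j \<le> b n \<or> n < j + b n then 3 * M else 0)" if j: "j \<in> {1..n}" for j
      using rough[OF j] fine[of n j] b1 e0 by (auto simp: not_le not_less)
    then have "(\<Sum>j=1..n. ?g n j) \<le> (\<Sum>j=1..n. e n + (if j \<le> b n \<or> n < j + b n then 3 * M else 0))"
      by (rule sum_mono)
    also have "\<dots> = n * e n + 3 * M * card ?B"
      by (simp add: sum.distrib sum.If_cases Int_def)
    also have "\<dots> \<le> n * e n + 3 * M * (2 * b n)"
    proof -
      have "?B \<subseteq> {1..b n} \<union> {n - b n<..n}" by auto
      from card_mono[OF _ this] have "card ?B \<le> card ({1..b n} \<union> {n - b n<..n})" by simp
      also have "\<dots> \<le> 2 * b n" by (rule order_trans[OF card_Un_le]) simp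
      finally have "real (card ?B) \<le> 2 * b n" by simp
      then show ?thesis using M0 by (intro add_left_mono mult_left_mono) auto
    qed
    finally have "(\<Sum>j=1..n. ?g n j) / n \<le> (n * e n + 3 * M * (2 * b n)) / n"
      by (rule divide_right_mono) simp
    also have "\<dots> \<le> e n + 6 * M * (b n / n)" using e0 by (cases "n = 0") (auto simp: field_simps)
    finally show ?thesis by (simp add: sum_nonneg)
  qed
  have "(\<lambda>n. e n + 6 * M * (b n / n)) \<longlonglongrightarrow> (2 * 0 + 0) + 6 * M * 0"
    unfolding e_def
  proof (intro tendsto_add tendsto_mult tendsto_const \<omega>(1) bn)
    have "filterlim (\<lambda>n. 2 * real (b n)) at_top sequentially"
      by (rule filterlim_tendsto_pos_mult_at_top[OF tendsto_const _ btop]) simp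
    then show "(\<lambda>n. M / (2 * real (b n))) \<longlonglongrightarrow> 0"
      by (intro tendsto_divide_0[OF tendsto_const] filterlim_at_top_imp_at_infinity)
  qed
  then have lim: "(\<lambda>n. e n + 6 * M * (b n / n)) \<longlonglongrightarrow> 0" by simp
  have "eventually (\<lambda>n. 1 \<le> b n) sequentially"
    using b by (auto simp: slow_growth_def filterlim_at_top)
  then show "(\<lambda>n. (\<Sum>j=1..n. ?g n j) / n) \<longlonglongrightarrow> 0"
    by (intro Lim_null_comparison[OF _ lim]) (rule eventually_mono[OF _ bound])
qed

subsection \<open>Proportional growth\<close>

text \<open>Differences of the primitive from 0, rather than an integral over the window, reduce
  continuity and shifts of the end points to facts about one function. The denominator is the area
  of the band of half-width \<open>c\<close> in the unit square.\<close>

definition window :: "real \<Rightarrow> (real \<Rightarrow> real) \<Rightarrow> real \<Rightarrow> real" where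
  "window c f x = (integral {0..min 1 (x + c)} f - integral {0..max 0 (x - c)} f) / (2 * c - c\<^sup>2)"

lemma window_denominator: "0 < c \<Longrightarrow> c \<le> 1 \<Longrightarrow> 0 < 2 * c - c\<^sup>2" for c :: real
proof -
  assume c: "0 < c" "c \<le> 1"
  have "0 < c * (2 - c)" using c by simp
  then show ?thesis by (simp add: power2_eq_square algebra_simps)
qed

lemma continuous_window:
  assumes "continuous_on {0..1} f" "0 < c" "c \<le> 1"
  shows "continuous_on {0..1} (window c f)"
proof -
  have F: "continuous_on {0..1} (\<lambda>x. integral {0..x} f)"
    by (rule indefinite_integral_continuous_1) (use assms in \<open>auto intro: integrable_continuous_interval\<close>)
  have "continuous_on {0..1} (\<lambda>x. integral {0..min 1 (x + c)} f)"
    by (rule continuous_on_compose2[OF F]) (use assms in \<open>auto intro!: continuous_intros\<close>)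
  moreover have "continuous_on {0..1} (\<lambda>x. integral {0..max 0 (x - c)} f)"
    by (rule continuous_on_compose2[OF F]) (use assms in \<open>auto intro!: continuous_intros\<close>)
  ultimately show ?thesis unfolding window_def
    using window_denominator[of c] assms by (auto intro!: continuous_intros)
qed

text \<open>The error is uniform here. A Riemann sum turns the sum over the band into a difference
  of the primitive, which is Lipschitz with constant \<open>M\<close>, so the discrete end points
  can be moved to those of the window.\<close>

lemma proportional_kernel_limit:
  assumes b: "proportional_growth b c"
  shows "kernel_limit (band_kernel (\<lambda>n. 1 / ((2 * c - c\<^sup>2) * real n)) b) (window c)"
  unfolding kernel_limit_def
proof (intro allI impI conjI)
  fix f :: "real \<Rightarrow> real" assume f: "continuous_on {0..1} f"
  have c: "0 < c" "c \<le> 1" and bn: "(\<lambda>n. real (b n) / real n) \<longlonglongrightarrow> c"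
    using b by (auto simp: proportional_growth_def)
  show "continuous_on {0..1} (window c f)" by (rule continuous_window[OF f c])
  define D where "D = 2 * c - c\<^sup>2"
  have D: "0 < D" unfolding D_def by (rule window_denominator[OF c])
  let ?k = "band_kernel (\<lambda>n. 1 / (D * real n)) b"
  let ?F = "\<lambda>x. integral {0..x} f"
  from ex_modulus[OF f lim_1_over_n] obtain \<omega> where \<omega>: "\<omega> \<longlonglongrightarrow> 0" "\<And>n. 0 \<le> \<omega> n"
    "\<And>n x y. x \<in> {0..1} \<Longrightarrow> y \<in> {0..1} \<Longrightarrow> \<bar>x - y\<bar> \<le> 1 / real n \<Longrightarrow> \<bar>f x - f y\<bar> \<le> \<omega> n" by auto
  obtain M where M: "\<And>x. x \<in> {0..1} \<Longrightarrow> \<bar>f x\<bar> \<le> M"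
    using continuous_imp_bounded_01[OF f] by blast
  have M0: "0 \<le> M" using M[of 0] by simp
  have int: "f integrable_on {u..v}" if "0 \<le> u" "v \<le> 1" for u v
    by (rule integrable_continuous_interval) (use f that in \<open>auto intro: continuous_on_subset\<close>)
  have lip1: "\<bar>?F y - ?F x\<bar> \<le> M * \<bar>y - x\<bar>" if "0 \<le> x" "x \<le> y" "y \<le> 1" for x y
  proof -
    have "?F x + integral {x..y} f = ?F y"
      by (rule Henstock_Kurzweil_Integration.integral_combine) (use that int in auto)
    moreover have "\<bar>integral {x..y} f\<bar> \<le> M * (y - x)"
      by (rule integral_le_const) (use that int M in auto)
    ultimately show ?thesis using that by auto
  qed
  have lip: "\<bar>?F y - ?F x\<bar> \<le> M * \<bar>y - x\<bar>" if "x \<in> {0..1}" "y \<in> {0..1}" for x y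
    using lip1[of x y] lip1[of y x] that by (cases "x \<le> y") (auto simp: abs_minus_commute)
  \<comment> \<open>The Riemann error, the shift of both end points from \<open>b n / n\<close> to
    \<open>c\<close>, and one mesh width at the left end.\<close>
  define e where "e n = (\<omega> n + 2 * M * \<bar>b n / n - c\<bar> + M * (1 / n)) / D" for n
  have e0: "0 \<le> e n" for n using \<omega>(2) M0 D by (simp add: e_def)
  have bound: "\<bar>(\<Sum>x=1..n. ?k n x j * f (x / n)) - window c f (j / n)\<bar> \<le> e n" if j: "j \<in> {1..n}" for n j
  proof -
    have n1: "1 \<le> n" and n0: "0 < real n" using j by auto
    \<comment> \<open>Riemann sums run over half-open ranges, so the left end is the position before
      the first one in the band; truncated subtraction does the job of \<open>max 0\<close>.\<close>
    let ?p = "j - (b n + 1)" and ?q = "min n (j + b n)"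
    let ?q' = "min 1 (j / n + c)" and ?p' = "max 0 (j / n - c)"
    have set: "{x\<in>{1..n}. \<bar>int x - int j\<bar> \<le> int (b n)} = {?p<..?q}" using j by auto
    have "(\<Sum>x=1..n. ?k n x j * f (x / n)) = (\<Sum>x=1..n. if \<bar>int x - int j\<bar> \<le> int (b n) then f (x / n) / (D * n) else 0)"
      by (rule sum.cong) (auto simp: band_kernel_def)
    also have "\<dots> = (\<Sum>x\<in>{x\<in>{1..n}. \<bar>int x - int j\<bar> \<le> int (b n)}. f (x / n) / (D * n))"
      by (rule sum.inter_filter[symmetric]) simp
    finally have s: "(\<Sum>x=1..n. ?k n x j * f (x / n)) = ((\<Sum>x\<in>{?p<..?q}. f (x / n)) / n) / D"
      unfolding set by (simp add: sum_divide_distrib mult.commute)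
    have 1: "\<bar>(\<Sum>x\<in>{?p<..?q}. f (x / n)) / n - (?F (?q / n) - ?F (?p / n))\<bar> \<le> \<omega> n * (real ?q - real ?p) / n"
      by (rule riemann_sum_error[OF f n1]) (use j \<omega>(3) in auto)
    have "real ?q - real ?p \<le> n" by simp
    then have "\<omega> n * (real ?q - real ?p) / n \<le> \<omega> n * n / n"
      using \<omega>(2) by (intro divide_right_mono mult_left_mono) auto
    with 1 n0 have 1: "\<bar>(\<Sum>x\<in>{?p<..?q}. f (x / n)) / n - (?F (?q / n) - ?F (?p / n))\<bar> \<le> \<omega> n" by simp
    have qn: "real ?q / n = min 1 (j / n + b n / n)"
      using n0 by (auto simp: min_def field_simps of_nat_add[symmetric] simp del: of_nat_add)
    have pn: "real ?p / n = max 0 (j / n - b n / n - 1 / n)"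
    proof -
      have "real ?p = max 0 (real j - real (b n) - 1)" by auto
      then have "real ?p / n = max (0 / n) ((real j - real (b n) - 1) / n)"
        using n0 by (simp only: max_divide_distrib_right) simp
      then show ?thesis by (simp add: diff_divide_distrib)
    qed
    have "\<bar>?F (?q / n) - ?F ?q'\<bar> \<le> M * \<bar>?q / n - ?q'\<bar>"
      by (rule lip) (use c j n0 in \<open>auto simp: divide_le_eq\<close>)
    also have "\<bar>?q / n - ?q'\<bar> \<le> \<bar>b n / n - c\<bar>" unfolding qn by (auto simp: min_def abs_if)
    finally have 2: "\<bar>?F (?q / n) - ?F ?q'\<bar> \<le> M * \<bar>b n / n - c\<bar>" using M0 by (simp add: mult_left_mono)
    have "\<bar>?F (?p / n) - ?F ?p'\<bar> \<le> M * \<bar>?p / n - ?p'\<bar>"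
      proof (rule lip)
      have "real j / n \<le> 1" using j by (simp add: divide_le_eq)
      then show "?p' \<in> {0..1}" using c by auto
    qed (use c j n0 in \<open>auto simp: divide_le_eq\<close>)
    also have "\<bar>?p / n - ?p'\<bar> \<le> \<bar>b n / n - c\<bar> + 1 / n"
    proof -
      have max_lip: "\<bar>max 0 u - max 0 v\<bar> \<le> \<bar>u - v\<bar>" for u v :: real by (auto simp: max_def)
      have "0 \<le> 1 / real n" by simp
      then show ?thesis
        unfolding pn using max_lip[of "j / n - b n / n - 1 / n" "j / n - c"] by linarith
    qed
    finally have 3: "\<bar>?F (?p / n) - ?F ?p'\<bar> \<le> M * (\<bar>b n / n - c\<bar> + 1 / n)" using M0 by (simp add: mult_left_mono)
    have "\<bar>(\<Sum>x\<in>{?p<..?q}. f (x / n)) / n - (?F ?q' - ?F ?p')\<bar>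
        \<le> \<omega> n + 2 * M * \<bar>b n / n - c\<bar> + M * (1 / n)"
    proof -
      have tri: "\<bar>S - (a' - b')\<bar> \<le> x + (y + z)"
        if "\<bar>S - (a - b)\<bar> \<le> x" "\<bar>a - a'\<bar> \<le> y" "\<bar>b - b'\<bar> \<le> z" for S a b a' b' x y z :: real
        using that by linarith
      show ?thesis using tri[OF 1 2 3] by (simp add: algebra_simps)
    qed
    then have "\<bar>((\<Sum>x\<in>{?p<..?q}. f (x / n)) / n - (?F ?q' - ?F ?p')) / D\<bar> \<le> e n"
      unfolding e_def abs_divide using D by (simp add: divide_right_mono)
    then show ?thesis unfolding s window_def D_def[symmetric] by (simp add: diff_divide_distrib)
  qed
  have "(\<lambda>n. \<bar>b n / n - c\<bar>) \<longlonglongrightarrow> 0"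
    by (rule tendsto_rabs_zero) (use bn in \<open>simp add: LIM_zero_iff\<close>)
  then have "(\<lambda>n. e n) \<longlonglongrightarrow> (0 + 2 * M * 0 + M * 0) / D"
    unfolding e_def using D by (intro tendsto_intros \<omega>(1) lim_1_over_n) auto
  then have lim: "e \<longlonglongrightarrow> 0" by simp
  show "(\<lambda>n. (\<Sum>j=1..n. \<bar>(\<Sum>x=1..n. band_kernel (\<lambda>n. 1 / ((2 * c - c\<^sup>2) * real n)) b n x j * f (x / n))
      - window c f (j / n)\<bar>) / n) \<longlonglongrightarrow> 0"
    unfolding D_def[symmetric]
  proof (rule Lim_null_comparison[OF _ lim])
    have "norm ((\<Sum>j=1..n. \<bar>(\<Sum>x=1..n. ?k n x j * f (x / n)) - window c f (j / n)\<bar>) / n) \<le> e n" for n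
      using average_le[of n "\<lambda>j. \<bar>(\<Sum>x=1..n. ?k n x j * f (x / n)) - window c f (j / n)\<bar>" "e n"] bound e0
      by (simp add: sum_nonneg)
    then show "\<forall>\<^sub>F n in sequentially. norm ((\<Sum>j=1..n. \<bar>(\<Sum>x=1..n. ?k n x j * f (x / n)) - window c f (j / n)\<bar>) / n) \<le> e n"
      by simp
  qed
qed

subsection \<open>The window operator applied to constants\<close>

text \<open>The primitive is half the square of the positive part; the kink at \<open>t\<close> is
  the exceptional point that the fundamental theorem admits. Truncation of a window at the ends of
  the interval is expressed by such positive parts.\<close>

lemma integral_positive_part:
  fixes t :: real assumes "0 \<le> t" "t \<le> 1"
  shows "((\<lambda>x. max 0 (x - t)) has_integral (1 - t)\<^sup>2 / 2) {0..1}"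
proof -
  have "((\<lambda>x. max 0 (x - t)) has_integral (max 0 (1 - t))\<^sup>2 / 2 - (max 0 (0 - t))\<^sup>2 / 2) {0..1}"
  proof (rule fundamental_theorem_of_calculus_interior_strong[where S = "{t}"])
    show "continuous_on {0..1} (\<lambda>x. (max 0 (x - t))\<^sup>2 / 2)" by (intro continuous_intros) auto
    fix x assume x: "x \<in> {0<..<1} - {t}"
    show "((\<lambda>x. (max 0 (x - t))\<^sup>2 / 2) has_vector_derivative max 0 (x - t)) (at x)"
    proof (cases "x < t")
      case True
      have "((\<lambda>x. 0) has_vector_derivative (0::real)) (at x)" by simp
      then have "((\<lambda>x. (max 0 (x - t))\<^sup>2 / 2) has_vector_derivative 0) (at x)"
        by (rule has_vector_derivative_transform_within_open[where S = "{..<t}"]) (use True in auto)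
      then show ?thesis using True by simp
    next
      case False
      then have "t < x" using x by auto
      have "((\<lambda>x. (x - t)\<^sup>2 / 2) has_real_derivative (x - t)) (at x)"
        by (auto intro!: derivative_eq_intros)
      then have "((\<lambda>x. (x - t)\<^sup>2 / 2) has_vector_derivative (x - t)) (at x)"
        by (simp add: has_real_derivative_iff_has_vector_derivative)
      then have "((\<lambda>x. (max 0 (x - t))\<^sup>2 / 2) has_vector_derivative (x - t)) (at x)"
        by (rule has_vector_derivative_transform_within_open[where S = "{t<..}"]) (use \<open>t < x\<close> in auto)
      then show ?thesis using \<open>t < x\<close> by simp
    qed
  qed auto
  then show ?thesis using assms by simp
qed

lemma window_one:
  assumes "0 < c" "c \<le> 1" "x \<in> {0..1}"
  shows "window c (\<lambda>_. 1) x = (min 1 (x + c) - max 0 (x - c)) / (2 * c - c\<^sup>2)"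
  using assms by (simp add: window_def)

text \<open>Both truncations are positive parts: \<open>min 1 (x + c)\<close> is
  \<open>x + c\<close> minus that of \<open>x - (1 - c)\<close>. The integral is the area 2c - c^2
  of the band, so the normalization gives mean 1, which becomes the mass of a single edge.\<close>

lemma integral_window_one:
  assumes "0 < c" "c \<le> 1" shows "(window c (\<lambda>_. 1) has_integral 1) {0..1}"
proof -
  have D: "0 < 2 * c - c\<^sup>2" by (rule window_denominator[OF assms])
  have "((\<lambda>x. x + c) has_integral (1\<^sup>2 / 2 + c * 1 - (0\<^sup>2 / 2 + c * 0))) {0..1}"
    by (rule fundamental_theorem_of_calculus)
      (auto simp: has_real_derivative_iff_has_vector_derivative[symmetric] intro!: derivative_eq_intros)
  then have "((\<lambda>x. x + c - max 0 (x - (1 - c)) - max 0 (x - c)) has_integral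
      (1/2 + c) - (1 - (1 - c))\<^sup>2 / 2 - (1 - c)\<^sup>2 / 2) {0..1}"
    by (intro has_integral_diff integral_positive_part) (use assms in auto)
  from has_integral_divide[OF this, of "2 * c - c\<^sup>2"]
  have "((\<lambda>x. (x + c - max 0 (x - (1 - c)) - max 0 (x - c)) / (2 * c - c\<^sup>2)) has_integral
      ((1/2 + c) - (1 - (1 - c))\<^sup>2 / 2 - (1 - c)\<^sup>2 / 2) / (2 * c - c\<^sup>2)) {0..1}" .
  also have "(1/2 + c) - (1 - (1 - c))\<^sup>2 / 2 - (1 - c)\<^sup>2 / 2 = 2 * c - c\<^sup>2"
    by (simp add: power2_eq_square field_simps)
  finally have "((\<lambda>x. (x + c - max 0 (x - (1 - c)) - max 0 (x - c)) / (2 * c - c\<^sup>2)) has_integral 1) {0..1}"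
    using D by simp
  then show ?thesis
    by (rule has_integral_eq[rotated]) (auto simp: window_one[OF assms] min_def max_def)
qed

text \<open>In this form the window of 1 depends on the distance to the boundary only and increases
  with it. The cap \<open>min c (1 - c)\<close> is reached when the window lies inside the interval
  or covers all of it.\<close>

lemma window_one_eq:
  fixes c x :: real assumes "0 < c" "c \<le> 1" "x \<in> {0..1}"
  shows "window c (\<lambda>_. 1) x = (c + min (min x (1 - x)) (min c (1 - c))) / (2 * c - c\<^sup>2)"
  unfolding window_one[OF assms] using assms by (auto simp: min_def max_def intro!: arg_cong[where f = "\<lambda>y. y / _"])

text \<open>Chebyshev's inequality: both functions increase with the distance of \<open>x\<close> to the boundary,
  and at distance \<open>c * (1 - c)\<close> the first one takes its mean value 1.\<close>

lemma integral_window_product_gt: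
  fixes c c' :: real assumes c: "0 < c" "c < 1" and c': "0 < c'" "c' < 1"
  shows "integral {0..1} (\<lambda>x. window c (\<lambda>_. 1) x * window c' (\<lambda>_. 1) x) > 1"
proof -
  define g where "g c s = (c + min s (min c (1 - c))) / (2 * c - c\<^sup>2)" for c s :: real
  have g_mono: "g c s \<le> g c t" if "0 < c" "c < 1" "s \<le> t" for c s t
    unfolding g_def using that window_denominator[of c] by (intro divide_right_mono) auto
  let ?m = "\<lambda>x::real. min x (1 - x)"
  let ?d = "window c (\<lambda>_. 1)" and ?d' = "window c' (\<lambda>_. 1)"
  define s where "s = c * (1 - c)"
  have s: "0 < s" "s \<le> c" "s \<le> 1 - c" using c by (auto simp: s_def mult_left_le mult_left_le_one_le)
  have D: "0 < 2 * c - c\<^sup>2" "0 < 2 * c' - c'\<^sup>2" using window_denominator c c' by auto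
  have gs: "g c s = 1"
  proof -
    have "c + s = 2 * c - c\<^sup>2" by (simp add: s_def power2_eq_square algebra_simps)
    then show ?thesis using s D by (simp add: g_def)
  qed
  have d: "?d x = g c (?m x)" "?d' x = g c' (?m x)" if "x \<in> {0..1}" for x
    using window_one_eq[of c x] window_one_eq[of c' x] c c' that by (auto simp: g_def)
  \<comment> \<open>Since the first factor has mean 0, any constant may be subtracted from the
    second window; its value at distance \<open>s\<close> makes the two factors change sign
    together.\<close>
  let ?h = "\<lambda>x. (?d x - 1) * (?d' x - g c' s)"
  have cont: "continuous_on {0..1} ?d" "continuous_on {0..1} ?d'"
    using c c' by (auto intro!: continuous_window)
  have nonneg: "0 \<le> ?h x" if "x \<in> {0..1}" for x
  proof (cases "?m x \<le> s")
    case True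
    then have "?d x \<le> 1" "?d' x \<le> g c' s"
      unfolding d[OF that] using g_mono[OF c True] g_mono[OF c' True] gs by auto
    then show ?thesis by (intro mult_nonpos_nonpos) auto
  next
    case False
    then have "s \<le> ?m x" by linarith
    then have "1 \<le> ?d x" "g c' s \<le> ?d' x"
      unfolding d[OF that] using g_mono[OF c] g_mono[OF c'] gs by metis+
    then show ?thesis by (intro mult_nonneg_nonneg) auto
  qed
  \<comment> \<open>Strictness at the boundary point 0 rests on \<open>s > 0\<close>, that is, on
    \<open>c < 1\<close>: for full proportion the window of 1 would be constant.\<close>
  have "?d 0 < 1" "?d' 0 < g c' s"
  proof -
    have "?d 0 = c / (2 * c - c\<^sup>2)" "?d' 0 = c' / (2 * c' - c'\<^sup>2)"
      using d[of 0] c c' by (auto simp: g_def)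
    moreover have "c < 2 * c - c\<^sup>2" using s(1) by (simp add: s_def power2_eq_square algebra_simps)
    moreover have "c' / (2 * c' - c'\<^sup>2) < g c' s"
      unfolding g_def using s c' D by (intro divide_strict_right_mono) auto
    ultimately show "?d 0 < 1" "?d' 0 < g c' s" using D by auto
  qed
  then have h0: "0 < ?h 0" by (intro mult_neg_neg) auto
  have hc: "continuous_on {0..1} ?h" using cont by (intro continuous_intros)
  have "integral {0..1} ?h \<noteq> 0"
    using integral_eq_0_iff[OF hc _ nonneg] h0 by fastforce
  moreover have "0 \<le> integral {0..1} ?h"
    by (rule integral_nonneg) (use hc nonneg in \<open>auto intro: integrable_continuous_interval\<close>)
  ultimately have "0 < integral {0..1} ?h" by simp
  moreover have "integral {0..1} ?h = integral {0..1} (\<lambda>x. ?d x * ?d' x) - 1"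
  proof -
    have "((\<lambda>x. ?d x * ?d' x) has_integral integral {0..1} (\<lambda>x. ?d x * ?d' x)) {0..1}"
      by (intro integrable_integral integrable_continuous_interval continuous_on_mult cont)
    moreover have "(?d has_integral 1) {0..1}" "(?d' has_integral 1) {0..1}"
      using integral_window_one c c' by auto
    moreover have "((\<lambda>_. g c' s) has_integral g c' s) {0..1::real}"
      using has_integral_const_real[of "g c' s" 0 1] by simp
    ultimately have "((\<lambda>x. ?d x * ?d' x - g c' s * ?d x - ?d' x + g c' s) has_integral
      integral {0..1} (\<lambda>x. ?d x * ?d' x) - g c' s * 1 - 1 + g c' s) {0..1}"
      by (intro has_integral_add has_integral_diff has_integral_mult_right)
    then have "(?h has_integral integral {0..1} (\<lambda>x. ?d x * ?d' x) - 1) {0..1}"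
      by (simp add: algebra_simps)
    then show ?thesis by (rule integral_unique)
  qed
  ultimately show ?thesis by simp
qed


section \<open>Independence of the entries and exact expectations of classes\<close>

section \<open>Injective traffic states of band matrices\<close>

text \<open>The growth regime enters only through the scale \<open>s\<close>, the bound
  \<open>C\<close> and the limit operator \<open>Op\<close> of the squared kernel, so slow and
  proportional labels are treated at once. The bounds are at least 1 so that a constant kernel 1/n
  obeys them too and a product may be enlarged by further factors.\<close>

locale band_matrices =
  fixes M :: "nat \<Rightarrow> 'w measure" and L :: "'i set" and \<beta> :: "'i \<Rightarrow> real"
    and X A :: "nat \<Rightarrow> 'i \<Rightarrow> 'w random_matrix"
    and s :: "'i \<Rightarrow> nat \<Rightarrow> real" and b :: "'i \<Rightarrow> nat \<Rightarrow> nat"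
    and C :: "'i \<Rightarrow> real" and Op :: "'i \<Rightarrow> (real \<Rightarrow> real) \<Rightarrow> real \<Rightarrow> real"
  assumes wigner: "wigner_family M L \<beta> X"
    and A_eq: "\<And>n i. i \<in> L \<Longrightarrow> A n i = (\<lambda>j k \<omega>. complex_of_real (s i n) * band_matrix (b i n) (X n i) j k \<omega>)"
    and s_nonneg: "\<And>i n. 0 \<le> s i n"
    and s_tendsto: "\<And>i. i \<in> L \<Longrightarrow> s i \<longlonglongrightarrow> 0"
    and C_ge_1: "\<And>i. i \<in> L \<Longrightarrow> 1 \<le> C i"
    and bounded: "\<And>i. i \<in> L \<Longrightarrow> bounded_kernel (band_kernel (\<lambda>n. (s i n)\<^sup>2) (b i)) (C i)"
    and limit: "\<And>i. i \<in> L \<Longrightarrow> kernel_limit (band_kernel (\<lambda>n. (s i n)\<^sup>2) (b i)) (Op i)"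
begin

abbreviation "kern i \<equiv> band_kernel (\<lambda>n. (s i n)\<^sup>2) (b i)"

definition amp :: "nat \<Rightarrow> 'i \<Rightarrow> nat \<Rightarrow> nat \<Rightarrow> real" where
  "amp n i j k = (if \<bar>int j - int k\<bar> \<le> int (b i n) then s i n else 0)"

lemma amp_nonneg: "0 \<le> amp n i j k" using s_nonneg by (simp add: amp_def)

lemma amp_le: "amp n i j k \<le> s i n" using s_nonneg by (simp add: amp_def)

lemma amp_sym: "amp n i j k = amp n i k j" by (simp add: amp_def abs_minus_commute)

lemma amp_square: "amp n i j k * amp n i j k = kern i n j k"
  by (simp add: amp_def band_kernel_def power2_eq_square)

lemma A_amp: "i \<in> L \<Longrightarrow> A n i j k \<omega> = of_real (amp n i j k) * X n i j k \<omega>"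
  by (simp add: A_eq amp_def band_matrix_def)

lemma prob_space_M: "prob_space (M n)" using wigner by (simp add: wigner_family_def)

lemma X_cnj:
  "i \<in> L \<Longrightarrow> j \<in> {1..n} \<Longrightarrow> k \<in> {1..n} \<Longrightarrow> \<omega> \<in> space (M n) \<Longrightarrow> X n i j k \<omega> = cnj (X n i k j \<omega>)"
  using wigner[unfolded wigner_family_def, THEN conjunct2, THEN conjunct1] by blast

abbreviation "upper n \<equiv> {(j, k). 1 \<le> j \<and> j \<le> k \<and> k \<le> n}"

lemma X_indep: "prob_space.indep_vars (M n) (\<lambda>_. borel) (\<lambda>(i, j, k). X n i j k) (L \<times> upper n)"
  using wigner by (simp add: wigner_family_def)

lemma X_measurable:
  assumes "i \<in> L" "(j, k) \<in> upper n" shows "X n i j k \<in> borel_measurable (M n)"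
proof -
  interpret prob_space "M n" by (rule prob_space_M)
  have "\<forall>t\<in>L \<times> upper n. (case t of (i, j, k) \<Rightarrow> X n i j k) \<in> borel_measurable (M n)"
    using X_indep[of n] unfolding indep_vars_def by blast
  then show ?thesis using assms by force
qed

text \<open>The suprema in the assumption become one real constant for all exponents up to
  \<open>m\<close>; a test graph with \<open>m\<close> arcs involves no higher moments.\<close>

lemma X_moments:
  assumes "finite I0" "I0 \<subseteq> L"
  shows "\<exists>B\<ge>1. \<forall>l\<le>m. \<forall>n. \<forall>i\<in>I0. \<forall>(j, k)\<in>upper n.
    integrable (M n) (\<lambda>\<omega>. cmod (X n i j k \<omega>) ^ l) \<and> (\<integral>\<omega>. cmod (X n i j k \<omega>) ^ l \<partial>M n) \<le> B"
proof -
  define S where "S l = (SUP n. SUP i\<in>I0. SUP (j, k)\<in>upper n. \<integral>\<^sup>+\<omega>. ennreal ((cmod (X n i j k \<omega>)) ^ l) \<partial>M n)" for l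
  have Sfin: "S l < \<infinity>" for l
    using wigner assms unfolding wigner_family_def S_def by blast
  have le: "(\<integral>\<^sup>+\<omega>. ennreal ((cmod (X n i j k \<omega>)) ^ l) \<partial>M n) \<le> S l" if "i \<in> I0" "(j, k) \<in> upper n" for n i j k l
  proof -
    have "(\<integral>\<^sup>+\<omega>. ennreal ((cmod (X n i j k \<omega>)) ^ l) \<partial>M n)
        \<le> (SUP (j, k)\<in>upper n. \<integral>\<^sup>+\<omega>. ennreal ((cmod (X n i j k \<omega>)) ^ l) \<partial>M n)"
      by (rule SUP_upper2[OF that(2)]) simp
    also have "\<dots> \<le> (SUP i\<in>I0. SUP (j, k)\<in>upper n. \<integral>\<^sup>+\<omega>. ennreal ((cmod (X n i j k \<omega>)) ^ l) \<partial>M n)"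
      by (rule SUP_upper[OF that(1)])
    also have "\<dots> \<le> S l" unfolding S_def by (rule SUP_upper) simp
    finally show ?thesis .
  qed
  define B where "B = 1 + (\<Sum>l\<le>m. enn2real (S l))"
  have B: "enn2real (S l) \<le> B" if "l \<le> m" for l
  proof -
    have "enn2real (S l) \<le> (\<Sum>l\<le>m. enn2real (S l))" by (rule member_le_sum) (use that in auto)
    then show ?thesis by (simp add: B_def)
  qed
  have "integrable (M n) (\<lambda>\<omega>. cmod (X n i j k \<omega>) ^ l) \<and> (\<integral>\<omega>. cmod (X n i j k \<omega>) ^ l \<partial>M n) \<le> B"
    if "l \<le> m" "i \<in> I0" "(j, k) \<in> upper n" for l n i j k
  proof -
    have meas: "X n i j k \<in> borel_measurable (M n)" using X_measurable that assms by blast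
    have fin: "(\<integral>\<^sup>+\<omega>. ennreal (cmod (X n i j k \<omega>) ^ l) \<partial>M n) < \<infinity>"
      using le[OF that(2,3)] Sfin by (rule le_less_trans)
    have int: "integrable (M n) (\<lambda>\<omega>. cmod (X n i j k \<omega>) ^ l)"
      by (rule integrableI_nonneg) (use meas fin in auto)
    have "(\<integral>\<omega>. cmod (X n i j k \<omega>) ^ l \<partial>M n) = enn2real (\<integral>\<^sup>+\<omega>. ennreal (cmod (X n i j k \<omega>) ^ l) \<partial>M n)"
      by (rule integral_eq_nn_integral) (use meas in auto)
    also have "\<dots> \<le> enn2real (S l)"
      by (rule enn2real_mono[OF le[OF that(2,3)]]) (use Sfin in simp)
    finally show ?thesis using int B[OF that(1)] by simp
  qed
  moreover have "1 \<le> B" by (simp add: B_def sum_nonneg)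
  ultimately show ?thesis by blast
qed

subsection \<open>Expectations factor over classes of parallel arcs\<close>

definition entry :: "('v, 'e) pre_digraph \<Rightarrow> ('e \<Rightarrow> 'i) \<Rightarrow> nat \<Rightarrow> ('v \<Rightarrow> nat) \<Rightarrow> 'e \<Rightarrow> 'w \<Rightarrow> complex" where
  "entry T \<gamma> n \<phi> e \<omega> = A n (\<gamma> e) (\<phi> (head T e)) (\<phi> (tail T e)) \<omega>"

definition eamp :: "('v, 'e) pre_digraph \<Rightarrow> ('e \<Rightarrow> 'i) \<Rightarrow> nat \<Rightarrow> ('v \<Rightarrow> nat) \<Rightarrow> 'e \<Rightarrow> real" where
  "eamp T \<gamma> n \<phi> e = amp n (\<gamma> e) (\<phi> (head T e)) (\<phi> (tail T e))"

definition class_arcs :: "('v, 'e) pre_digraph \<Rightarrow> ('e \<Rightarrow> 'i) \<Rightarrow> 'i \<times> 'v set \<Rightarrow> 'e set" where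
  "class_arcs T \<gamma> q = {e \<in> arcs T. arc_class T \<gamma> e = q}"

abbreviation class_mean :: "('v, 'e) pre_digraph \<Rightarrow> ('e \<Rightarrow> 'i) \<Rightarrow> nat \<Rightarrow> ('v \<Rightarrow> nat) \<Rightarrow> 'i \<times> 'v set \<Rightarrow> complex" where
  "class_mean T \<gamma> n \<phi> q \<equiv> \<integral>\<omega>. (\<Prod>e\<in>class_arcs T \<gamma> q. entry T \<gamma> n \<phi> e \<omega>) \<partial>M n"

definition inj_maps :: "'v set \<Rightarrow> nat \<Rightarrow> ('v \<Rightarrow> nat) set" where
  "inj_maps V n = {\<phi> \<in> PiE V (\<lambda>_. {1..n}). inj_on \<phi> V}"

text \<open>Injectivity of \<open>\<phi>\<close> makes distinct classes use distinct upper
  triangular entries, and these are independent. In \<open>class_bound\<close> the constant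
  \<open>B\<close> is a hypothesis because the same one has to serve all \<open>n\<close> and
  \<open>\<phi>\<close>.\<close>

lemma class_factorization:
  fixes T :: "('v, 'e) pre_digraph"
  assumes T: "test_graph T \<gamma> L" and \<phi>: "\<phi> \<in> inj_maps (verts T) n"
  shows "integrable (M n) (\<lambda>\<omega>. \<Prod>e\<in>arcs T. entry T \<gamma> n \<phi> e \<omega>)"
    "(\<integral>\<omega>. (\<Prod>e\<in>arcs T. entry T \<gamma> n \<phi> e \<omega>) \<partial>M n) =
      (\<Prod>q\<in>arc_class T \<gamma> ` arcs T. class_mean T \<gamma> n \<phi> q)"
    and class_bound: "(\<And>l i j k. l \<le> card (arcs T) \<Longrightarrow> i \<in> \<gamma> ` arcs T \<Longrightarrow> (j, k) \<in> upper n \<Longrightarrow>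
      (\<integral>\<omega>. cmod (X n i j k \<omega>) ^ l \<partial>M n) \<le> B) \<Longrightarrow> q \<in> arc_class T \<gamma> ` arcs T \<Longrightarrow>
      cmod (class_mean T \<gamma> n \<phi> q) \<le> B * (\<Prod>e\<in>class_arcs T \<gamma> q. eamp T \<gamma> n \<phi> e)"
proof -
  interpret prob_space "M n" by (rule prob_space_M)
  interpret fin_digraph T using T by (simp add: test_graph_def)
  have lab: "\<gamma> e \<in> L" if "e \<in> arcs T" for e using T that by (auto simp: test_graph_def)
  have \<phi>V: "\<phi> v \<in> {1..n}" if "v \<in> verts T" for v using \<phi> that by (auto simp: inj_maps_def)
  have \<phi>inj: "inj_on \<phi> (verts T)" using \<phi> by (simp add: inj_maps_def)
  \<comment> \<open>The independent variables are the entries on and above the diagonal; minimum and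
    maximum give the position of the one that a class uses.\<close>
  define idx where "idx q = (fst q, Min (\<phi> ` snd q), Max (\<phi> ` snd q))" for q :: "'i \<times> 'v set"
  define key where "key e = (\<gamma> e, min (\<phi> (tail T e)) (\<phi> (head T e)), max (\<phi> (tail T e)) (\<phi> (head T e)))" for e
  have idx_key: "idx (arc_class T \<gamma> e) = key e" for e
    by (simp add: idx_def key_def arc_class_def)
  have key_eq: "key e = key e' \<longleftrightarrow> arc_class T \<gamma> e = arc_class T \<gamma> e'" if e: "e \<in> arcs T" "e' \<in> arcs T" for e e'
  proof
    assume k: "key e = key e'"
    then have "\<phi> ` {tail T e, head T e} = \<phi> ` {tail T e', head T e'}"
      by (auto simp: key_def min_def max_def split: if_splits)
    then have "{tail T e, head T e} = {tail T e', head T e'}"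
      by (subst (asm) inj_on_image_eq_iff[OF \<phi>inj]) (use e in auto)
    then show "arc_class T \<gamma> e = arc_class T \<gamma> e'" using k by (simp add: key_def arc_class_def)
  next
    assume "arc_class T \<gamma> e = arc_class T \<gamma> e'"
    then show "key e = key e'" by (metis idx_key)
  qed
  have idx_inj: "inj_on idx (arc_class T \<gamma> ` arcs T)"
  proof (rule inj_onI)
    fix q q' assume "q \<in> arc_class T \<gamma> ` arcs T" "q' \<in> arc_class T \<gamma> ` arcs T" "idx q = idx q'"
    then show "q = q'" using key_eq idx_key by (metis imageE)
  qed
  have idx_im: "idx ` arc_class T \<gamma> ` arcs T = key ` arcs T" by (simp add: image_image idx_key)
  have key_up: "key ` arcs T \<subseteq> L \<times> upper n"
    using lab \<phi>V by (fastforce simp: key_def)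
  define Y where "Y = (\<lambda>(i, j, k). X n i j k)"
  \<comment> \<open>All arcs of a class see the same variable \<open>z\<close>, conjugated for arcs
    whose entry lies below the diagonal.\<close>
  define G where "G t z = (\<Prod>e\<in>{e\<in>arcs T. key e = t}.
    of_real (eamp T \<gamma> n \<phi> e) * (if \<phi> (head T e) \<le> \<phi> (tail T e) then z else cnj z))" for t z
  have Gm: "G t \<in> borel_measurable borel" for t
  proof -
    have "(\<lambda>z. if c then z else cnj z) \<in> borel_measurable borel" for c
      by (cases c) (auto intro!: borel_measurable_continuous_onI continuous_intros)
    then show ?thesis
      unfolding G_def by (intro borel_measurable_prod borel_measurable_times borel_measurable_const)
  qed
  have entry_Y: "entry T \<gamma> n \<phi> e \<omega> = of_real (eamp T \<gamma> n \<phi> e) *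
      (if \<phi> (head T e) \<le> \<phi> (tail T e) then Y (key e) \<omega> else cnj (Y (key e) \<omega>))"
    if e: "e \<in> arcs T" and \<omega>: "\<omega> \<in> space (M n)" for e \<omega>
  proof -
    have "X n (\<gamma> e) (\<phi> (head T e)) (\<phi> (tail T e)) \<omega> = cnj (X n (\<gamma> e) (\<phi> (tail T e)) (\<phi> (head T e)) \<omega>)"
      by (rule X_cnj) (use e \<omega> lab \<phi>V in auto)
    then show ?thesis using lab[OF e] by (auto simp: entry_def eamp_def A_amp Y_def key_def)
  qed
  have class_key: "class_arcs T \<gamma> q = {e\<in>arcs T. key e = idx q}" if "q \<in> arc_class T \<gamma> ` arcs T" for q
    using that key_eq by (auto simp: class_arcs_def idx_key)
  have class_Y: "(\<Prod>e\<in>class_arcs T \<gamma> q. entry T \<gamma> n \<phi> e \<omega>) = G (idx q) (Y (idx q) \<omega>)"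
    if "q \<in> arc_class T \<gamma> ` arcs T" "\<omega> \<in> space (M n)" for q \<omega>
    unfolding G_def class_key[OF that(1)] by (rule prod.cong) (use entry_Y that(2) in auto)
  have prod_eq: "(\<Prod>e\<in>arcs T. entry T \<gamma> n \<phi> e \<omega>) = (\<Prod>t\<in>key ` arcs T. G t (Y t \<omega>))"
    if "\<omega> \<in> space (M n)" for \<omega>
  proof -
    have "(\<Prod>e\<in>arcs T. entry T \<gamma> n \<phi> e \<omega>) = (\<Prod>q\<in>arc_class T \<gamma> ` arcs T. \<Prod>e\<in>class_arcs T \<gamma> q. entry T \<gamma> n \<phi> e \<omega>)"
      unfolding class_arcs_def by (rule prod.image_gen) simp
    also have "\<dots> = (\<Prod>q\<in>arc_class T \<gamma> ` arcs T. G (idx q) (Y (idx q) \<omega>))"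
      by (rule prod.cong) (use class_Y that in auto)
    also have "\<dots> = (\<Prod>t\<in>key ` arcs T. G t (Y t \<omega>))"
      unfolding idx_im[symmetric] by (simp add: prod.reindex[OF idx_inj])
    finally show ?thesis .
  qed
  have "indep_vars (\<lambda>_. borel) Y (key ` arcs T)"
    using X_indep key_up unfolding Y_def by (rule indep_vars_subset)
  then have ind: "indep_vars (\<lambda>_. borel) (\<lambda>t \<omega>. G t (Y t \<omega>)) (key ` arcs T)"
    by (rule indep_vars_compose2) (rule Gm)
  have G_norm: "cmod (G t z) = (\<Prod>e\<in>{e\<in>arcs T. key e = t}. eamp T \<gamma> n \<phi> e) * cmod z ^ card {e\<in>arcs T. key e = t}" for t z
  proof -
    have "cmod (G t z) = (\<Prod>e\<in>{e\<in>arcs T. key e = t}. eamp T \<gamma> n \<phi> e * cmod z)"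
      unfolding G_def prod_norm[symmetric]
      by (rule prod.cong) (auto simp: norm_mult eamp_def amp_nonneg)
    then show ?thesis by (simp add: prod.distrib)
  qed
  have card_le: "card {e\<in>arcs T. key e = t} \<le> card (arcs T)" for t by (rule card_mono) auto
  obtain B0 where B0: "\<And>l i j k. l \<le> card (arcs T) \<Longrightarrow> i \<in> \<gamma> ` arcs T \<Longrightarrow> (j, k) \<in> upper n \<Longrightarrow>
    integrable (M n) (\<lambda>\<omega>. cmod (X n i j k \<omega>) ^ l) \<and> (\<integral>\<omega>. cmod (X n i j k \<omega>) ^ l \<partial>M n) \<le> B0"
  proof -
    have "\<gamma> ` arcs T \<subseteq> L" using lab by blast
    from X_moments[OF finite_imageI[OF finite_arcs] this, of "card (arcs T)"]
    obtain B where B: "\<forall>l\<le>card (arcs T). \<forall>n. \<forall>i\<in>\<gamma> ` arcs T. \<forall>(j, k)\<in>upper n.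
      integrable (M n) (\<lambda>\<omega>. cmod (X n i j k \<omega>) ^ l) \<and> (\<integral>\<omega>. cmod (X n i j k \<omega>) ^ l \<partial>M n) \<le> B"
      by (elim exE conjE)
    show ?thesis
    proof (rule that)
      fix l i j k assume a: "l \<le> card (arcs T)" "i \<in> \<gamma> ` arcs T" "(j, k) \<in> upper n"
      from bspec[OF bspec[OF spec[OF mp[OF spec[OF B] a(1)]] a(2)] a(3)]
      show "integrable (M n) (\<lambda>\<omega>. cmod (X n i j k \<omega>) ^ l) \<and> (\<integral>\<omega>. cmod (X n i j k \<omega>) ^ l \<partial>M n) \<le> B"
        by (simp only: prod.case)
    qed
  qed
  have Yint: "integrable (M n) (\<lambda>\<omega>. cmod (Y t \<omega>) ^ card {e\<in>arcs T. key e = t})" if "t \<in> key ` arcs T" for t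
    using that key_up B0[OF card_le] by (auto simp: Y_def key_def)
  have Ymeas: "Y t \<in> borel_measurable (M n)" if "t \<in> key ` arcs T" for t
    using that key_up X_measurable by (auto simp: Y_def)
  have Gint: "integrable (M n) (\<lambda>\<omega>. G t (Y t \<omega>))" if t: "t \<in> key ` arcs T" for t
  proof (rule Bochner_Integration.integrable_bound)
    show "integrable (M n) (\<lambda>\<omega>. (\<Prod>e\<in>{e\<in>arcs T. key e = t}. eamp T \<gamma> n \<phi> e) * cmod (Y t \<omega>) ^ card {e\<in>arcs T. key e = t})"
      by (rule integrable_mult_right) (rule Yint[OF t])
    show "(\<lambda>\<omega>. G t (Y t \<omega>)) \<in> borel_measurable (M n)"
      by (rule measurable_compose[OF Ymeas[OF t] Gm])
  qed (auto simp: G_norm)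
  have "integrable (M n) (\<lambda>\<omega>. \<Prod>t\<in>key ` arcs T. G t (Y t \<omega>))"
    by (rule indep_vars_integrable[OF _ ind Gint]) auto
  then show "integrable (M n) (\<lambda>\<omega>. \<Prod>e\<in>arcs T. entry T \<gamma> n \<phi> e \<omega>)"
    by (subst Bochner_Integration.integrable_cong[OF refl prod_eq])
  have "(\<integral>\<omega>. (\<Prod>e\<in>arcs T. entry T \<gamma> n \<phi> e \<omega>) \<partial>M n) = (\<integral>\<omega>. (\<Prod>t\<in>key ` arcs T. G t (Y t \<omega>)) \<partial>M n)"
    by (rule Bochner_Integration.integral_cong[OF refl prod_eq])
  also have "\<dots> = (\<Prod>t\<in>key ` arcs T. \<integral>\<omega>. G t (Y t \<omega>) \<partial>M n)"
    by (rule indep_vars_lebesgue_integral[OF _ ind Gint]) auto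
  also have "\<dots> = (\<Prod>q\<in>arc_class T \<gamma> ` arcs T. \<integral>\<omega>. G (idx q) (Y (idx q) \<omega>) \<partial>M n)"
    unfolding idx_im[symmetric] by (simp add: prod.reindex[OF idx_inj])
  also have "\<dots> = (\<Prod>q\<in>arc_class T \<gamma> ` arcs T. class_mean T \<gamma> n \<phi> q)"
    by (intro prod.cong refl Bochner_Integration.integral_cong) (simp add: class_Y)
  finally show "(\<integral>\<omega>. (\<Prod>e\<in>arcs T. entry T \<gamma> n \<phi> e \<omega>) \<partial>M n) =
      (\<Prod>q\<in>arc_class T \<gamma> ` arcs T. class_mean T \<gamma> n \<phi> q)" .
  {
    assume B: "\<And>l i j k. l \<le> card (arcs T) \<Longrightarrow> i \<in> \<gamma> ` arcs T \<Longrightarrow> (j, k) \<in> upper n \<Longrightarrow>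
      (\<integral>\<omega>. cmod (X n i j k \<omega>) ^ l \<partial>M n) \<le> B" and q: "q \<in> arc_class T \<gamma> ` arcs T"
    let ?t = "idx q" and ?m = "card {e\<in>arcs T. key e = idx q}"
    have t: "?t \<in> key ` arcs T" using q idx_im by blast
    have P0: "0 \<le> (\<Prod>e\<in>{e\<in>arcs T. key e = ?t}. eamp T \<gamma> n \<phi> e)"
      by (rule prod_nonneg) (simp add: eamp_def amp_nonneg)
    have "class_mean T \<gamma> n \<phi> q = (\<integral>\<omega>. G ?t (Y ?t \<omega>) \<partial>M n)"
      by (rule Bochner_Integration.integral_cong) (simp_all add: class_Y q)
    also have "cmod \<dots> \<le> (\<integral>\<omega>. cmod (G ?t (Y ?t \<omega>)) \<partial>M n)" by (rule integral_norm_bound)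
    also have "\<dots> = (\<Prod>e\<in>{e\<in>arcs T. key e = ?t}. eamp T \<gamma> n \<phi> e) * (\<integral>\<omega>. cmod (Y ?t \<omega>) ^ ?m \<partial>M n)"
      unfolding G_norm by simp
    also have "\<dots> \<le> (\<Prod>e\<in>{e\<in>arcs T. key e = ?t}. eamp T \<gamma> n \<phi> e) * B"
    proof (rule mult_left_mono[OF _ P0])
      obtain i j k where ijk: "?t = (i, j, k)" by (cases ?t)
      then have "i \<in> \<gamma> ` arcs T" "(j, k) \<in> upper n" using t key_up by (auto simp: key_def)
      from B[OF card_le this] show "(\<integral>\<omega>. cmod (Y ?t \<omega>) ^ ?m \<partial>M n) \<le> B" by (simp add: Y_def ijk)
    qed
    finally show "cmod (class_mean T \<gamma> n \<phi> q)
      \<le> B * (\<Prod>e\<in>class_arcs T \<gamma> q. eamp T \<gamma> n \<phi> e)"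
      using class_key[OF q] by (simp add: mult.commute)
  }
qed

lemma inj_traffic_state_eq:
  assumes T: "test_graph T \<gamma> L"
  shows "inj_traffic_state M A T \<gamma> n = (1 / of_nat n) * (\<Sum>\<phi>\<in>inj_maps (verts T) n.
    \<Prod>q\<in>arc_class T \<gamma> ` arcs T. class_mean T \<gamma> n \<phi> q)"
proof -
  have "inj_traffic_state M A T \<gamma> n =
      (\<integral>\<omega>. (1 / of_nat n) * (\<Sum>\<phi>\<in>inj_maps (verts T) n. \<Prod>e\<in>arcs T. entry T \<gamma> n \<phi> e \<omega>) \<partial>M n)"
    by (simp add: inj_traffic_state_def inj_maps_def entry_def)
  also have "\<dots> = (1 / of_nat n) * (\<integral>\<omega>. (\<Sum>\<phi>\<in>inj_maps (verts T) n. \<Prod>e\<in>arcs T. entry T \<gamma> n \<phi> e \<omega>) \<partial>M n)"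
    by (rule integral_mult_right_zero)
  also have "(\<integral>\<omega>. (\<Sum>\<phi>\<in>inj_maps (verts T) n. \<Prod>e\<in>arcs T. entry T \<gamma> n \<phi> e \<omega>) \<partial>M n) =
      (\<Sum>\<phi>\<in>inj_maps (verts T) n. \<integral>\<omega>. (\<Prod>e\<in>arcs T. entry T \<gamma> n \<phi> e \<omega>) \<partial>M n)"
    by (rule Bochner_Integration.integral_sum) (rule class_factorization(1)[OF T])
  also have "\<dots> = (\<Sum>\<phi>\<in>inj_maps (verts T) n.
    \<Prod>q\<in>arc_class T \<gamma> ` arcs T. class_mean T \<gamma> n \<phi> q)"
    by (rule sum.cong[OF refl]) (rule class_factorization(2)[OF T])
  finally show ?thesis .
qed

lemma X_mean:
  assumes "i \<in> L" "j \<in> {1..n}" "k \<in> {1..n}" "j \<noteq> k"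
  shows "(\<integral>\<omega>. X n i j k \<omega> \<partial>M n) = 0"
proof (cases "j < k")
  case True
  then show ?thesis using wigner assms unfolding wigner_family_def by auto
next
  case False
  then have "(\<integral>\<omega>. X n i k j \<omega> \<partial>M n) = 0"
    using wigner assms unfolding wigner_family_def by auto
  moreover have "(\<integral>\<omega>. X n i j k \<omega> \<partial>M n) = (\<integral>\<omega>. cnj (X n i k j \<omega>) \<partial>M n)"
    by (rule Bochner_Integration.integral_cong[OF refl]) (rule X_cnj[OF assms(1-3)])
  ultimately show ?thesis by simp
qed

lemma X_product:
  assumes "i \<in> L" "j \<in> {1..n}" "k \<in> {1..n}" "j \<noteq> k"
  shows "(\<integral>\<omega>. X n i j k \<omega> * X n i k j \<omega> \<partial>M n) = 1"
proof -
  have sq: "X n i j k \<omega> * X n i k j \<omega> = of_real ((cmod (X n i j k \<omega>))\<^sup>2)"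
    "X n i j k \<omega> * X n i k j \<omega> = of_real ((cmod (X n i k j \<omega>))\<^sup>2)" if "\<omega> \<in> space (M n)" for \<omega>
    using X_cnj[OF assms(1,3,2) that] by (simp_all add: complex_norm_square mult.commute del: of_real_power)
  have 1: "(\<integral>\<omega>. (cmod (X n i j k \<omega>))\<^sup>2 \<partial>M n) = 1" if "j < k"
    using wigner assms that unfolding wigner_family_def by auto
  have 2: "(\<integral>\<omega>. (cmod (X n i k j \<omega>))\<^sup>2 \<partial>M n) = 1" if "k < j"
    using wigner assms that unfolding wigner_family_def by auto
  have "(\<integral>\<omega>. X n i j k \<omega> * X n i k j \<omega> \<partial>M n) = (\<integral>\<omega>. complex_of_real ((cmod (X n i j k \<omega>))\<^sup>2) \<partial>M n)"
    "(\<integral>\<omega>. X n i j k \<omega> * X n i k j \<omega> \<partial>M n) = (\<integral>\<omega>. complex_of_real ((cmod (X n i k j \<omega>))\<^sup>2) \<partial>M n)"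
    by (rule Bochner_Integration.integral_cong[OF refl]; erule sq)+
  then show ?thesis using 1 2 assms(4) by (cases "j < k") (simp_all del: of_real_power)
qed

text \<open>Below the diagonal the entry is a conjugate; as \<open>\<beta> i\<close> is real, the
  expectation of the square is the same there.\<close>

lemma X_square:
  assumes "i \<in> L" "j \<in> {1..n}" "k \<in> {1..n}" "j \<noteq> k"
  shows "(\<integral>\<omega>. X n i j k \<omega> * X n i j k \<omega> \<partial>M n) = \<beta> i"
proof -
  have up: "(\<integral>\<omega>. X n i j k \<omega> * X n i j k \<omega> \<partial>M n) = \<beta> i" if "j < k" "j \<in> {1..n}" "k \<in> {1..n}" for j k
    using wigner assms(1) that unfolding wigner_family_def by (auto simp: power2_eq_square)
  show ?thesis
  proof (cases "j < k")
    case False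
    then have "(\<integral>\<omega>. X n i k j \<omega> * X n i k j \<omega> \<partial>M n) = \<beta> i" using up assms by simp
    moreover have "(\<integral>\<omega>. X n i j k \<omega> * X n i j k \<omega> \<partial>M n) = (\<integral>\<omega>. cnj (X n i k j \<omega> * X n i k j \<omega>) \<partial>M n)"
      by (rule Bochner_Integration.integral_cong[OF refl]) (simp add: X_cnj[OF assms(1-3)])
    ultimately show ?thesis by (simp del: complex_cnj_mult)
  qed (use up assms in auto)
qed

text \<open>Meant for a class of two arcs: in the same direction they produce the expectation of the
  square of an entry, which is \<open>\<beta>\<close>, in opposite directions that of its squared
  modulus, which is 1.\<close>

definition class_weight :: "('v, 'e) pre_digraph \<Rightarrow> ('e \<Rightarrow> 'i) \<Rightarrow> 'i \<times> 'v set \<Rightarrow> real" where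
  "class_weight T \<gamma> q = (if \<exists>e\<in>class_arcs T \<gamma> q. \<exists>e'\<in>class_arcs T \<gamma> q. e \<noteq> e' \<and> tail T e = tail T e'
     then \<beta> (fst q) else 1)"

text \<open>A class knows its end points only as a set; reading them off as minimum and maximum is
  harmless because the kernel is symmetric.\<close>

definition class_kernel :: "nat \<Rightarrow> ('v \<Rightarrow> nat) \<Rightarrow> 'i \<times> 'v set \<Rightarrow> real" where
  "class_kernel n \<phi> q = kern (fst q) n (Min (\<phi> ` snd q)) (Max (\<phi> ` snd q))"

lemma class_kernel_pair: "class_kernel n \<phi> (i, {u, v}) = kern i n (\<phi> u) (\<phi> v)"
  by (simp add: class_kernel_def min_def max_def band_kernel_sym)

lemma class_integral_lone:
  assumes T: "test_graph T \<gamma> L" and \<phi>: "\<phi> \<in> inj_maps (verts T) n"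
    and e: "e \<in> arcs T" "tail T e \<noteq> head T e" and lone: "class_arcs T \<gamma> q = {e}"
  shows "class_mean T \<gamma> n \<phi> q = 0"
proof -
  interpret fin_digraph T using T by (simp add: test_graph_def)
  have i: "\<gamma> e \<in> L" using T e by (auto simp: test_graph_def)
  have "\<phi> (head T e) \<in> {1..n}" "\<phi> (tail T e) \<in> {1..n}" "\<phi> (head T e) \<noteq> \<phi> (tail T e)"
    using \<phi> e by (auto simp: inj_maps_def inj_on_eq_iff)
  from X_mean[OF i this] show ?thesis
    unfolding lone by (simp add: entry_def A_amp[OF i])
qed

lemma class_integral_twins:
  assumes T: "test_graph T \<gamma> L" and \<phi>: "\<phi> \<in> inj_maps (verts T) n"
    and e: "e \<in> arcs T" "e' \<in> arcs T" "e \<noteq> e'" "tail T e \<noteq> head T e"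
    and twins: "class_arcs T \<gamma> q = {e, e'}"
  shows "class_mean T \<gamma> n \<phi> q = of_real (class_weight T \<gamma> q * class_kernel n \<phi> q)"
proof -
  interpret fin_digraph T using T by (simp add: test_graph_def)
  have i: "\<gamma> e \<in> L" using T e by (auto simp: test_graph_def)
  have v: "\<phi> (head T e) \<in> {1..n}" "\<phi> (tail T e) \<in> {1..n}" "\<phi> (head T e) \<noteq> \<phi> (tail T e)"
    using \<phi> e by (auto simp: inj_maps_def inj_on_eq_iff)
  have "arc_class T \<gamma> e = q" "arc_class T \<gamma> e' = q" using twins by (auto simp: class_arcs_def)
  then have q: "q = (\<gamma> e, {tail T e, head T e})" and same: "\<gamma> e' = \<gamma> e"
    "{tail T e', head T e'} = {tail T e, head T e}" by (auto simp: arc_class_def)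
  let ?i = "\<gamma> e" and ?j = "\<phi> (head T e)" and ?k = "\<phi> (tail T e)"
  have kq: "class_kernel n \<phi> q = kern ?i n ?j ?k" unfolding q
    using class_kernel_pair[of n \<phi> ?i "tail T e" "head T e"] by (simp add: band_kernel_sym)
  have "class_mean T \<gamma> n \<phi> q =
      (\<integral>\<omega>. entry T \<gamma> n \<phi> e \<omega> * entry T \<gamma> n \<phi> e' \<omega> \<partial>M n)"
    unfolding twins using e(3) by simp
  also have "\<dots> = of_real (class_weight T \<gamma> q * class_kernel n \<phi> q)"
  proof (cases "tail T e' = tail T e")
    case True
    then have h: "head T e' = head T e" using same(2) by (auto simp: doubleton_eq_iff)
    have "(\<integral>\<omega>. entry T \<gamma> n \<phi> e \<omega> * entry T \<gamma> n \<phi> e' \<omega> \<partial>M n) =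
        (\<integral>\<omega>. of_real (amp n ?i ?j ?k * amp n ?i ?j ?k) * (X n ?i ?j ?k \<omega> * X n ?i ?j ?k \<omega>) \<partial>M n)"
      by (simp add: entry_def same True h A_amp[OF i] mult_ac)
    also have "\<dots> = of_real (amp n ?i ?j ?k * amp n ?i ?j ?k) * complex_of_real (\<beta> ?i)"
      by (simp only: integral_mult_right_zero X_square[OF i v])
    also have "\<dots> = of_real (class_weight T \<gamma> q * class_kernel n \<phi> q)"
    proof -
      have "class_weight T \<gamma> q = \<beta> ?i"
        unfolding class_weight_def twins using True e(3) by (auto simp: q)
      then show ?thesis unfolding kq amp_square by simp
    qed
    finally show ?thesis .
  next
    case False
    then have h: "head T e' = tail T e" "tail T e' = head T e" using same(2) by (auto simp: doubleton_eq_iff)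
    have "(\<integral>\<omega>. entry T \<gamma> n \<phi> e \<omega> * entry T \<gamma> n \<phi> e' \<omega> \<partial>M n) =
        (\<integral>\<omega>. of_real (amp n ?i ?j ?k * amp n ?i ?k ?j) * (X n ?i ?j ?k \<omega> * X n ?i ?k ?j \<omega>) \<partial>M n)"
      by (simp add: entry_def same h A_amp[OF i] mult_ac)
    also have "\<dots> = of_real (amp n ?i ?j ?k * amp n ?i ?j ?k)"
      by (simp only: integral_mult_right_zero X_product[OF i v] amp_sym[of n ?i ?k ?j] mult_1_right)
    also have "\<dots> = of_real (class_weight T \<gamma> q * class_kernel n \<phi> q)"
    proof -
      have "class_weight T \<gamma> q = 1"
        unfolding class_weight_def twins using False e(3) by auto
      then show ?thesis unfolding kq amp_square by simp
    qed
    finally show ?thesis .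
  qed
  finally show ?thesis .
qed

end


context band_matrices
begin

section \<open>Double trees survive in the limit, all other test graphs vanish\<close>

subsection \<open>The limit of the injective traffic states\<close>

definition tree_mass :: "('v, 'e) pre_digraph \<Rightarrow> ('e \<Rightarrow> 'i) \<Rightarrow> nat \<Rightarrow> real" where
  "tree_mass T \<gamma> n = (\<Sum>\<phi>\<in>PiE (verts T) (\<lambda>_. {1..n}). \<Prod>q\<in>arc_class T \<gamma> ` arcs T. class_kernel n \<phi> q) / real n"

definition tree_weight :: "('v, 'e) pre_digraph \<Rightarrow> ('e \<Rightarrow> 'i) \<Rightarrow> real" where
  "tree_weight T \<gamma> = (\<Prod>q\<in>arc_class T \<gamma> ` arcs T. class_weight T \<gamma> q)"

text \<open>Indexing the classes by the vertices other than the root turns a product over classes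
  into \<open>tree_prod\<close>.\<close>

definition tree_shape :: "('v, 'e) pre_digraph \<Rightarrow> ('e \<Rightarrow> 'i) \<Rightarrow> 'v \<Rightarrow> ('v \<Rightarrow> 'v) \<Rightarrow> ('v \<Rightarrow> 'i) \<Rightarrow> bool" where
  "tree_shape T \<gamma> r p i \<longleftrightarrow> rooted_tree r p (verts T) \<and>
    bij_betw (\<lambda>v. (i v, {v, p v})) (verts T - {r}) (arc_class T \<gamma> ` arcs T) \<and>
    i ` (verts T - {r}) \<subseteq> \<gamma> ` arcs T"

text \<open>In a double tree the spanning arcs and their twins are all arcs, by their number, so
  every class is a pair of twins.\<close>

lemma double_tree_shape:
  fixes T :: "('v, 'e) pre_digraph" and \<gamma> :: "'e \<Rightarrow> 'i"
  assumes T: "test_graph T \<gamma> L'" and dt: "double_tree T \<gamma>"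
  shows "\<exists>r p i. tree_shape T \<gamma> r p i"
    and "q \<in> arc_class T \<gamma> ` arcs T \<Longrightarrow> \<exists>e\<in>arcs T. \<exists>e'\<in>arcs T. e \<noteq> e' \<and> tail T e \<noteq> head T e \<and> class_arcs T \<gamma> q = {e, e'}"
proof -
  interpret fin_digraph T using T by (simp add: test_graph_def)
  have "Digraph_Component.connected T" "no_lone_arcs T \<gamma>"
    using T dt by (auto simp: test_graph_def double_tree_def)
  from spanning_twins[OF fin_digraph this] obtain r p f g where
    tree: "rooted_tree r p (verts T)" and
    fg': "\<forall>v\<in>verts T - {r}. f v \<in> arcs T \<and> g v \<in> arcs T \<and> f v \<noteq> g v \<and>
      arc_class T \<gamma> (f v) = (\<gamma> (f v), {v, p v}) \<and> arc_class T \<gamma> (g v) = (\<gamma> (f v), {v, p v})" and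
    inj: "inj_on f (verts T - {r})" "inj_on g (verts T - {r})"
      "f ` (verts T - {r}) \<inter> g ` (verts T - {r}) = {}" and
    card: "card (f ` (verts T - {r}) \<union> g ` (verts T - {r})) = 2 * (card (verts T) - 1)"
    by (elim exE conjE)
  note fg = bspec[OF fg']
  let ?V = "verts T - {r}"
  have sub: "f ` ?V \<union> g ` ?V \<subseteq> arcs T" using fg by auto
  have arcs: "arcs T = f ` ?V \<union> g ` ?V"
    using card_subset_eq[OF finite_arcs sub] card dt by (simp add: double_tree_def)
  have edge_inj: "inj_on (\<lambda>v. {v, p v}) ?V" by (rule rooted_tree_edge_inj[OF tree])
  have classes: "arc_class T \<gamma> ` arcs T = (\<lambda>v. (\<gamma> (f v), {v, p v})) ` ?V"
    unfolding arcs image_Un image_image using fg by auto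
  have "inj_on (\<lambda>v. (\<gamma> (f v), {v, p v})) ?V"
    using edge_inj unfolding inj_on_def by blast
  then have "bij_betw (\<lambda>v. (\<gamma> (f v), {v, p v})) ?V (arc_class T \<gamma> ` arcs T)"
    unfolding bij_betw_def classes by blast
  moreover have "(\<lambda>v. \<gamma> (f v)) ` ?V \<subseteq> \<gamma> ` arcs T" using fg by auto
  ultimately have "tree_shape T \<gamma> r p (\<lambda>v. \<gamma> (f v))"
    using tree by (simp add: tree_shape_def)
  then show "\<exists>r p i. tree_shape T \<gamma> r p i" by blast
  assume "q \<in> arc_class T \<gamma> ` arcs T"
  then obtain v where v: "v \<in> ?V" and q: "q = (\<gamma> (f v), {v, p v})" unfolding classes by blast
  have "e = f v \<or> e = g v" if e: "e \<in> arcs T" "arc_class T \<gamma> e = q" for e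
  proof -
    obtain w where w: "w \<in> ?V" "e = f w \<or> e = g w" using e(1) arcs by blast
    then have "arc_class T \<gamma> e = (\<gamma> (f w), {w, p w})" using fg by metis
    then have "{w, p w} = {v, p v}" using e(2) q by simp
    then have "w = v" using inj_onD[OF edge_inj _ w(1) v] by blast
    then show ?thesis using w by blast
  qed
  then have cl: "class_arcs T \<gamma> q = {f v, g v}"
    using fg[OF v] by (auto simp: class_arcs_def q)
  have "p v \<noteq> v" using rooted_tree_parent[OF tree v] by blast
  then have "tail T (f v) \<noteq> head T (f v)" using fg[OF v] by (auto simp: arc_class_def doubleton_eq_iff)
  then show "\<exists>e\<in>arcs T. \<exists>e'\<in>arcs T. e \<noteq> e' \<and> tail T e \<noteq> head T e \<and> class_arcs T \<gamma> q = {e, e'}"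
    using fg[OF v] cl by blast
qed

lemma class_prod_tree:
  assumes "tree_shape T \<gamma> r p i"
  shows "(\<Prod>q\<in>arc_class T \<gamma> ` arcs T. class_kernel n \<phi> q) = tree_prod r p (verts T) (\<lambda>v. kern (i v) n) \<phi>"
proof -
  have "bij_betw (\<lambda>v. (i v, {v, p v})) (verts T - {r}) (arc_class T \<gamma> ` arcs T)"
    using assms by (simp add: tree_shape_def)
  from prod.reindex_bij_betw[OF this, of "class_kernel n \<phi>"] show ?thesis
    by (simp add: tree_prod_def class_kernel_pair)
qed

lemma tree_mass_eq:
  assumes "tree_shape T \<gamma> r p i"
  shows "tree_mass T \<gamma> n = weighted_tree_sum r p (verts T) (\<lambda>v. kern (i v)) (\<lambda>_ _. 1) n"
  by (simp add: tree_mass_def weighted_tree_sum_def class_prod_tree[OF assms])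

lemma convergent_weighted_tree_sum:
  assumes "rooted_tree r p V" "\<And>v. v \<in> V - {r} \<Longrightarrow> i v \<in> L" "\<And>v. v \<in> V \<Longrightarrow> continuous_on {0..1} (f v)"
  shows "convergent (weighted_tree_sum r p V (\<lambda>v. kern (i v)) f)"
  using assms
proof (induction arbitrary: f rule: rooted_tree.induct)
  case root
  then show ?case using weighted_tree_sum_root[of f r] unfolding convergent_def by blast
next
  case (leaf V w)
  have wr: "w \<noteq> r" using rooted_tree_root[OF leaf.hyps(1)] leaf.hyps(2) by blast
  let ?f = "f(p w := (\<lambda>x. f (p w) x * Op (i w) (f w) x))"
  have lim: "kernel_limit (kern (i w)) (Op (i w))" using limit leaf.prems(1)[of w] wr by simp
  then have cont: "continuous_on {0..1} (Op (i w) (f w))"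
    using leaf.prems(2)[of w] by (simp add: kernel_limit_def)
  have "convergent (weighted_tree_sum r p V (\<lambda>v. kern (i v)) ?f)"
  proof (rule leaf.IH)
    fix v assume v: "v \<in> V"
    show "continuous_on {0..1} (?f v)"
      using leaf.prems(2)[of v] leaf.prems(2)[of "p w"] v leaf.hyps(3) cont
      by (auto intro!: continuous_intros)
  qed (use leaf.prems(1) in auto)
  then obtain l where l: "weighted_tree_sum r p V (\<lambda>v. kern (i v)) ?f \<longlonglongrightarrow> l"
    by (auto simp: convergent_def)
  have "(\<lambda>n. weighted_tree_sum r p (insert w V) (\<lambda>v. kern (i v)) f n
    - weighted_tree_sum r p V (\<lambda>v. kern (i v)) ?f n) \<longlonglongrightarrow> 0"
  proof (rule weighted_tree_sum_leaf[where k = "\<lambda>v. kern (i v)", OF leaf.hyps _ lim])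
    show "bounded_kernel (kern (i v)) (C (i v))" if "v \<in> V - {r}" for v
      using bounded leaf.prems(1)[of v] that by blast
  qed (rule leaf.prems(2))
  from tendsto_add[OF this l] show ?case by (auto simp: convergent_def)
qed

lemma tree_shape_labels:
  assumes "test_graph T \<gamma> L" "tree_shape T \<gamma> r p i" "v \<in> verts T - {r}"
  shows "i v \<in> L"
  using assms by (auto simp: test_graph_def tree_shape_def)

lemma convergent_tree_mass:
  assumes T: "test_graph T \<gamma> L" and dt: "double_tree T \<gamma>"
  shows "convergent (tree_mass T \<gamma>)"
proof -
  obtain r p i where sh: "tree_shape T \<gamma> r p i" using double_tree_shape(1)[OF T dt] by blast
  then have "rooted_tree r p (verts T)" by (simp add: tree_shape_def)
  then have "convergent (weighted_tree_sum r p (verts T) (\<lambda>v. kern (i v)) (\<lambda>_ _. 1))"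
    by (rule convergent_weighted_tree_sum) (use tree_shape_labels[OF T sh] in auto)
  moreover have "tree_mass T \<gamma> = weighted_tree_sum r p (verts T) (\<lambda>v. kern (i v)) (\<lambda>_ _. 1)"
    using tree_mass_eq[OF sh] by blast
  ultimately show ?thesis by simp
qed

lemma kern_bounds:
  assumes "i \<in> L"
  shows "0 \<le> kern i n x y" "kern i n x y \<le> (s i n)\<^sup>2"
    "x \<in> {1..n} \<Longrightarrow> (\<Sum>y=1..n. kern i n x y) \<le> C i" "y \<in> {1..n} \<Longrightarrow> (\<Sum>x=1..n. kern i n x y) \<le> C i"
  using bounded[OF assms] by (auto simp: bounded_kernel_def band_kernel_def)

text \<open>The class expectations are exact on injective maps, so the only error is the sum over
  maps with a collision. Each pair of vertices contributes at most a constant times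
  \<open>\<epsilon> n\<close> after division by \<open>n\<close>, and the number of pairs is
  fixed.\<close>

lemma double_tree_traffic:
  assumes T: "test_graph T \<gamma> L" and dt: "double_tree T \<gamma>"
  shows "(\<lambda>n. inj_traffic_state M A T \<gamma> n - of_real (tree_weight T \<gamma> * tree_mass T \<gamma> n)) \<longlonglongrightarrow> 0"
proof -
  interpret fin_digraph T using T by (simp add: test_graph_def)
  obtain r p i where sh: "tree_shape T \<gamma> r p i" using double_tree_shape(1)[OF T dt] by blast
  then have tree: "rooted_tree r p (verts T)" by (simp add: tree_shape_def)
  note iL = tree_shape_labels[OF T sh]
  let ?V = "verts T" and ?W = "tree_weight T \<gamma>"
  let ?t = "\<lambda>n. tree_prod r p ?V (\<lambda>v. kern (i v) n)"
  let ?P = "\<lambda>n::nat. PiE ?V (\<lambda>_. {1..n})"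
  have fin: "finite (?P n)" for n by (rule finite_PiE) auto
  have t0: "0 \<le> ?t n \<phi>" if "\<phi> \<in> ?P n" for n \<phi>
    by (rule tree_prod_nonneg[OF tree _ that]) (use kern_bounds(1) iL in blast)
  have state: "inj_traffic_state M A T \<gamma> n = of_real (?W * ((\<Sum>\<phi>\<in>inj_maps ?V n. ?t n \<phi>) / n))" for n
  proof -
    have "(\<Prod>q\<in>arc_class T \<gamma> ` arcs T. class_mean T \<gamma> n \<phi> q)
        = of_real (?W * ?t n \<phi>)" if \<phi>: "\<phi> \<in> inj_maps ?V n" for \<phi>
    proof -
      have "(\<Prod>q\<in>arc_class T \<gamma> ` arcs T. class_mean T \<gamma> n \<phi> q)
        = (\<Prod>q\<in>arc_class T \<gamma> ` arcs T. of_real (class_weight T \<gamma> q * class_kernel n \<phi> q))"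
      proof (rule prod.cong[OF refl])
        fix q assume "q \<in> arc_class T \<gamma> ` arcs T"
        from double_tree_shape(2)[OF T dt this] obtain e e' where
          "e \<in> arcs T" "e' \<in> arcs T" "e \<noteq> e'" "tail T e \<noteq> head T e" "class_arcs T \<gamma> q = {e, e'}" by blast
        from class_integral_twins[OF T \<phi> this]
        show "class_mean T \<gamma> n \<phi> q
          = of_real (class_weight T \<gamma> q * class_kernel n \<phi> q)" .
      qed
      also have "\<dots> = of_real (?W * ?t n \<phi>)"
        by (simp only: of_real_prod[symmetric] prod.distrib tree_weight_def class_prod_tree[OF sh])
      finally show ?thesis .
    qed
    then show ?thesis
      unfolding inj_traffic_state_eq[OF T] by (simp add: sum_distrib_left sum_divide_distrib)
  qed
  \<comment> \<open>One sequence that dominates every kernel on the tree; a sum is used instead of a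
    maximum because it makes sense and tends to 0 also without edges.\<close>
  define \<epsilon> where "\<epsilon> n = (\<Sum>v\<in>?V - {r}. (s (i v) n)\<^sup>2)" for n
  have e0: "0 \<le> \<epsilon> n" for n by (simp add: \<epsilon>_def sum_nonneg)
  have k\<epsilon>: "0 \<le> kern (i v) n x y \<and> kern (i v) n x y \<le> \<epsilon> n" if v: "v \<in> ?V - {r}" for v n x y
  proof -
    have "(s (i v) n)\<^sup>2 \<le> \<epsilon> n" unfolding \<epsilon>_def
      by (rule member_le_sum[of v "?V - {r}" "\<lambda>v. (s (i v) n)\<^sup>2"]) (use v in auto)
    then show ?thesis using kern_bounds(1,2)[OF iL[OF v], of n x y] by linarith
  qed
  have "\<epsilon> \<longlonglongrightarrow> (\<Sum>v\<in>?V - {r}. 0\<^sup>2)"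
    unfolding \<epsilon>_def by (intro tendsto_sum tendsto_power s_tendsto iL)
  then have \<epsilon>lim: "\<epsilon> \<longlonglongrightarrow> 0" by simp
  define PC where "PC = (\<Prod>v\<in>?V - {r}. C (i v))"
  define N where "N = card (?V \<times> ?V)"
  have noninj: "(\<Sum>\<phi>\<in>?P n - inj_maps ?V n. ?t n \<phi>) \<le> N * (\<epsilon> n * PC * n)" for n
  proof -
    let ?D = "{(u, u') \<in> ?V \<times> ?V. u \<noteq> u'}"
    have finD: "finite ?D" by (rule finite_subset[of _ "?V \<times> ?V"]) auto
    have "(\<Sum>\<phi>\<in>?P n - inj_maps ?V n. ?t n \<phi>) \<le>
      (\<Sum>\<phi>\<in>?P n - inj_maps ?V n. \<Sum>(u, u')\<in>?D. if \<phi> u = \<phi> u' then ?t n \<phi> else 0)"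
    proof (rule sum_mono)
      fix \<phi> assume \<phi>: "\<phi> \<in> ?P n - inj_maps ?V n"
      then obtain u u' where u: "u \<in> ?V" "u' \<in> ?V" "u \<noteq> u'" "\<phi> u = \<phi> u'"
        by (auto simp: inj_maps_def inj_on_def)
      have "?t n \<phi> = (case (u, u') of (u, u') \<Rightarrow> if \<phi> u = \<phi> u' then ?t n \<phi> else 0)" using u by simp
      also have "\<dots> \<le> (\<Sum>(u, u')\<in>?D. if \<phi> u = \<phi> u' then ?t n \<phi> else 0)"
        by (rule member_le_sum) (use u finD t0[of \<phi> n] \<phi> in \<open>auto split: if_splits\<close>)
      finally show "?t n \<phi> \<le> (\<Sum>(u, u')\<in>?D. if \<phi> u = \<phi> u' then ?t n \<phi> else 0)" .
    qed
    also have "\<dots> \<le> (\<Sum>\<phi>\<in>?P n. \<Sum>(u, u')\<in>?D. if \<phi> u = \<phi> u' then ?t n \<phi> else 0)"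
      by (rule sum_mono2) (use fin t0 in \<open>auto intro!: sum_nonneg\<close>)
    also have "\<dots> = (\<Sum>(u, u')\<in>?D. \<Sum>\<phi>\<in>?P n. if \<phi> u = \<phi> u' then ?t n \<phi> else 0)"
      by (subst sum.swap) (simp add: case_prod_unfold)
    also have "\<dots> \<le> (\<Sum>(u, u')\<in>?D. \<epsilon> n * PC * card {1..n})"
    proof (rule sum_mono, clarify)
      fix u u' assume u: "u \<in> ?V" "u' \<in> ?V" "u \<noteq> u'"
      show "(\<Sum>\<phi>\<in>?P n. if \<phi> u = \<phi> u' then ?t n \<phi> else 0) \<le> \<epsilon> n * PC * card {1..n}"
        unfolding PC_def
        by (rule tree_sum_collision[OF tree _ k\<epsilon> _ _ _ e0 u])
          (use kern_bounds(3,4) iL C_ge_1 in auto)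
    qed
    also have "\<dots> = card ?D * (\<epsilon> n * PC * n)" by (simp add: case_prod_unfold)
    also have "\<dots> \<le> N * (\<epsilon> n * PC * n)"
    proof (rule mult_right_mono)
      show "real (card ?D) \<le> N" unfolding N_def
        by (intro of_nat_mono card_mono) auto
      have "0 \<le> PC" unfolding PC_def by (rule prod_nonneg) (use C_ge_1 iL in force)
      then show "0 \<le> \<epsilon> n * PC * n" using e0 by simp
    qed
    finally show ?thesis .
  qed
  have diff: "norm (inj_traffic_state M A T \<gamma> n - of_real (?W * tree_mass T \<gamma> n)) \<le> \<bar>?W\<bar> * (N * PC) * \<epsilon> n" for n
  proof (cases "n = 0")
    case True
    have "0 \<le> PC" unfolding PC_def by (rule prod_nonneg) (use C_ge_1 iL in force)
    then show ?thesis using True e0 by (simp add: state tree_mass_def)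
  next
    case False
    have "(\<Sum>\<phi>\<in>?P n. ?t n \<phi>) = (\<Sum>\<phi>\<in>?P n - inj_maps ?V n. ?t n \<phi>) + (\<Sum>\<phi>\<in>inj_maps ?V n. ?t n \<phi>)"
      by (rule sum.subset_diff) (use fin in \<open>auto simp: inj_maps_def\<close>)
    then have "tree_mass T \<gamma> n = (\<Sum>\<phi>\<in>?P n - inj_maps ?V n. ?t n \<phi>) / n + (\<Sum>\<phi>\<in>inj_maps ?V n. ?t n \<phi>) / n"
      by (simp add: tree_mass_def class_prod_tree[OF sh] add_divide_distrib)
    then have "inj_traffic_state M A T \<gamma> n - of_real (?W * tree_mass T \<gamma> n)
        = of_real (- (?W * ((\<Sum>\<phi>\<in>?P n - inj_maps ?V n. ?t n \<phi>) / n)))"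
      unfolding state by (simp add: algebra_simps)
    then have "norm (inj_traffic_state M A T \<gamma> n - of_real (?W * tree_mass T \<gamma> n))
        = \<bar>?W\<bar> * (\<bar>\<Sum>\<phi>\<in>?P n - inj_maps ?V n. ?t n \<phi>\<bar> / n)"
      by (simp only: norm_of_real abs_minus abs_mult abs_divide abs_of_nat)
    also have "\<bar>\<Sum>\<phi>\<in>?P n - inj_maps ?V n. ?t n \<phi>\<bar> = (\<Sum>\<phi>\<in>?P n - inj_maps ?V n. ?t n \<phi>)"
      by (rule abs_of_nonneg) (use t0 in \<open>auto intro!: sum_nonneg\<close>)
    also have "\<bar>?W\<bar> * ((\<Sum>\<phi>\<in>?P n - inj_maps ?V n. ?t n \<phi>) / n) \<le> \<bar>?W\<bar> * (N * (\<epsilon> n * PC * n) / n)"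
      by (intro mult_left_mono divide_right_mono noninj) auto
    also have "\<dots> = \<bar>?W\<bar> * (N * PC) * \<epsilon> n" using False by simp
    finally show ?thesis .
  qed
  have "(\<lambda>n. \<bar>?W\<bar> * (N * PC) * \<epsilon> n) \<longlonglongrightarrow> \<bar>?W\<bar> * (N * PC) * 0"
    by (intro tendsto_intros \<epsilon>lim)
  then have "(\<lambda>n. \<bar>?W\<bar> * (N * PC) * \<epsilon> n) \<longlonglongrightarrow> 0" by simp
  then show ?thesis by (rule Lim_null_comparison[rotated]) (rule always_eventually, use diff in blast)
qed

text \<open>A lone arc contributes the mean of an off-diagonal entry as a factor, for every
  injective map; so the state vanishes for each \<open>n\<close>, not only in the limit.\<close>

lemma lone_arc_traffic:
  assumes T: "test_graph T \<gamma> L" and nl: "\<not> no_lone_arcs T \<gamma>"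
  shows "inj_traffic_state M A T \<gamma> n = 0"
proof -
  interpret fin_digraph T using T by (simp add: test_graph_def)
  obtain e where e: "e \<in> arcs T" "tail T e \<noteq> head T e"
    "\<And>e'. e' \<in> arcs T \<Longrightarrow> arc_class T \<gamma> e' = arc_class T \<gamma> e \<Longrightarrow> e' = e"
    using nl unfolding no_lone_arcs_def by blast
  then have lone: "class_arcs T \<gamma> (arc_class T \<gamma> e) = {e}" by (auto simp: class_arcs_def)
  have "(\<Prod>q\<in>arc_class T \<gamma> ` arcs T. class_mean T \<gamma> n \<phi> q) = 0"
    if "\<phi> \<in> inj_maps (verts T) n" for \<phi>
    using class_integral_lone[OF T that e(1,2) lone] e(1)
    by (intro prod_zero finite_imageI finite_arcs) blast
  then have "(\<Sum>\<phi>\<in>inj_maps (verts T) n. \<Prod>q\<in>arc_class T \<gamma> ` arcs T.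
      class_mean T \<gamma> n \<phi> q) = 0"
    by (intro sum.neutral) blast
  then show ?thesis unfolding inj_traffic_state_eq[OF T] by simp
qed

text \<open>Absolute values suffice. Two twin amplitudes multiply to a kernel, so the spanning twins
  give a tree sum of order \<open>n\<close>, and the amplitudes of the remaining arcs, loops
  included, are at most their scales.\<close>

lemma excess_traffic:
  assumes T: "test_graph T \<gamma> L" and nl: "no_lone_arcs T \<gamma>" and ndt: "\<not> double_tree T \<gamma>"
  shows "inj_traffic_state M A T \<gamma> \<longlonglongrightarrow> 0"
proof -
  interpret fin_digraph T using T by (simp add: test_graph_def)
  have lab: "\<gamma> e \<in> L" if "e \<in> arcs T" for e using T that by (auto simp: test_graph_def)
  have "Digraph_Component.connected T" using T by (simp add: test_graph_def)
  from spanning_twins[OF fin_digraph this nl] obtain r p f g where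
    tree: "rooted_tree r p (verts T)" and
    fg': "\<forall>v\<in>verts T - {r}. f v \<in> arcs T \<and> g v \<in> arcs T \<and> f v \<noteq> g v \<and>
      arc_class T \<gamma> (f v) = (\<gamma> (f v), {v, p v}) \<and> arc_class T \<gamma> (g v) = (\<gamma> (f v), {v, p v})" and
    inj: "inj_on f (verts T - {r})" "inj_on g (verts T - {r})"
      "f ` (verts T - {r}) \<inter> g ` (verts T - {r}) = {}" and
    card: "card (f ` (verts T - {r}) \<union> g ` (verts T - {r})) = 2 * (card (verts T) - 1)"
    by (elim exE conjE)
  note fg = bspec[OF fg']
  let ?V = "verts T" and ?P = "\<lambda>n::nat. PiE (verts T) (\<lambda>_. {1..n})"
  let ?D = "f ` (?V - {r}) \<union> g ` (?V - {r})"
  let ?t = "\<lambda>n. tree_prod r p ?V (\<lambda>v. kern (\<gamma> (f v)) n)"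
  have sub: "?D \<subseteq> arcs T" using fg by auto
  have "?D \<noteq> arcs T" using card ndt nl by (auto simp: double_tree_def)
  then obtain e0 where e0: "e0 \<in> arcs T - ?D" using sub by blast
  have amp0: "0 \<le> eamp T \<gamma> n \<phi> e" for n \<phi> e by (simp add: eamp_def amp_nonneg)
  \<comment> \<open>The leftover arcs include \<open>e0\<close>, so this product of scales tends to
    0.\<close>
  define \<eta> where "\<eta> n = (\<Prod>e\<in>arcs T - ?D. s (\<gamma> e) n)" for n
  have "\<eta> \<longlonglongrightarrow> (\<Prod>e\<in>arcs T - ?D. 0)"
    unfolding \<eta>_def by (intro tendsto_prod s_tendsto lab) auto
  moreover have "(\<Prod>e\<in>arcs T - ?D. 0) = (0::real)" using e0 by (intro prod_zero) auto
  ultimately have \<eta>lim: "\<eta> \<longlonglongrightarrow> 0" by (simp only:)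
  have \<eta>0: "0 \<le> \<eta> n" for n unfolding \<eta>_def by (rule prod_nonneg) (simp add: s_nonneg)
  have t0: "0 \<le> ?t n \<phi>" if "\<phi> \<in> ?P n" for n \<phi>
    by (rule tree_prod_nonneg[OF tree _ that]) (use kern_bounds(1) fg lab in blast)
  have pair: "eamp T \<gamma> n \<phi> (f v) * eamp T \<gamma> n \<phi> (g v) = kern (\<gamma> (f v)) n (\<phi> v) (\<phi> (p v))"
    if v: "v \<in> ?V - {r}" for n \<phi> v
  proof -
    have *: "eamp T \<gamma> n \<phi> e = amp n (\<gamma> (f v)) (\<phi> v) (\<phi> (p v))"
      if "arc_class T \<gamma> e = (\<gamma> (f v), {v, p v})" for e
      using that by (auto simp: arc_class_def eamp_def doubleton_eq_iff amp_sym)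
    show ?thesis using *[of "f v"] *[of "g v"] fg[OF v] by (simp add: amp_square)
  qed
  have prod_le: "(\<Prod>e\<in>arcs T. eamp T \<gamma> n \<phi> e) \<le> ?t n \<phi> * \<eta> n" if \<phi>: "\<phi> \<in> ?P n" for n \<phi>
  proof -
    have "(\<Prod>e\<in>arcs T. eamp T \<gamma> n \<phi> e) = (\<Prod>e\<in>?D. eamp T \<gamma> n \<phi> e) * (\<Prod>e\<in>arcs T - ?D. eamp T \<gamma> n \<phi> e)"
      using prod.subset_diff[OF sub finite_arcs] by (simp add: mult.commute)
    also have "(\<Prod>e\<in>?D. eamp T \<gamma> n \<phi> e) = (\<Prod>v\<in>?V - {r}. eamp T \<gamma> n \<phi> (f v)) * (\<Prod>v\<in>?V - {r}. eamp T \<gamma> n \<phi> (g v))"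
      by (subst prod.union_disjoint) (auto simp: inj prod.reindex)
    also have "\<dots> = ?t n \<phi>" by (simp add: prod.distrib[symmetric] tree_prod_def pair)
    also have "?t n \<phi> * (\<Prod>e\<in>arcs T - ?D. eamp T \<gamma> n \<phi> e) \<le> ?t n \<phi> * \<eta> n"
      unfolding \<eta>_def
      by (intro mult_left_mono prod_mono t0[OF \<phi>]) (use amp0 amp_le in \<open>auto simp: eamp_def amp_nonneg\<close>)
    finally show ?thesis .
  qed
  let ?Q = "arc_class T \<gamma> ` arcs T"
  obtain B where B: "1 \<le> B" "\<And>l n i j k. l \<le> card (arcs T) \<Longrightarrow> i \<in> \<gamma> ` arcs T \<Longrightarrow> (j, k) \<in> upper n \<Longrightarrow>
      (\<integral>\<omega>. cmod (X n i j k \<omega>) ^ l \<partial>M n) \<le> B"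
  proof -
    have "\<gamma> ` arcs T \<subseteq> L" using lab by blast
    from X_moments[OF finite_imageI[OF finite_arcs] this, of "card (arcs T)"]
    obtain B where B: "1 \<le> B" "\<forall>l\<le>card (arcs T). \<forall>n. \<forall>i\<in>\<gamma> ` arcs T. \<forall>(j, k)\<in>upper n.
      integrable (M n) (\<lambda>\<omega>. cmod (X n i j k \<omega>) ^ l) \<and> (\<integral>\<omega>. cmod (X n i j k \<omega>) ^ l \<partial>M n) \<le> B"
      by (elim exE conjE)
    show ?thesis
    proof (rule that[OF B(1)])
      fix l n j k :: nat and i assume a: "l \<le> card (arcs T)" "i \<in> \<gamma> ` arcs T" "(j, k) \<in> upper n"
      from bspec[OF bspec[OF spec[where x = n, OF mp[OF spec[OF B(2)] a(1)]] a(2)] a(3)]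
      show "(\<integral>\<omega>. cmod (X n i j k \<omega>) ^ l \<partial>M n) \<le> B" by (simp only: prod.case)
    qed
  qed
  have term_le: "cmod (\<Prod>q\<in>?Q. class_mean T \<gamma> n \<phi> q)
      \<le> B ^ card ?Q * (?t n \<phi> * \<eta> n)" if \<phi>: "\<phi> \<in> inj_maps ?V n" for n \<phi>
  proof -
    have "cmod (\<Prod>q\<in>?Q. class_mean T \<gamma> n \<phi> q)
        \<le> (\<Prod>q\<in>?Q. B * (\<Prod>e\<in>class_arcs T \<gamma> q. eamp T \<gamma> n \<phi> e))"
      unfolding prod_norm[symmetric]
      by (rule prod_mono) (use class_bound[OF T \<phi> B(2)] in auto)
    also have "\<dots> = B ^ card ?Q * (\<Prod>e\<in>arcs T. eamp T \<gamma> n \<phi> e)"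
      unfolding prod.distrib class_arcs_def
      by (subst prod.image_gen[OF finite_arcs, of _ "arc_class T \<gamma>"]) simp
    also have "\<dots> \<le> B ^ card ?Q * (?t n \<phi> * \<eta> n)"
      using prod_le[of \<phi> n] \<phi> B(1) by (intro mult_left_mono) (auto simp: inj_maps_def)
    finally show ?thesis .
  qed
  define PC where "PC = (\<Prod>v\<in>?V - {r}. C (\<gamma> (f v)))"
  have PC0: "0 \<le> PC" unfolding PC_def by (rule prod_nonneg) (use C_ge_1 lab fg in force)
  have bound: "norm (inj_traffic_state M A T \<gamma> n) \<le> B ^ card ?Q * PC * \<eta> n" for n
  proof (cases "n = 0")
    case True
    then show ?thesis using B(1) PC0 \<eta>0 by (simp add: inj_traffic_state_eq[OF T])
  next
    case False
    have "norm (inj_traffic_state M A T \<gamma> n) = (1 / n) * norm (\<Sum>\<phi>\<in>inj_maps ?V n.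
        \<Prod>q\<in>?Q. class_mean T \<gamma> n \<phi> q)"
      by (simp add: inj_traffic_state_eq[OF T] norm_mult norm_divide)
    also have "\<dots> \<le> (1 / n) * (\<Sum>\<phi>\<in>inj_maps ?V n. B ^ card ?Q * (?t n \<phi> * \<eta> n))"
      by (intro mult_left_mono order_trans[OF norm_sum] sum_mono term_le) auto
    also have "\<dots> = (1 / n) * (B ^ card ?Q * \<eta> n * (\<Sum>\<phi>\<in>inj_maps ?V n. ?t n \<phi> * 1))"
      by (simp add: sum_distrib_left mult_ac)
    also have "\<dots> \<le> (1 / n) * (B ^ card ?Q * \<eta> n * (PC * (\<Sum>x=1..n. 1)))"
    proof (intro mult_left_mono)
      have "(\<Sum>\<phi>\<in>inj_maps ?V n. ?t n \<phi> * 1) \<le> (\<Sum>\<phi>\<in>?P n. ?t n \<phi> * 1)"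
        by (rule sum_mono2) (use t0 in \<open>auto simp: inj_maps_def finite_PiE\<close>)
      also have "\<dots> \<le> PC * (\<Sum>x=1..n. 1)"
        unfolding PC_def
        by (rule tree_sum_bound[OF tree, where u = r])
          (use kern_bounds fg lab rooted_tree_root[OF tree] C_ge_1 in \<open>auto intro: order_trans[of 0 1]\<close>)
      finally show "(\<Sum>\<phi>\<in>inj_maps ?V n. ?t n \<phi> * 1) \<le> PC * (\<Sum>x=1..n. 1)" .
    qed (use B(1) \<eta>0 in auto)
    also have "\<dots> = B ^ card ?Q * PC * \<eta> n" using False by simp
    finally show ?thesis .
  qed
  have "(\<lambda>n. B ^ card ?Q * PC * \<eta> n) \<longlonglongrightarrow> B ^ card ?Q * PC * 0" by (intro tendsto_intros \<eta>lim)
  then have "(\<lambda>n. B ^ card ?Q * PC * \<eta> n) \<longlonglongrightarrow> 0" by simp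
  then show ?thesis by (rule Lim_null_comparison[rotated]) (rule always_eventually, use bound in blast)
qed

lemma traffic_limit:
  assumes T: "test_graph T \<gamma> L"
  shows "inj_traffic_state M A T \<gamma> \<longlonglongrightarrow>
    (if double_tree T \<gamma> then of_real (tree_weight T \<gamma> * lim (tree_mass T \<gamma>)) else 0)"
proof (cases "double_tree T \<gamma>")
  case True
  have "tree_mass T \<gamma> \<longlonglongrightarrow> lim (tree_mass T \<gamma>)"
    using convergent_tree_mass[OF T True] by (simp add: convergent_LIMSEQ_iff)
  then have "(\<lambda>n. complex_of_real (tree_weight T \<gamma> * tree_mass T \<gamma> n)) \<longlonglongrightarrow>
      of_real (tree_weight T \<gamma> * lim (tree_mass T \<gamma>))"
    by (intro tendsto_of_real tendsto_mult tendsto_const)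
  from tendsto_add[OF double_tree_traffic[OF T True] this] show ?thesis using True by simp
next
  case False
  have "inj_traffic_state M A T \<gamma> \<longlonglongrightarrow> 0"
  proof (cases "no_lone_arcs T \<gamma>")
    case nl: False
    have "inj_traffic_state M A T \<gamma> = (\<lambda>_. 0)"
      by (rule ext) (rule lone_arc_traffic[OF T nl])
    then show ?thesis by simp
  qed (rule excess_traffic[OF T _ False])
  then show ?thesis using False by simp
qed

end


section \<open>Full proportion: constant kernels cut the tree\<close>

section \<open>Factorization over colored components\<close>

lemma sum_PiE_Un:
  fixes F G :: "('v \<Rightarrow> 'a) \<Rightarrow> real"
  assumes AB: "A \<inter> B = {}"
    and F: "\<And>\<phi> \<psi>. (\<And>v. v \<in> A \<Longrightarrow> \<phi> v = \<psi> v) \<Longrightarrow> F \<phi> = F \<psi>"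
    and G: "\<And>\<phi> \<psi>. (\<And>v. v \<in> B \<Longrightarrow> \<phi> v = \<psi> v) \<Longrightarrow> G \<phi> = G \<psi>"
  shows "(\<Sum>\<phi>\<in>PiE (A \<union> B) (\<lambda>_. S). F \<phi> * G \<phi>) = (\<Sum>\<phi>\<in>PiE A (\<lambda>_. S). F \<phi>) * (\<Sum>\<phi>\<in>PiE B (\<lambda>_. S). G \<phi>)"
proof -
  have "(\<Sum>\<phi>\<in>PiE (A \<union> B) (\<lambda>_. S). F \<phi> * G \<phi>) = (\<Sum>(\<phi>, \<psi>)\<in>PiE A (\<lambda>_. S) \<times> PiE B (\<lambda>_. S). F \<phi> * G \<psi>)"
  proof (rule sum.reindex_bij_witness[of _ "\<lambda>(\<phi>, \<psi>) v. if v \<in> A then \<phi> v else \<psi> v" "\<lambda>\<phi>. (restrict \<phi> A, restrict \<phi> B)"])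
    fix \<phi> assume \<phi>: "\<phi> \<in> PiE (A \<union> B) (\<lambda>_. S)"
    show "(case (restrict \<phi> A, restrict \<phi> B) of (\<phi>, \<psi>) \<Rightarrow> \<lambda>v. if v \<in> A then \<phi> v else \<psi> v) = \<phi>"
      using \<phi> by (fastforce simp: fun_eq_iff PiE_def extensional_def)
    show "(restrict \<phi> A, restrict \<phi> B) \<in> PiE A (\<lambda>_. S) \<times> PiE B (\<lambda>_. S)" using \<phi> by auto
    have "F (restrict \<phi> A) = F \<phi>" "G (restrict \<phi> B) = G \<phi>" by (rule F, simp) (rule G, simp)
    then show "(case (restrict \<phi> A, restrict \<phi> B) of (\<phi>, \<psi>) \<Rightarrow> F \<phi> * G \<psi>) = F \<phi> * G \<phi>" by simp
  next
    fix z assume z: "z \<in> PiE A (\<lambda>_. S) \<times> PiE B (\<lambda>_. S)"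
    obtain \<phi> \<psi> where [simp]: "z = (\<phi>, \<psi>)" by (cases z)
    have \<phi>: "\<phi> \<in> PiE A (\<lambda>_. S)" and \<psi>: "\<psi> \<in> PiE B (\<lambda>_. S)" using z by auto
    let ?h = "\<lambda>v. if v \<in> A then \<phi> v else \<psi> v"
    have "restrict ?h A = \<phi>" using \<phi> by (auto simp: fun_eq_iff PiE_def extensional_def)
    moreover have "restrict ?h B = \<psi>" using \<psi> AB by (fastforce simp: fun_eq_iff PiE_def extensional_def)
    ultimately show "(restrict (case z of (\<phi>, \<psi>) \<Rightarrow> \<lambda>v. if v \<in> A then \<phi> v else \<psi> v) A,
      restrict (case z of (\<phi>, \<psi>) \<Rightarrow> \<lambda>v. if v \<in> A then \<phi> v else \<psi> v) B) = z" by simp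
    show "(case z of (\<phi>, \<psi>) \<Rightarrow> \<lambda>v. if v \<in> A then \<phi> v else \<psi> v) \<in> PiE (A \<union> B) (\<lambda>_. S)"
      using \<phi> \<psi> by (auto simp: PiE_def extensional_def)
  qed
  then show ?thesis by (simp add: sum_product sum.cartesian_product)
qed

text \<open>The map splits into independent pieces, and each vertex seen by none of the factors is
  free and contributes \<open>card S\<close>.\<close>

lemma sum_PiE_disjoint:
  fixes F :: "'c \<Rightarrow> ('v \<Rightarrow> 'a) \<Rightarrow> real"
  assumes "finite \<C>" "finite V" "\<And>c. c \<in> \<C> \<Longrightarrow> U c \<subseteq> V" "disjoint_family_on U \<C>"
    "\<And>c \<phi> \<psi>. c \<in> \<C> \<Longrightarrow> (\<And>v. v \<in> U c \<Longrightarrow> \<phi> v = \<psi> v) \<Longrightarrow> F c \<phi> = F c \<psi>"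
  shows "(\<Sum>\<phi>\<in>PiE V (\<lambda>_. S). \<Prod>c\<in>\<C>. F c \<phi>) =
    real (card S) ^ card (V - (\<Union>c\<in>\<C>. U c)) * (\<Prod>c\<in>\<C>. \<Sum>\<phi>\<in>PiE (U c) (\<lambda>_. S). F c \<phi>)"
  using assms
proof (induction arbitrary: V rule: finite_induct)
  case empty
  then show ?case by (simp add: card_PiE)
next
  case (insert c \<C>)
  let ?V = "V - U c"
  have UV: "U c \<union> ?V = V" using insert.prems(2) by blast
  have dis: "U d \<inter> U c = {}" if "d \<in> \<C>" for d
    using insert.prems(3) insert.hyps(2) that unfolding disjoint_family_on_def by (metis insertCI)
  have "(\<Sum>\<phi>\<in>PiE V (\<lambda>_. S). \<Prod>c\<in>insert c \<C>. F c \<phi>) = (\<Sum>\<phi>\<in>PiE (U c \<union> ?V) (\<lambda>_. S). F c \<phi> * (\<Prod>c\<in>\<C>. F c \<phi>))"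
    unfolding UV using insert.hyps by simp
  also have "\<dots> = (\<Sum>\<phi>\<in>PiE (U c) (\<lambda>_. S). F c \<phi>) * (\<Sum>\<phi>\<in>PiE ?V (\<lambda>_. S). \<Prod>c\<in>\<C>. F c \<phi>)"
  proof (rule sum_PiE_Un)
    show "(\<Prod>c\<in>\<C>. F c \<phi>) = (\<Prod>c\<in>\<C>. F c \<psi>)"
      if eq: "\<And>v. v \<in> V - U c \<Longrightarrow> \<phi> v = \<psi> v" for \<phi> \<psi>
    proof (rule prod.cong[OF refl])
      fix d assume d: "d \<in> \<C>"
      have "U d \<subseteq> V - U c" using dis[OF d] insert.prems(2)[OF insertI2[OF d]] by blast
      then show "F d \<phi> = F d \<psi>"
        by (intro insert.prems(4)[OF insertI2[OF d]] eq) (rule subsetD)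
    qed
    show "U c \<inter> (V - U c) = {}" by blast
    show "F c \<phi> = F c \<psi>" if "\<And>v. v \<in> U c \<Longrightarrow> \<phi> v = \<psi> v" for \<phi> \<psi>
      by (rule insert.prems(4)[OF insertI1 that])
  qed
  also have "(\<Sum>\<phi>\<in>PiE ?V (\<lambda>_. S). \<Prod>c\<in>\<C>. F c \<phi>) =
      real (card S) ^ card (?V - (\<Union>c\<in>\<C>. U c)) * (\<Prod>c\<in>\<C>. \<Sum>\<phi>\<in>PiE (U c) (\<lambda>_. S). F c \<phi>)"
  proof (rule insert.IH)
    show "U d \<subseteq> V - U c" if "d \<in> \<C>" for d using insert.prems(2)[of d] dis[OF that] that by blast
    show "disjoint_family_on U \<C>" using insert.prems(3) by (auto simp: disjoint_family_on_def)
    show "F d \<phi> = F d \<psi>" if "d \<in> \<C>" "\<And>v. v \<in> U d \<Longrightarrow> \<phi> v = \<psi> v" for d \<phi> \<psi>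
      by (rule insert.prems(4)) (use that in auto)
  qed (use insert.prems(1) in simp)
  also have "?V - (\<Union>c\<in>\<C>. U c) = V - (\<Union>c\<in>insert c \<C>. U c)" by blast
  finally show ?case using insert.hyps by (simp add: mult_ac)
qed

context colored_graph
begin

lemma class_arcs_comp:
  assumes C: "C \<in> comps" and q: "q \<in> arc_class C \<gamma> ` arcs C"
  shows "{e \<in> arcs C. arc_class C \<gamma> e = q} = {e \<in> arcs T. arc_class T \<gamma> e = q}"
proof -
  have k: "arcs C \<subseteq> arcs T" using compsE[OF C] by metis
  obtain e0 where e0: "e0 \<in> arcs C" "q = arc_class T \<gamma> e0" using q arc_class_comp[OF C] by auto
  have "tail T e0 \<in> verts C"
    using compsE[OF C] e0(1) by (metis fin_digraph_def test_graph_def wf_digraph.tail_in_verts)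
  then have "e \<in> arcs C" if "e \<in> arcs T" "arc_class T \<gamma> e = q" for e
    by (intro comp_absorbs_arc[OF C e0(1) that(1)]) (use that(2) e0(2) in \<open>auto simp: arc_class_def\<close>)
  then show ?thesis using k arc_class_comp[OF C] by auto
qed

lemma classes_disjoint:
  assumes "C \<in> comps" "C' \<in> comps" "C \<noteq> C'"
  shows "arc_class C \<gamma> ` arcs C \<inter> arc_class C' \<gamma> ` arcs C' = {}"
proof (rule equals0I)
  fix q assume q: "q \<in> arc_class C \<gamma> ` arcs C \<inter> arc_class C' \<gamma> ` arcs C'"
  then have "{e \<in> arcs C. arc_class C \<gamma> e = q} = {e \<in> arcs C'. arc_class C' \<gamma> e = q}"
    using class_arcs_comp assms(1,2) by blast
  then obtain e where "e \<in> arcs C" "e \<in> arcs C'" using q by blast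
  then show False using comps_arcs_disjoint assms by blast
qed

lemma prod_classes:
  "(\<Prod>q\<in>arc_class T \<gamma> ` arcs T. h q) = (\<Prod>C\<in>comps. \<Prod>q\<in>arc_class C \<gamma> ` arcs C. h q)"
proof -
  have "arc_class T \<gamma> ` arcs T = (\<Union>C\<in>comps. arc_class C \<gamma> ` arcs C)"
  proof (intro equalityI subsetI)
    fix q assume "q \<in> arc_class T \<gamma> ` arcs T"
    then obtain e where e: "e \<in> arcs T" "q = arc_class T \<gamma> e" by blast
    obtain C where "C \<in> comps" "e \<in> arcs C" using arc_in_comp[OF e(1)] by blast
    then show "q \<in> (\<Union>C\<in>comps. arc_class C \<gamma> ` arcs C)"
      using e(2) arc_class_comp by (intro UN_I[of C]) auto
  next
    fix q assume "q \<in> (\<Union>C\<in>comps. arc_class C \<gamma> ` arcs C)"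
    then obtain C where C: "C \<in> comps" "q \<in> arc_class C \<gamma> ` arcs C" by blast
    have "arcs C \<subseteq> arcs T" using compsE[OF C(1)] by metis
    then show "q \<in> arc_class T \<gamma> ` arcs T" using C(2) arc_class_comp[OF C(1)] by auto
  qed
  moreover have "prod h (\<Union>C\<in>comps. arc_class C \<gamma> ` arcs C) = (\<Prod>C\<in>comps. \<Prod>q\<in>arc_class C \<gamma> ` arcs C. h q)"
  proof (rule prod.UNION_disjoint[OF finite_comps])
    show "\<forall>C\<in>comps. finite (arc_class C \<gamma> ` arcs C)"
      using comp_test_graph(1) by (blast intro: fin_digraph.finite_arcs)
    show "\<forall>C\<in>comps. \<forall>C'\<in>comps. C \<noteq> C' \<longrightarrow> arc_class C \<gamma> ` arcs C \<inter> arc_class C' \<gamma> ` arcs C' = {}"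
      using classes_disjoint by blast
  qed
  ultimately show ?thesis by simp
qed

end

context band_matrices
begin

lemma tree_weight_comps:
  assumes "colored_graph T \<gamma> K J"
  shows "tree_weight T \<gamma> = (\<Prod>C\<in>color_components T \<gamma> K J. tree_weight C \<gamma>)"
proof -
  interpret colored_graph T \<gamma> K J by fact
  have "class_weight C \<gamma> q = class_weight T \<gamma> q" if "C \<in> comps" "q \<in> arc_class C \<gamma> ` arcs C" for C q
  proof -
    have "tail C = tail T" using compsE[OF that(1)] by metis
    then show ?thesis using class_arcs_comp[OF that] by (simp add: class_weight_def class_arcs_def)
  qed
  then show ?thesis unfolding tree_weight_def prod_classes by simp
qed

text \<open>The labels in \<open>F\<close> are those of full proportion, whose kernel is asymptotically constant.\<close>

definition flat_kernel :: "'i set \<Rightarrow> nat \<Rightarrow> ('v \<Rightarrow> nat) \<Rightarrow> 'i \<times> 'v set \<Rightarrow> real" where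
  "flat_kernel F n \<phi> q = (if fst q \<in> F then 1 / real n else class_kernel n \<phi> q)"

definition flat_mass :: "'i set \<Rightarrow> ('v, 'e) pre_digraph \<Rightarrow> ('e \<Rightarrow> 'i) \<Rightarrow> nat \<Rightarrow> real" where
  "flat_mass F T \<gamma> n = (\<Sum>\<phi>\<in>PiE (verts T) (\<lambda>_. {1..n}). \<Prod>q\<in>arc_class T \<gamma> ` arcs T. flat_kernel F n \<phi> q) / real n"

text \<open>At \<open>c = 1\<close> the constant 2c - c^2 equals 1, so the squared scale is exactly
  1/n and only the width deviates from its limit.\<close>

definition full_labels :: "'i set \<Rightarrow> bool" where
  "full_labels F \<longleftrightarrow> F \<subseteq> L \<and> (\<forall>i\<in>F. (\<forall>n. (s i n)\<^sup>2 = 1 / real n) \<and> (\<lambda>n. real (b i n) / real n) \<longlonglongrightarrow> 1)"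

text \<open>The kernels are exchanged for constants one edge at a time; each exchange is a tree sum
  with a deviation of vanishing row and column sums on that edge.\<close>

lemma flat_mass_approx:
  assumes T: "test_graph T \<gamma> L" and dt: "double_tree T \<gamma>" and F: "full_labels F"
  shows "(\<lambda>n. tree_mass T \<gamma> n - flat_mass F T \<gamma> n) \<longlonglongrightarrow> 0"
proof -
  obtain r p i where sh: "tree_shape T \<gamma> r p i" using double_tree_shape(1)[OF T dt] by blast
  then have tree: "rooted_tree r p (verts T)" by (simp add: tree_shape_def)
  note iL = tree_shape_labels[OF T sh]
  let ?V = "verts T"
  have fin: "finite ?V" by (rule rooted_tree_finite[OF tree])
  define k where "k S v = (if v \<in> S then (\<lambda>n _ _. 1 / real n) else kern (i v))" for S v
  let ?w = "\<lambda>S. weighted_tree_sum r p ?V (k S) (\<lambda>_ _. 1)"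
  define S1 where "S1 = {v \<in> ?V - {r}. i v \<in> F}"
  have flat: "flat_mass F T \<gamma> n = ?w S1 n" for n
  proof -
    have "(\<Prod>q\<in>arc_class T \<gamma> ` arcs T. flat_kernel F n \<phi> q) = tree_prod r p ?V (\<lambda>v. k S1 v n) \<phi>" for \<phi>
    proof -
      have "bij_betw (\<lambda>v. (i v, {v, p v})) (verts T - {r}) (arc_class T \<gamma> ` arcs T)"
        using sh by (simp add: tree_shape_def)
      then have "(\<Prod>q\<in>arc_class T \<gamma> ` arcs T. flat_kernel F n \<phi> q) =
          (\<Prod>v\<in>?V - {r}. flat_kernel F n \<phi> (i v, {v, p v}))"
        by (rule prod.reindex_bij_betw[symmetric])
      also have "\<dots> = tree_prod r p ?V (\<lambda>v. k S1 v n) \<phi>"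
        unfolding tree_prod_def
        by (rule prod.cong) (auto simp: flat_kernel_def class_kernel_pair k_def S1_def)
      finally show ?thesis .
    qed
    then show ?thesis by (simp add: flat_mass_def weighted_tree_sum_def)
  qed
  have mass: "tree_mass T \<gamma> n = ?w {} n" for n
  proof -
    have "k {} = (\<lambda>v. kern (i v))" by (rule ext) (simp add: k_def)
    then show ?thesis unfolding tree_mass_eq[OF sh] by simp
  qed
  \<comment> \<open>The constant kernel has row and column sums 1 and obeys the same bounds, since
    \<open>C\<close> is at least 1.\<close>
  have bk: "0 \<le> k S v n x y" "x \<in> {1..n} \<Longrightarrow> (\<Sum>y=1..n. k S v n x y) \<le> C (i v)"
      "y \<in> {1..n} \<Longrightarrow> (\<Sum>x=1..n. k S v n x y) \<le> C (i v)" if v: "v \<in> ?V - {r}" for S v n x y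
    using kern_bounds[OF iL[OF v]] C_ge_1[OF iL[OF v]] by (auto simp: k_def)
  have step: "(\<lambda>n. ?w S n - ?w (insert v S) n) \<longlonglongrightarrow> 0" if v: "v \<in> S1" "v \<notin> S" for S v
  proof -
    have vV: "v \<in> ?V - {r}" and vF: "i v \<in> F" using v by (auto simp: S1_def)
    have sq: "(\<lambda>n. (s (i v) n)\<^sup>2) = (\<lambda>n. 1 / real n)" and blim: "(\<lambda>n. real (b (i v) n) / real n) \<longlonglongrightarrow> 1"
      using F vF by (auto simp: full_labels_def)
    \<comment> \<open>The absolute deviation is again a nonnegative kernel, with row and column sums
      at most \<open>\<delta> n\<close>; placed on the edge of \<open>v\<close> it makes the general
      tree bound applicable.\<close>
    define dev where "dev n x y = \<bar>kern (i v) n x y - 1 / real n\<bar>" for n x y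
    define \<delta> where "\<delta> n = \<bar>1 - real (b (i v) n) / real n\<bar>" for n
    have col: "(\<Sum>x=1..n. dev n x y) \<le> \<delta> n" if "y \<in> {1..n}" for n y
      unfolding dev_def \<delta>_def sq by (rule full_kernel_deviation[OF that])
    have row: "(\<Sum>y=1..n. dev n x y) \<le> \<delta> n" if "x \<in> {1..n}" for n x
      using col[OF that] by (simp add: dev_def band_kernel_sym)
    define PC where "PC = (\<Prod>u\<in>?V - {r} - {v}. C (i u))"
    have bound: "norm (?w S n - ?w (insert v S) n) \<le> PC * \<delta> n" for n
    proof (cases "n = 0")
      case True
      have "0 \<le> PC" unfolding PC_def by (rule prod_nonneg) (use C_ge_1 iL in force)
      then show ?thesis using True by (simp add: weighted_tree_sum_def \<delta>_def)
    next
      case False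
      let ?P = "PiE ?V (\<lambda>_. {1..n})"
      have diff: "\<bar>tree_prod r p ?V (\<lambda>u. k S u n) \<phi> - tree_prod r p ?V (\<lambda>u. k (insert v S) u n) \<phi>\<bar>
          = tree_prod r p ?V (\<lambda>u. ((k S)(v := dev)) u n) \<phi>" if \<phi>: "\<phi> \<in> ?P" for \<phi>
      proof -
        have R: "tree_prod r p ?V h \<phi> = h v (\<phi> v) (\<phi> (p v)) * (\<Prod>u\<in>?V - {r} - {v}. h u (\<phi> u) (\<phi> (p u)))" for h
          unfolding tree_prod_def by (rule prod.remove) (use fin vV in auto)
        let ?R = "\<Prod>u\<in>?V - {r} - {v}. k S u n (\<phi> u) (\<phi> (p u))"
        have same: "(\<Prod>u\<in>?V - {r} - {v}. k (insert v S) u n (\<phi> u) (\<phi> (p u))) = ?R"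
          "(\<Prod>u\<in>?V - {r} - {v}. ((k S)(v := dev)) u n (\<phi> u) (\<phi> (p u))) = ?R"
          by (rule prod.cong; auto simp: k_def)+
        have "0 \<le> ?R" by (rule prod_nonneg) (use bk(1) in blast)
        moreover have "k S v n (\<phi> v) (\<phi> (p v)) = kern (i v) n (\<phi> v) (\<phi> (p v))"
          "k (insert v S) v n (\<phi> v) (\<phi> (p v)) = 1 / real n" using v(2) by (simp_all add: k_def)
        ultimately show ?thesis unfolding R same
          by (simp only: fun_upd_same dev_def left_diff_distrib[symmetric] abs_mult abs_of_nonneg)
      qed
      have "norm (?w S n - ?w (insert v S) n)
          = \<bar>\<Sum>\<phi>\<in>?P. tree_prod r p ?V (\<lambda>u. k S u n) \<phi> - tree_prod r p ?V (\<lambda>u. k (insert v S) u n) \<phi>\<bar> / n"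
        by (simp add: weighted_tree_sum_def diff_divide_distrib[symmetric] sum_subtractf)
      also have "\<dots> \<le> (\<Sum>\<phi>\<in>?P. tree_prod r p ?V (\<lambda>u. ((k S)(v := dev)) u n) \<phi> * 1) / n"
        by (intro divide_right_mono order_trans[OF sum_abs] sum_mono) (use diff in auto)
      also have "\<dots> \<le> (\<Prod>u\<in>?V - {r}. if u = v then \<delta> n else C (i u)) * (\<Sum>x=1..n. 1) / n"
      proof (intro divide_right_mono tree_sum_bound[OF tree, where u = r])
        show "r \<in> ?V" by (rule rooted_tree_root[OF tree])
      qed (use bk row col C_ge_1 iL in \<open>auto simp: dev_def \<delta>_def intro: order_trans[of 0 1]\<close>)
      also have "(\<Prod>u\<in>?V - {r}. if u = v then \<delta> n else C (i u)) = \<delta> n * PC"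
        unfolding PC_def by (subst prod.remove[of _ v]) (use fin vV in auto)
      finally show ?thesis using False by (simp add: mult.commute)
    qed
    have "\<delta> \<longlonglongrightarrow> \<bar>1 - 1\<bar>" unfolding \<delta>_def by (intro tendsto_intros blim)
    then have "(\<lambda>n. PC * \<delta> n) \<longlonglongrightarrow> PC * \<bar>1 - 1\<bar>" by (intro tendsto_intros)
    then have "(\<lambda>n. PC * \<delta> n) \<longlonglongrightarrow> 0" by simp
    then show ?thesis by (rule Lim_null_comparison[rotated]) (rule always_eventually, use bound in blast)
  qed
  have "(\<lambda>n. ?w {} n - ?w S n) \<longlonglongrightarrow> 0" if "finite S" "S \<subseteq> S1" for S
    using that
  proof (induction S rule: finite_induct)
    case (insert v S)
    then have "(\<lambda>n. (?w {} n - ?w S n) + (?w S n - ?w (insert v S) n)) \<longlonglongrightarrow> 0 + 0"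
      by (intro tendsto_add step) auto
    then show ?case by simp
  qed simp
  from this[of S1] fin show ?thesis unfolding flat mass by (simp add: S1_def)
qed

lemma double_tree_card_classes:
  fixes \<gamma> :: "'e \<Rightarrow> 'i"
  assumes "test_graph T \<gamma> L'" "double_tree T \<gamma>"
  shows "Suc (card (arc_class T \<gamma> ` arcs T)) = card (verts T)"
proof -
  obtain r p i where "tree_shape T \<gamma> r p i" using double_tree_shape(1)[OF assms] by blast
  then have bij: "bij_betw (\<lambda>v. (i v, {v, p v})) (verts T - {r}) (arc_class T \<gamma> ` arcs T)"
    and tree: "rooted_tree r p (verts T)" by (auto simp: tree_shape_def)
  have "card (arc_class T \<gamma> ` arcs T) = card (verts T - {r})" using bij_betw_same_card[OF bij] by simp
  moreover have "r \<in> verts T" "finite (verts T)"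
    using rooted_tree_root[OF tree] rooted_tree_finite[OF tree] by auto
  ultimately show ?thesis by (metis card_Suc_Diff1)
qed

text \<open>Each class of colour \<open>a\<close> contributes just a factor 1/n, and components of
  that colour have mass 1. Those of colour \<open>c\<close> are pairwise disjoint, so the sum over
  maps is a product over them times powers of \<open>n\<close> for the free vertices. In a double
  tree all powers of \<open>n\<close> cancel exactly.\<close>

lemma flat_mass_factorization:
  assumes cg: "colored_graph T \<gamma> {a, c} J" and ac: "a \<noteq> c" and dt: "double_tree T \<gamma>" and n: "n \<ge> 1"
  shows "flat_mass (J a) T \<gamma> n = (\<Prod>D\<in>color_components T \<gamma> {a, c} J. flat_mass (J a) D \<gamma> n)"
proof -
  interpret colored_graph T \<gamma> "{a, c}" J by fact
  let ?f = "\<lambda>D \<phi>. \<Prod>q\<in>arc_class D \<gamma> ` arcs D. flat_kernel (J a) n \<phi> q"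
  define N where "N = real n"
  have N0: "N \<noteq> 0" using n by (simp add: N_def)
  define CA where "CA = {D \<in> comps. component_of a D}"
  define CC where "CC = {D \<in> comps. \<not> component_of a D}"
  have split: "comps = CA \<union> CC" "CA \<inter> CC = {}" by (auto simp: CA_def CC_def)
  have fin: "finite CA" "finite CC" using finite_comps by (auto simp: CA_def CC_def)
  have CCc: "component_of c D" if "D \<in> CC" for D using that comps_iff by (auto simp: CC_def)
  have dtD: "double_tree D \<gamma>" if "D \<in> comps" for D using double_tree_iff_comps dt that by blast
  have tgD: "\<exists>k. test_graph D \<gamma> (J k)" if "D \<in> comps" for D using compsE[OF that] by metis
  have cardD: "Suc (card (arc_class D \<gamma> ` arcs D)) = card (verts D)" if "D \<in> comps" for D
    using tgD[OF that] double_tree_card_classes dtD[OF that] by metis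
  have finV: "finite (verts D)" if "D \<in> comps" for D
    using comp_test_graph(1)[OF that] by (rule fin_digraph.finite_verts)
  have fA: "?f D \<phi> = (1 / N) ^ card (arc_class D \<gamma> ` arcs D)" if "D \<in> CA" for D \<phi>
  proof -
    have "subgraph D (Lab a)" using that component_ofD(1) by (auto simp: CA_def)
    then have "\<gamma> e \<in> J a" if "e \<in> arcs D" for e using subgraph_LabD(5) that by blast
    then have "flat_kernel (J a) n \<phi> q = 1 / N" if "q \<in> arc_class D \<gamma> ` arcs D" for q
      using that by (auto simp: flat_kernel_def arc_class_def N_def)
    then show ?thesis by simp
  qed
  have card_set: "card {1..n} = n" by simp
  have massA: "flat_mass (J a) D \<gamma> n = 1" if D: "D \<in> CA" for D
  proof -
    have DC: "D \<in> comps" using D by (simp add: CA_def)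
    have "flat_mass (J a) D \<gamma> n = N ^ card (verts D) * (1 / N) ^ card (arc_class D \<gamma> ` arcs D) / N"
      unfolding flat_mass_def fA[OF D] using finV[OF DC] by (simp add: card_PiE N_def)
    also have "\<dots> = 1" unfolding cardD[OF DC, symmetric] using N0 by (simp add: power_one_over)
    finally show ?thesis .
  qed
  have massC: "(\<Sum>\<phi>\<in>PiE (verts D) (\<lambda>_. {1..n}). ?f D \<phi>) = N * flat_mass (J a) D \<gamma> n" for D :: "('a, 'b) pre_digraph"
    using N0 by (simp add: flat_mass_def N_def)
  let ?U = "\<Union>D\<in>CC. verts D"
  have disjC: "disjoint_family_on verts CC"
    unfolding disjoint_family_on_def using component_of_eqI CCc by blast
  have "(\<Sum>\<phi>\<in>PiE (verts T) (\<lambda>_. {1..n}). \<Prod>D\<in>CC. ?f D \<phi>) =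
      real (card {1..n}) ^ card (verts T - ?U) * (\<Prod>D\<in>CC. \<Sum>\<phi>\<in>PiE (verts D) (\<lambda>_. {1..n}). ?f D \<phi>)"
  proof (rule sum_PiE_disjoint[OF fin(2) finite_verts _ disjC])
    show "verts D \<subseteq> verts T" if "D \<in> CC" for D using that by (auto simp: CC_def elim!: compsE)
    fix D and \<phi> \<psi> :: "'a \<Rightarrow> nat" assume D: "D \<in> CC" and eq: "\<And>v. v \<in> verts D \<Longrightarrow> \<phi> v = \<psi> v"
    interpret D: fin_digraph D using D comp_test_graph(1) by (simp add: CC_def)
    show "?f D \<phi> = ?f D \<psi>"
    proof (rule prod.cong[OF refl])
      fix q assume "q \<in> arc_class D \<gamma> ` arcs D"
      then have "snd q \<subseteq> verts D" by (auto simp: arc_class_def)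
      then have "\<phi> ` snd q = \<psi> ` snd q" using eq by (intro image_cong) auto
      then show "flat_kernel (J a) n \<phi> q = flat_kernel (J a) n \<psi> q"
        by (simp add: flat_kernel_def class_kernel_def)
    qed
  qed
  then have sumC: "(\<Sum>\<phi>\<in>PiE (verts T) (\<lambda>_. {1..n}). \<Prod>D\<in>CC. ?f D \<phi>) =
      N ^ (card (verts T - ?U) + card CC) * (\<Prod>D\<in>CC. flat_mass (J a) D \<gamma> n)"
    unfolding massC prod.distrib card_set by (simp add: power_add N_def)
  define qA where "qA = (\<Sum>D\<in>CA. card (arc_class D \<gamma> ` arcs D))"
  have "card (arc_class T \<gamma> ` arcs T) = (\<Sum>D\<in>comps. card (arc_class D \<gamma> ` arcs D))"
  proof -
    \<comment> \<open>The numbers of classes add up over the components: the product formula for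
      classes, read with the constant factor 2.\<close>
    have "(2::nat) ^ card (arc_class T \<gamma> ` arcs T) = (\<Prod>q\<in>arc_class T \<gamma> ` arcs T. 2)" by simp
    also have "\<dots> = (\<Prod>D\<in>comps. 2 ^ card (arc_class D \<gamma> ` arcs D))" unfolding prod_classes by simp
    also have "\<dots> = 2 ^ (\<Sum>D\<in>comps. card (arc_class D \<gamma> ` arcs D))" by (simp add: power_sum)
    finally show ?thesis by simp
  qed
  also have "\<dots> = qA + (\<Sum>D\<in>CC. card (arc_class D \<gamma> ` arcs D))"
    unfolding qA_def split(1) by (rule sum.union_disjoint[OF fin split(2)])
  finally have q: "card (arc_class T \<gamma> ` arcs T) = qA + (\<Sum>D\<in>CC. card (arc_class D \<gamma> ` arcs D))" .
  have "card ?U = (\<Sum>D\<in>CC. card (verts D))"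
  proof (rule card_UN_disjoint[OF fin(2)])
    show "\<forall>D\<in>CC. finite (verts D)" using finV by (auto simp: CC_def)
    show "\<forall>D\<in>CC. \<forall>D'\<in>CC. D \<noteq> D' \<longrightarrow> verts D \<inter> verts D' = {}"
      using disjC by (auto simp: disjoint_family_on_def)
  qed
  also have "\<dots> = (\<Sum>D\<in>CC. card (arc_class D \<gamma> ` arcs D) + 1)"
    by (rule sum.cong) (use cardD in \<open>auto simp: CC_def\<close>)
  also have "\<dots> = (\<Sum>D\<in>CC. card (arc_class D \<gamma> ` arcs D)) + card CC"
    by (simp only: sum.distrib sum_constant of_nat_id mult_1_right)
  finally have u: "card ?U = (\<Sum>D\<in>CC. card (arc_class D \<gamma> ` arcs D)) + card CC" .
  have "?U \<subseteq> verts T" by (auto simp: CC_def elim!: compsE)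
  then have "card (verts T) = card (verts T - ?U) + card ?U"
    using card_Diff_subset[of ?U "verts T"] card_mono[of "verts T" ?U] finite_subset[of ?U "verts T"] by simp
  \<comment> \<open>A double tree has one vertex more than classes. For \<open>T\<close> and for the
    components in \<open>CC\<close> this counts the powers of \<open>N\<close>: one for each class
    of colour \<open>a\<close>, and one more for the prefactor 1/n.\<close>
  then have exponent: "card (verts T - ?U) + card CC = Suc qA"
    using double_tree_card_classes[OF T dt] q u by simp
  have "flat_mass (J a) T \<gamma> n = (\<Sum>\<phi>\<in>PiE (verts T) (\<lambda>_. {1..n}). \<Prod>D\<in>comps. ?f D \<phi>) / N"
    unfolding flat_mass_def prod_classes N_def ..
  also have "(\<Sum>\<phi>\<in>PiE (verts T) (\<lambda>_. {1..n}). \<Prod>D\<in>comps. ?f D \<phi>)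
      = (\<Sum>\<phi>\<in>PiE (verts T) (\<lambda>_. {1..n}). (1 / N) ^ qA * (\<Prod>D\<in>CC. ?f D \<phi>))"
    unfolding split(1) prod.union_disjoint[OF fin split(2)] by (simp add: fA qA_def power_sum)
  also have "\<dots> = (1 / N) ^ qA * (N ^ Suc qA * (\<Prod>D\<in>CC. flat_mass (J a) D \<gamma> n))"
    unfolding sum_distrib_left[symmetric] sumC exponent ..
  also have "\<dots> / N = (\<Prod>D\<in>CC. flat_mass (J a) D \<gamma> n)" using N0 by (simp add: power_one_over)
  also have "\<dots> = (\<Prod>D\<in>comps. flat_mass (J a) D \<gamma> n)"
    unfolding split(1) prod.union_disjoint[OF fin split(2)] using massA by simp
  finally show ?thesis .
qed

text \<open>The identity for flat masses is exact for each positive \<open>n\<close>, and flat and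
  true masses have the same limits.\<close>

lemma tree_mass_factorization:
  assumes cg: "colored_graph T \<gamma> {a, c} J" and ac: "a \<noteq> c" and dt: "double_tree T \<gamma>"
    and sub: "J a \<union> J c \<subseteq> L" and full: "full_labels (J a)"
  shows "lim (tree_mass T \<gamma>) = (\<Prod>D\<in>color_components T \<gamma> {a, c} J. lim (tree_mass D \<gamma>))"
proof -
  interpret colored_graph T \<gamma> "{a, c}" J by fact
  have flat_lim: "flat_mass (J a) D \<gamma> \<longlonglongrightarrow> lim (tree_mass D \<gamma>)" if "test_graph D \<gamma> L" "double_tree D \<gamma>"
    for D :: "('a, 'b) pre_digraph"
  proof -
    have "tree_mass D \<gamma> \<longlonglongrightarrow> lim (tree_mass D \<gamma>)"
      using convergent_tree_mass[OF that] by (simp add: convergent_LIMSEQ_iff)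
    from tendsto_diff[OF this flat_mass_approx[OF that full]] show ?thesis by simp
  qed
  have TL: "test_graph T \<gamma> L" using T sub by (auto simp: test_graph_def)
  have "flat_mass (J a) D \<gamma> \<longlonglongrightarrow> lim (tree_mass D \<gamma>)" if "D \<in> comps" for D
  proof (rule flat_lim)
    show "double_tree D \<gamma>" using double_tree_iff_comps dt that by blast
    show "test_graph D \<gamma> L" using that sub by (auto simp: test_graph_def elim!: compsE)
  qed
  then have "(\<lambda>n. \<Prod>D\<in>comps. flat_mass (J a) D \<gamma> n) \<longlonglongrightarrow> (\<Prod>D\<in>comps. lim (tree_mass D \<gamma>))"
    by (intro tendsto_prod)
  moreover have "eventually (\<lambda>n. (\<Prod>D\<in>comps. flat_mass (J a) D \<gamma> n) = flat_mass (J a) T \<gamma> n) sequentially"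
    using flat_mass_factorization[OF cg ac dt] by (intro eventually_sequentiallyI[of 1]) simp
  ultimately have "flat_mass (J a) T \<gamma> \<longlonglongrightarrow> (\<Prod>D\<in>comps. lim (tree_mass D \<gamma>))"
    by (rule Lim_transform_eventually)
  with flat_lim[OF TL dt] show ?thesis by (rule LIMSEQ_unique)
qed

text \<open>Any disjoint family \<open>J c\<close> of labels of the locale may stand opposite the
  full one, so both independence claims are instances.\<close>

lemma full_independent:
  assumes ac: "a \<noteq> c" "J a \<inter> J c = {}" and sub: "J a \<union> J c \<subseteq> L" and full: "full_labels (J a)"
  shows "asymp_traffic_independent M A {a, c} J"
  unfolding asymp_traffic_independent_def
proof (intro allI impI)
  fix T :: "(nat, nat) pre_digraph" and \<gamma> assume T: "test_graph T \<gamma> (\<Union>k\<in>{a, c}. J k)"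
  interpret colored_graph T \<gamma> "{a, c}" J
    using T ac by unfold_locales (auto simp: disjoint_family_on_def)
  have TL: "test_graph T \<gamma> L" using T sub by (auto simp: test_graph_def)
  have DL: "test_graph D \<gamma> L" if "D \<in> comps" for D
    using that sub by (auto simp: test_graph_def elim!: compsE)
  have limD: "lim (inj_traffic_state M A D \<gamma>) =
      (if double_tree D \<gamma> then of_real (tree_weight D \<gamma> * lim (tree_mass D \<gamma>)) else 0)" if "D \<in> comps" for D
    by (rule limI[OF traffic_limit[OF DL[OF that]]])
  have "(if double_tree T \<gamma> then complex_of_real (tree_weight T \<gamma> * lim (tree_mass T \<gamma>)) else 0) =
      (if free_product T \<gamma> {a, c} J then \<Prod>D\<in>comps. lim (inj_traffic_state M A D \<gamma>) else 0)"
  proof (cases "double_tree T \<gamma>")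
    case True
    then have *: "free_product T \<gamma> {a, c} J" "\<And>D. D \<in> comps \<Longrightarrow> double_tree D \<gamma>"
      using double_tree_iff_comps by blast+
    have "(\<Prod>D\<in>comps. lim (inj_traffic_state M A D \<gamma>)) =
        (\<Prod>D\<in>comps. complex_of_real (tree_weight D \<gamma> * lim (tree_mass D \<gamma>)))"
      by (rule prod.cong) (use limD *(2) in auto)
    also have "\<dots> = of_real (tree_weight T \<gamma> * lim (tree_mass T \<gamma>))"
      unfolding tree_weight_comps[OF colored_graph_axioms]
        tree_mass_factorization[OF colored_graph_axioms ac(1) True sub full]
      by (simp only: of_real_prod[symmetric] prod.distrib)
    finally show ?thesis using True *(1) by simp
  next
    case False
    show ?thesis
    proof (cases "free_product T \<gamma> {a, c} J")
      \<comment> \<open>A free product that is not a double tree has a component that is not one,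
        and the state of that component tends to 0.\<close>
      case True
      then obtain D where "D \<in> comps" "\<not> double_tree D \<gamma>" using False double_tree_iff_comps by blast
      then have "(\<Prod>D\<in>comps. lim (inj_traffic_state M A D \<gamma>)) = 0"
        using limD by (intro prod_zero finite_comps) force
      then show ?thesis using False by simp
    qed (use False in simp)
  qed
  then show "convergent (inj_traffic_state M A T \<gamma>) \<and> lim (inj_traffic_state M A T \<gamma>) =
      (if free_product T \<gamma> {a, c} J then \<Prod>D\<in>comps. lim (inj_traffic_state M A D \<gamma>) else 0)"
    using convergentI[OF traffic_limit[OF TL]] limI[OF traffic_limit[OF TL]] by simp
qed

end


section \<open>Counterexamples to independence on paths of alternating colours\<close>

section \<open>Doubled paths\<close>

text \<open>Arcs \<open>2 * t\<close> and \<open>2 * t + 1\<close> join the vertices \<open>t\<close> and \<open>t + 1\<close> in opposite directions.\<close>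

definition doubled_path :: "nat \<Rightarrow> (nat, nat) pre_digraph" where
  "doubled_path m = \<lparr>verts = {0..m}, arcs = {0..<2 * m},
     tail = (\<lambda>e. if even e then e div 2 else Suc (e div 2)),
     head = (\<lambda>e. if even e then Suc (e div 2) else e div 2)\<rparr>"

definition path_labels :: "(nat \<Rightarrow> 'i) \<Rightarrow> nat \<Rightarrow> 'i" where
  "path_labels lab e = lab (e div 2)"

lemma doubled_path_simps [simp]:
  "verts (doubled_path m) = {0..m}" "arcs (doubled_path m) = {0..<2 * m}"
  "tail (doubled_path m) e = (if even e then e div 2 else Suc (e div 2))"
  "head (doubled_path m) e = (if even e then Suc (e div 2) else e div 2)"
  by (simp_all add: doubled_path_def)

lemma doubled_path_class:
  "arc_class (doubled_path m) (path_labels lab) e = (lab (e div 2), {e div 2, Suc (e div 2)})"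
  by (auto simp: arc_class_def path_labels_def)

lemma fin_digraph_doubled_path: "fin_digraph (doubled_path m)"
  by unfold_locales (auto split: if_splits)

lemma connected_doubled_path: "Digraph_Component.connected (doubled_path m)"
proof -
  interpret fin_digraph "doubled_path m" by (rule fin_digraph_doubled_path)
  show ?thesis unfolding connected_iff_cut[OF wf_digraph]
  proof (intro conjI allI impI)
    fix U assume U: "U \<subset> verts (doubled_path m) \<and> U \<noteq> {}"
    show "\<exists>e\<in>arcs (doubled_path m). (tail (doubled_path m) e \<in> U) \<noteq> (head (doubled_path m) e \<in> U)"
    proof (rule ccontr)
      assume no: "\<not> ?thesis"
      have "t \<in> U \<longleftrightarrow> Suc t \<in> U" if "t < m" for t
      proof -
        have "2 * t \<in> arcs (doubled_path m)" using that by simp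
        then have "(tail (doubled_path m) (2 * t) \<in> U) = (head (doubled_path m) (2 * t) \<in> U)"
          using no by blast
        then show ?thesis by simp
      qed
      then have "t \<in> U \<longleftrightarrow> 0 \<in> U" if "t \<le> m" for t
        using that by (induction t) auto
      then show False using U by (cases "0 \<in> U") auto
    qed
  qed auto
qed

lemma test_graph_doubled_path:
  "(\<And>t. t < m \<Longrightarrow> lab t \<in> L) \<Longrightarrow> test_graph (doubled_path m) (path_labels lab) L"
  using fin_digraph_doubled_path connected_doubled_path by (auto simp: test_graph_def path_labels_def)

lemma double_tree_doubled_path: "double_tree (doubled_path m) (path_labels lab)"
  unfolding double_tree_def no_lone_arcs_def
proof (intro conjI ballI impI)
  fix e assume e: "e \<in> arcs (doubled_path m)"
  define e' where "e' = (if even e then Suc e else e - 1)"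
  have "e' div 2 = e div 2" by (cases "even e") (auto simp: e'_def elim!: oddE)
  moreover have "e' \<in> arcs (doubled_path m)" "e' \<noteq> e"
    using e by (auto simp: e'_def elim!: evenE oddE)
  ultimately show "\<exists>e'\<in>arcs (doubled_path m). e' \<noteq> e \<and>
      arc_class (doubled_path m) (path_labels lab) e' = arc_class (doubled_path m) (path_labels lab) e"
    unfolding doubled_path_class by metis
qed simp

text \<open>The root is vertex 1, so that the operators arriving from its two sides are multiplied
  there.\<close>

abbreviation path_parent :: "nat \<Rightarrow> nat" where
  "path_parent v \<equiv> (if v = 0 then 1 else v - 1)"

lemma rooted_tree_path: "1 \<le> m \<Longrightarrow> rooted_tree 1 path_parent {0..m}"
proof (induction m rule: dec_induct)
  case base
  have "rooted_tree 1 path_parent (insert 0 {1})"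
    by (intro rooted_tree.leaf rooted_tree.root) auto
  moreover have "insert 0 {1} = {0..1::nat}" by auto
  ultimately show ?case by simp
next
  case (step m)
  then have "rooted_tree 1 path_parent (insert (Suc m) {0..m})"
    by (intro rooted_tree.leaf) auto
  moreover have "insert (Suc m) {0..m} = {0..Suc m}" by auto
  ultimately show ?case by simp
qed

text \<open>Neighbouring edges of the path have different colours, so its components are single
  double edges; the operators send 1 to a function of mean 1, so these components have mass
  1.\<close>

locale path_graph = band_matrices M L \<beta> X A s b C Op
  for M :: "nat \<Rightarrow> 'w measure" and L :: "'i set" and \<beta> X A s b C Op +
  fixes m :: nat and lab :: "nat \<Rightarrow> 'i" and K :: "'k set" and J :: "'k \<Rightarrow> 'i set"
  assumes m: "1 \<le> m" and lab: "\<And>t. t < m \<Longrightarrow> lab t \<in> (\<Union>k\<in>K. J k)" and JL: "(\<Union>k\<in>K. J k) \<subseteq> L"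
    and disj: "disjoint_family_on J K"
    and alternating: "\<And>t k. Suc t < m \<Longrightarrow> k \<in> K \<Longrightarrow> lab t \<in> J k \<Longrightarrow> lab (Suc t) \<notin> J k"
    and mean: "\<And>i. i \<in> L \<Longrightarrow> (Op i (\<lambda>_. 1) has_integral 1) {0..1}"
begin

abbreviation "P \<equiv> doubled_path m"
abbreviation "g \<equiv> path_labels lab"

sublocale colored_graph P g K J
  using test_graph_doubled_path[OF lab] disj by unfold_locales auto

lemma path_label_L: "t < m \<Longrightarrow> lab t \<in> L" using lab JL by blast

lemma test_graph_P: "test_graph P g L" by (rule test_graph_doubled_path[OF path_label_L])

text \<open>To reach beyond one edge, a component would need an arc of its colour on an adjacent
  edge, which alternation excludes.\<close>

lemma path_component:
  assumes "D \<in> comps" shows "\<exists>t. verts D \<subseteq> {t, Suc t}"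
proof -
  obtain k where k: "k \<in> K" "verts D \<subseteq> verts P" "arcs D \<subseteq> arcs P" "tail D = tail P" "head D = head P"
    "test_graph D g (J k)" using compsE[OF assms] by metis
  obtain e where e: "e \<in> arcs D" using comp_arcs_nonempty[OF assms] by blast
  define t where "t = e div 2"
  interpret D: fin_digraph D using k by (simp add: test_graph_def)
  have lab_k: "lab (e' div 2) \<in> J k" "e' div 2 < m" if "e' \<in> arcs D" for e'
    using that k(3,6) by (auto simp: test_graph_def path_labels_def)
  have ends: "tail D e' \<in> {e' div 2, Suc (e' div 2)}" "head D e' \<in> {e' div 2, Suc (e' div 2)}" for e'
    using k(4,5) by auto
  have "verts D \<subseteq> {t, Suc t}"
  proof (rule ccontr)
    assume not: "\<not> ?thesis"
    let ?U = "verts D \<inter> {t, Suc t}"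
    have "tail D e \<in> ?U" using e ends[of e] D.tail_in_verts[OF e] unfolding t_def by blast
    then obtain e' where e': "e' \<in> arcs D" "(tail D e' \<in> ?U) \<noteq> (head D e' \<in> ?U)"
      using connected_cutE[OF D.wf_digraph comp_test_graph(2)[OF assms], of ?U] not by blast
    have tv: "tail D e' \<in> verts D" "head D e' \<in> verts D" using e' by auto
    have ne: "e' div 2 \<noteq> t" using e' ends[of e'] tv by auto
    have "e' div 2 = Suc t \<or> t = Suc (e' div 2)"
      using e'(2) ends[of e'] ne by auto
    then show False
      using alternating[of t k] alternating[of "e' div 2" k] lab_k[OF e] lab_k[OF e'(1)] k(1)
      by (auto simp: t_def)
  qed
  then show ?thesis by blast
qed

lemma weighted_sum_leaf:
  assumes "rooted_tree r p V" "w \<notin> V" "p w \<in> V" "\<And>v. v \<in> insert w V - {r} \<Longrightarrow> i v \<in> L"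
    "\<And>v. v \<in> insert w V \<Longrightarrow> continuous_on {0..1} (f v)" "w \<noteq> r"
    "weighted_tree_sum r p V (\<lambda>v. kern (i v)) (f(p w := (\<lambda>x. f (p w) x * Op (i w) (f w) x))) \<longlonglongrightarrow> l"
  shows "weighted_tree_sum r p (insert w V) (\<lambda>v. kern (i v)) f \<longlonglongrightarrow> l"
proof -
  have "(\<lambda>n. weighted_tree_sum r p (insert w V) (\<lambda>v. kern (i v)) f n
    - weighted_tree_sum r p V (\<lambda>v. kern (i v)) (f(p w := (\<lambda>x. f (p w) x * Op (i w) (f w) x))) n) \<longlonglongrightarrow> 0"
    by (rule weighted_tree_sum_leaf[where k = "\<lambda>v. kern (i v)" and C = "\<lambda>v. C (i v)", OF assms(1-3)])
      (use bounded limit assms(4-6) in auto)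
  from tendsto_add[OF this assms(7)] show ?thesis by simp
qed

lemma continuous_Op: "i \<in> L \<Longrightarrow> continuous_on {0..1} f \<Longrightarrow> continuous_on {0..1} (Op i f)"
  using limit[of i] by (simp add: kernel_limit_def)

text \<open>Removing the leaf of a single edge leaves the integral of \<open>Op\<close> applied to
  1.\<close>

lemma component_mass:
  assumes D: "D \<in> comps" shows "lim (tree_mass D g) = 1"
proof -
  obtain k where k: "test_graph D g (J k)" "k \<in> K" using compsE[OF D] by metis
  then have DL: "test_graph D g L" using JL by (auto simp: test_graph_def)
  have dt: "double_tree D g"
    using double_tree_iff_comps double_tree_doubled_path D by blast
  obtain r p i where sh: "tree_shape D g r p i" using double_tree_shape(1)[OF DL dt] by blast
  then have tree: "rooted_tree r p (verts D)" by (simp add: tree_shape_def)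
  obtain t where t: "verts D \<subseteq> {t, Suc t}" using path_component[OF D] by blast
  have "verts D \<noteq> {r}"
  proof
    assume "verts D = {r}"
    then have "arc_class D g ` arcs D = {}" using sh by (simp add: tree_shape_def bij_betw_def)
    then show False using comp_arcs_nonempty[OF D] by simp
  qed
  then obtain w where w: "w \<in> verts D" "w \<noteq> r" using rooted_tree_root[OF tree] by blast
  have V: "verts D = insert w {r}" using t w rooted_tree_root[OF tree] by blast
  have pw: "p w = r" using rooted_tree_parent[OF tree, of w] w V by blast
  have iL: "i w \<in> L" by (rule tree_shape_labels[OF DL sh]) (use w in simp)
  have "weighted_tree_sum r p (insert w {r}) (\<lambda>v. kern (i v)) (\<lambda>_ _. 1) \<longlonglongrightarrow> 1"
  proof (rule weighted_sum_leaf[OF rooted_tree.root])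
    let ?f = "(\<lambda>_ _. 1)(p w := (\<lambda>x. 1 * Op (i w) (\<lambda>_. 1) x))"
    have "weighted_tree_sum r p {r} (\<lambda>v. kern (i v)) ?f \<longlonglongrightarrow> integral {0..1} (?f r)"
      by (rule weighted_tree_sum_root) (use continuous_Op[OF iL, of "\<lambda>_. 1"] pw in simp)
    also have "integral {0..1} (?f r) = 1" using integral_unique[OF mean[OF iL]] pw by simp
    finally show "weighted_tree_sum r p {r} (\<lambda>v. kern (i v)) ?f \<longlonglongrightarrow> 1" .
  qed (use w pw iL in auto)
  then have "tree_mass D g \<longlonglongrightarrow> 1" unfolding tree_mass_eq[OF sh, abs_def] V by simp
  then show ?thesis by (rule limI)
qed

text \<open>Twins in opposite directions produce the expectation of a squared modulus, so the
  counterexamples work for all values of the parameters \<open>\<beta>\<close>.\<close>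

lemma path_weight: "tree_weight P g = 1"
  unfolding tree_weight_def
proof (rule prod.neutral, rule ballI)
  fix q assume "q \<in> arc_class P g ` arcs P"
  then obtain t where q: "q = (lab t, {t, Suc t})" by (auto simp: doubled_path_class)
  have half: "e div 2 = t" if "e \<in> class_arcs P g q" for e
    using that by (auto simp: class_arcs_def doubled_path_class q doubleton_eq_iff)
  have "e = e'" if "e \<in> class_arcs P g q" "e' \<in> class_arcs P g q" "tail P e = tail P e'" for e e'
  proof -
    have "e div 2 = e' div 2" "even e = even e'" using half[OF that(1)] half[OF that(2)] that(3) by (auto split: if_splits)
    then show ?thesis by presburger
  qed
  then have "\<not> (\<exists>e\<in>class_arcs P g q. \<exists>e'\<in>class_arcs P g q. e \<noteq> e' \<and> tail P e = tail P e')" by blast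
  then show "class_weight P g q = 1" by (simp only: class_weight_def if_False)
qed

text \<open>As the path is rooted at 1, vertex 0 hangs on edge 0 and a vertex \<open>v\<close> above
  1 on edge \<open>v - 1\<close>.\<close>

definition path_edge_label :: "nat \<Rightarrow> 'i" where
  "path_edge_label v = lab (if v = 0 then 0 else v - 1)"

lemma path_shape: "tree_shape P g 1 path_parent path_edge_label"
  unfolding tree_shape_def
proof (intro conjI)
  show "rooted_tree 1 path_parent (verts P)" using rooted_tree_path[OF m] by simp
  let ?t = "\<lambda>v. if v = 0 then 0 else v - 1 :: nat"
  have vm: "?t v < m" if "v \<in> {0..m} - {1}" for v using that m by auto
  have eq: "(path_edge_label v, {v, path_parent v}) = arc_class P g (2 * ?t v)" if "v \<in> {0..m} - {1}" for v
    using that unfolding doubled_path_class path_edge_label_def by auto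
  have im: "(\<lambda>v. (path_edge_label v, {v, path_parent v})) ` ({0..m} - {1}) = arc_class P g ` arcs P"
  proof (intro equalityI subsetI)
    fix q assume "q \<in> (\<lambda>v. (path_edge_label v, {v, path_parent v})) ` ({0..m} - {1})"
    then obtain v where v: "v \<in> {0..m} - {1}" "q = (path_edge_label v, {v, path_parent v})" by blast
    then have "q = arc_class P g (2 * ?t v)" using eq by blast
    with v(1) show "q \<in> arc_class P g ` arcs P" using vm[of v] by (intro image_eqI[of _ _ "2 * ?t v"]) auto
  next
    fix q assume "q \<in> arc_class P g ` arcs P"
    then obtain e where e: "e < 2 * m" "q = (lab (e div 2), {e div 2, Suc (e div 2)})"
      by (auto simp: doubled_path_class)
    define v where "v = (if e div 2 = 0 then 0 else Suc (e div 2))"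
    have "v \<in> {0..m} - {1}" "q = (path_edge_label v, {v, path_parent v})"
      using e by (auto simp: v_def path_edge_label_def)
    then show "q \<in> (\<lambda>v. (path_edge_label v, {v, path_parent v})) ` ({0..m} - {1})" by blast
  qed
  have "inj_on (\<lambda>v. {v, path_parent v}) ({0..m} - {1})"
    by (rule rooted_tree_edge_inj[OF rooted_tree_path[OF m]])
  then have "inj_on (\<lambda>v. (path_edge_label v, {v, path_parent v})) ({0..m} - {1})"
    unfolding inj_on_def by blast
  then show "bij_betw (\<lambda>v. (path_edge_label v, {v, path_parent v})) (verts P - {1}) (arc_class P g ` arcs P)"
    using im by (simp add: bij_betw_def)
  show "path_edge_label ` (verts P - {1}) \<subseteq> g ` arcs P"
  proof
    fix x assume "x \<in> path_edge_label ` (verts P - {1})"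
    then obtain v where x: "x = path_edge_label v" and "v \<in> verts P - {1}" by (rule imageE)
    then have v: "v \<in> {0..m} - {1}" by simp
    have "x = g (2 * ?t v)" by (simp add: x path_edge_label_def path_labels_def)
    with v(1) show "x \<in> g ` arcs P" using vm[of v] by auto
  qed
qed

text \<open>The path is a double tree, hence a free product, and its components have weights with
  product 1 and masses 1; independence would force the limit 1.\<close>

lemma not_independent:
  assumes l: "weighted_tree_sum 1 path_parent {0..m} (\<lambda>v. kern (path_edge_label v)) (\<lambda>_ _. 1) \<longlonglongrightarrow> l" "l \<noteq> 1"
  shows "\<not> asymp_traffic_independent M A K J"
proof
  assume ind: "asymp_traffic_independent M A K J"
  have dt: "double_tree P g" by (rule double_tree_doubled_path)
  have "tree_mass P g \<longlonglongrightarrow> l" using l(1) unfolding tree_mass_eq[OF path_shape, abs_def] by simp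
  then have "lim (tree_mass P g) = l" by (rule limI)
  then have state: "lim (inj_traffic_state M A P g) = of_real l"
    using limI[OF traffic_limit[OF test_graph_P]] dt path_weight by simp
  have "free_product P g K J" using double_tree_iff_comps dt by blast
  then have "lim (inj_traffic_state M A P g) = (\<Prod>D\<in>comps. lim (inj_traffic_state M A D g))"
    using ind T by (simp add: asymp_traffic_independent_def)
  also have "\<dots> = (\<Prod>D\<in>comps. of_real (tree_weight D g))"
  proof (rule prod.cong[OF refl])
    fix D assume D: "D \<in> comps"
    obtain k where "k \<in> K" "test_graph D g (J k)" using compsE[OF D] by metis
    then have "test_graph D g L" using JL by (auto simp: test_graph_def)
    from limI[OF traffic_limit[OF this]] show "lim (inj_traffic_state M A D g) = of_real (tree_weight D g)"
      using component_mass[OF D] double_tree_iff_comps dt D by auto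
  qed
  also have "\<dots> = of_real (tree_weight P g)"
    unfolding tree_weight_comps[OF colored_graph_axioms] by simp
  also have "\<dots> = 1" using path_weight by simp
  finally show False using state l(2) by simp
qed

lemma path_edge_label_simps:
  "path_edge_label 0 = lab 0" "path_edge_label 2 = lab 1" "path_edge_label 3 = lab 2"
  by (simp_all add: path_edge_label_def)

text \<open>The leaves 2 and 0 both hang on the root 1, where the functions that they send are
  multiplied.\<close>

lemma path_two:
  assumes "m = 2"
  shows "weighted_tree_sum 1 path_parent {0..m} (\<lambda>v. kern (path_edge_label v)) (\<lambda>_ _. 1)
    \<longlonglongrightarrow> integral {0..1} (\<lambda>x. Op (lab 1) (\<lambda>_. 1) x * Op (lab 0) (\<lambda>_. 1) x)"
proof -
  have V: "{0..m} = insert 2 (insert 0 {1})" using assms by auto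
  have L: "lab 0 \<in> L" "lab 1 \<in> L" using path_label_L assms by auto
  have t0: "rooted_tree 1 path_parent (insert 0 {1})" by (intro rooted_tree.leaf rooted_tree.root) auto
  note lab_simps = path_edge_label_simps L
  note cont = continuous_Op[OF L(1), of "\<lambda>_. 1"] continuous_Op[OF L(2), of "\<lambda>_. 1"]
  let ?f = "\<lambda>(_::nat) (_::real). 1 :: real"
  let ?f2 = "?f(1 := \<lambda>x. 1 * Op (path_edge_label 2) (?f 2) x)"
  let ?f0 = "?f2(1 := \<lambda>x. ?f2 1 x * Op (path_edge_label 0) (?f2 0) x)"
  have c2: "continuous_on {0..1} (?f2 v)" for v
    using cont by (auto simp: lab_simps intro!: continuous_intros)
  have c0: "continuous_on {0..1} (?f0 1)"
    using cont by (auto simp: lab_simps intro!: continuous_intros)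
  have r: "weighted_tree_sum 1 path_parent {1} (\<lambda>v. kern (path_edge_label v)) ?f0
      \<longlonglongrightarrow> integral {0..1} (\<lambda>x. Op (lab 1) (\<lambda>_. 1) x * Op (lab 0) (\<lambda>_. 1) x)"
    using weighted_tree_sum_root[where f = ?f0 and r = 1, OF c0] by (simp add: lab_simps)
  have "weighted_tree_sum 1 path_parent (insert 0 {1}) (\<lambda>v. kern (path_edge_label v)) ?f2
      \<longlonglongrightarrow> integral {0..1} (\<lambda>x. Op (lab 1) (\<lambda>_. 1) x * Op (lab 0) (\<lambda>_. 1) x)"
    by (rule weighted_sum_leaf[OF rooted_tree.root]) (use r c2 lab_simps in \<open>auto\<close>)
  then show ?thesis unfolding V
    by (intro weighted_sum_leaf[OF t0]) (use lab_simps in \<open>auto\<close>)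
qed

text \<open>The function sent by the leaf 3 passes the middle edge unchanged and meets at vertex 1
  its copy from the leaf 0, which leaves the integral of a square.\<close>

lemma path_three:
  assumes "m = 3" "Op (lab 1) = (\<lambda>f. f)" "lab 2 = lab 0"
  shows "weighted_tree_sum 1 path_parent {0..m} (\<lambda>v. kern (path_edge_label v)) (\<lambda>_ _. 1)
    \<longlonglongrightarrow> integral {0..1} (\<lambda>x. Op (lab 0) (\<lambda>_. 1) x * Op (lab 0) (\<lambda>_. 1) x)"
proof -
  have V: "{0..m} = insert 3 (insert 2 (insert 0 {1}))" using assms by auto
  have L: "lab 0 \<in> L" "lab 1 \<in> L" using path_label_L assms by auto
  have t0: "rooted_tree 1 path_parent (insert 0 {1})" by (intro rooted_tree.leaf rooted_tree.root) auto
  have t2: "rooted_tree 1 path_parent (insert 2 (insert 0 {1}))" by (intro rooted_tree.leaf t0) auto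
  note lab_simps = path_edge_label_simps L assms(2,3) assms(2)[unfolded One_nat_def]
  note cont = continuous_Op[OF L(1), of "\<lambda>_. 1"]
  let ?f = "\<lambda>(_::nat) (_::real). 1 :: real"
  \<comment> \<open>The index names the leaf removed last; the functions are the vertex weights at
    that stage.\<close>
  let ?f3 = "?f(2 := \<lambda>x. 1 * Op (path_edge_label 3) (?f 3) x)"
  let ?f2 = "?f3(1 := \<lambda>x. ?f3 1 x * Op (path_edge_label 2) (?f3 2) x)"
  let ?f0 = "?f2(1 := \<lambda>x. ?f2 1 x * Op (path_edge_label 0) (?f2 0) x)"
  have c3: "continuous_on {0..1} (?f3 v)" for v
    using cont by (auto simp: lab_simps intro!: continuous_intros)
  have c2: "continuous_on {0..1} (?f2 v)" for v
    using cont by (auto simp: lab_simps intro!: continuous_intros)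
  have c0: "continuous_on {0..1} (?f0 1)"
    using cont by (auto simp: lab_simps intro!: continuous_intros)
  have r: "weighted_tree_sum 1 path_parent {1} (\<lambda>v. kern (path_edge_label v)) ?f0
      \<longlonglongrightarrow> integral {0..1} (\<lambda>x. Op (lab 0) (\<lambda>_. 1) x * Op (lab 0) (\<lambda>_. 1) x)"
    using weighted_tree_sum_root[where f = ?f0 and r = 1, OF c0] by (simp add: lab_simps)
  have r0: "weighted_tree_sum 1 path_parent (insert 0 {1}) (\<lambda>v. kern (path_edge_label v)) ?f2
      \<longlonglongrightarrow> integral {0..1} (\<lambda>x. Op (lab 0) (\<lambda>_. 1) x * Op (lab 0) (\<lambda>_. 1) x)"
    by (rule weighted_sum_leaf[OF rooted_tree.root]) (use r c2 lab_simps in \<open>auto\<close>)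
  have "weighted_tree_sum 1 path_parent (insert 2 (insert 0 {1})) (\<lambda>v. kern (path_edge_label v)) ?f3
      \<longlonglongrightarrow> integral {0..1} (\<lambda>x. Op (lab 0) (\<lambda>_. 1) x * Op (lab 0) (\<lambda>_. 1) x)"
    by (rule weighted_sum_leaf[OF t0]) (use r0 c3 lab_simps in \<open>auto\<close>)
  then show ?thesis unfolding V
    by (intro weighted_sum_leaf[OF t2]) (use lab_simps in \<open>auto\<close>)
qed

end


section \<open>The concrete normalizations and the four claims\<close>

section \<open>Band matrices of slow and proportional growth\<close>

definition band_scale :: "'i set \<Rightarrow> ('i \<Rightarrow> nat \<Rightarrow> nat) \<Rightarrow> ('i \<Rightarrow> real) \<Rightarrow> 'i \<Rightarrow> nat \<Rightarrow> real" where
  "band_scale S b c i n = (if i \<in> S then (2 * real (b i n)) powr (-1/2)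
     else (2 * c i - (c i)\<^sup>2) powr (-1/2) * real n powr (-1/2))"

text \<open>The case \<open>x = 0\<close> is included, as both sides are then 0 by convention; it
  occurs for band width or dimension 0.\<close>

lemma powr_minus_half_square: "0 \<le> x \<Longrightarrow> (x powr (-1/2))\<^sup>2 = 1 / x" for x :: real
  by (cases "x = 0") (auto simp: powr_minus powr_half_sqrt power_divide inverse_eq_divide)

lemma band_scale_square:
  assumes "i \<notin> S \<Longrightarrow> 0 < c i \<and> c i \<le> 1"
  shows "(band_scale S b c i n)\<^sup>2 = (if i \<in> S then 1 / (2 * real (b i n)) else 1 / ((2 * c i - (c i)\<^sup>2) * real n))"
proof (cases "i \<in> S")
  case True
  then show ?thesis
    using powr_minus_half_square[of "2 * real (b i n)"] unfolding band_scale_def by (simp only: if_True)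
next
  case False
  then have "0 \<le> 2 * c i - (c i)\<^sup>2" using assms window_denominator[of "c i"] by simp
  then show ?thesis
    using False unfolding band_scale_def if_not_P[OF False] power_mult_distrib
    by (subst (1 2) powr_minus_half_square) simp_all
qed

lemma band_scale_tendsto:
  assumes "i \<in> S \<Longrightarrow> slow_growth (b i)"
  shows "band_scale S b c i \<longlonglongrightarrow> 0"
proof (cases "i \<in> S")
  case True
  have "filterlim (\<lambda>n. real (b i n)) at_top sequentially"
    using assms[OF True] filterlim_compose[OF filterlim_real_sequentially] by (auto simp: slow_growth_def)
  then have "filterlim (\<lambda>n. 2 * real (b i n)) at_top sequentially"
    by (intro filterlim_tendsto_pos_mult_at_top[OF tendsto_const]) auto
  then have "(\<lambda>n. (2 * real (b i n)) powr (-1/2)) \<longlonglongrightarrow> 0"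
    by (intro tendsto_neg_powr) auto
  moreover have "band_scale S b c i = (\<lambda>n. (2 * real (b i n)) powr (-1/2))"
    using True by (simp add: band_scale_def fun_eq_iff)
  ultimately show ?thesis by simp
next
  case False
  have "(\<lambda>n. real n powr (-1/2)) \<longlonglongrightarrow> 0"
    by (intro tendsto_neg_powr filterlim_real_sequentially) auto
  then have "(\<lambda>n. (2 * c i - (c i)\<^sup>2) powr (-1/2) * real n powr (-1/2)) \<longlonglongrightarrow> 0"
    by (rule tendsto_mult_right_zero)
  moreover have "band_scale S b c i = (\<lambda>n. (2 * c i - (c i)\<^sup>2) powr (-1/2) * real n powr (-1/2))"
    using False by (simp add: band_scale_def fun_eq_iff)
  ultimately show ?thesis by simp
qed

lemma band_matrices_slow_proportional:
  assumes "wigner_family M L \<beta> X"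
    and slow: "\<And>i. i \<in> S \<Longrightarrow> slow_growth (b i)"
    and propor: "\<And>i. i \<in> L - S \<Longrightarrow> proportional_growth (b i) (c i)"
    and \<Theta>: "\<And>n i. i \<in> S \<Longrightarrow> \<Theta> n i = slow_band (b i n) (X n i)"
      "\<And>n i. i \<in> L - S \<Longrightarrow> \<Theta> n i = proportional_band n (c i) (b i n) (X n i)"
  shows "band_matrices M L \<beta> X \<Theta> (band_scale S b c) b
    (\<lambda>i. if i \<in> S then 2 else 1 / (2 * c i - (c i)\<^sup>2)) (\<lambda>i. if i \<in> S then (\<lambda>f. f) else window (c i))"
proof
  show "wigner_family M L \<beta> X" by fact
  show "\<Theta> n i = (\<lambda>j k \<omega>. complex_of_real (band_scale S b c i n) * band_matrix (b i n) (X n i) j k \<omega>)"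
    if "i \<in> L" for n i
    using \<Theta>[of i n] that by (cases "i \<in> S") (auto simp: slow_band_def proportional_band_def band_scale_def)
  show "0 \<le> band_scale S b c i n" for i n by (simp add: band_scale_def)
  show "band_scale S b c i \<longlonglongrightarrow> 0" for i by (rule band_scale_tendsto) (rule slow)
  have ci: "0 < c i \<and> c i \<le> 1" if "i \<in> L" "i \<notin> S" for i
    using propor[of i] that by (simp add: proportional_growth_def)
  have D: "0 < 2 * c i - (c i)\<^sup>2" if "i \<in> L" "i \<notin> S" for i
    using window_denominator ci[OF that] by blast
  \<comment> \<open>Completing the square; it makes the proportional bound \<open>C\<close> at least
    1.\<close>
  have D1: "2 * c - c\<^sup>2 \<le> 1" for c :: real
    using zero_le_power2[of "1 - c"] by (simp add: power2_eq_square algebra_simps)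
  have sq: "(\<lambda>n. (band_scale S b c i n)\<^sup>2) = (if i \<in> S then (\<lambda>n. 1 / (2 * real (b i n))) else (\<lambda>n. 1 / ((2 * c i - (c i)\<^sup>2) * real n)))"
    if "i \<in> L" for i
    using band_scale_square[of i S c b] ci[OF that] by (auto simp: fun_eq_iff)
  fix i assume i: "i \<in> L"
  show "1 \<le> (if i \<in> S then 2 else 1 / (2 * c i - (c i)\<^sup>2))"
    using D[OF i] D1[of "c i"] by (auto simp: le_divide_eq)
  show "bounded_kernel (band_kernel (\<lambda>n. (band_scale S b c i n)\<^sup>2) (b i)) (if i \<in> S then 2 else 1 / (2 * c i - (c i)\<^sup>2))"
    unfolding sq[OF i] using bounded_slow_kernel bounded_proportional_kernel D[OF i] by auto
  show "kernel_limit (band_kernel (\<lambda>n. (band_scale S b c i n)\<^sup>2) (b i)) (if i \<in> S then (\<lambda>f. f) else window (c i))"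
    unfolding sq[OF i] using slow_kernel_limit[OF slow] proportional_kernel_limit propor[of i] i by auto
qed

theorem corollary4p3p4:
  fixes M :: "nat \<Rightarrow> 'w measure"
    and I :: "nat \<Rightarrow> 'i set"
    and \<beta> :: "'i \<Rightarrow> real"
    and X \<Theta> :: "nat \<Rightarrow> 'i \<Rightarrow> 'w random_matrix"
    and b :: "'i \<Rightarrow> nat \<Rightarrow> nat"
    and c :: "'i \<Rightarrow> real"
  assumes "disjoint_family_on I {2, 3, 4}"
    and "wigner_family M (I 2 \<union> I 3 \<union> I 4) \<beta> X"
    and "\<And>i. i \<in> I 2 \<Longrightarrow> slow_growth (b i)"
    and "\<And>i. i \<in> I 3 \<union> I 4 \<Longrightarrow> proportional_growth (b i) (c i)"
    and "\<And>i. i \<in> I 3 \<Longrightarrow> c i = 1"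
    and "\<And>i. i \<in> I 4 \<Longrightarrow> 0 < c i \<and> c i < 1"
    and "\<And>n i. i \<in> I 2 \<Longrightarrow> \<Theta> n i = slow_band (b i n) (X n i)"
    and "\<And>n i. i \<in> I 3 \<union> I 4 \<Longrightarrow> \<Theta> n i = proportional_band n (c i) (b i n) (X n i)"
  shows "asymp_traffic_independent M \<Theta> {3, 4} I
    \<and> asymp_traffic_independent M \<Theta> {3, 2} I
    \<and> (I 2 \<noteq> {} \<and> I 4 \<noteq> {} \<longrightarrow> \<not> asymp_traffic_independent M \<Theta> {2, 4} I)
    \<and> (infinite (I 4) \<or> card (I 4) \<ge> 2 \<longrightarrow>
         \<not> asymp_traffic_independent M \<Theta> (I 4) (\<lambda>i. {i}))"
proof -
  let ?L = "I 2 \<union> I 3 \<union> I 4"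
  let ?s = "band_scale (I 2) b c"
  let ?C = "\<lambda>i. if i \<in> I 2 then 2 else 1 / (2 * c i - (c i)\<^sup>2)"
  let ?Op = "\<lambda>i. if i \<in> I 2 then (\<lambda>f. f) else window (c i)"
  have dis: "I 2 \<inter> I 3 = {}" "I 2 \<inter> I 4 = {}" "I 3 \<inter> I 4 = {}"
    using assms(1) by (auto simp: disjoint_family_on_def)
  interpret band_matrices M ?L \<beta> X \<Theta> ?s b ?C ?Op
    by (rule band_matrices_slow_proportional) (use assms dis in auto)
  have full: "full_labels (I 3)"
    unfolding full_labels_def
  proof (intro conjI ballI allI)
    fix i n assume i: "i \<in> I 3"
    then have "i \<notin> I 2" "c i = 1" using dis assms(5) by auto
    then show "(?s i n)\<^sup>2 = 1 / real n" by (subst band_scale_square) auto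
    show "(\<lambda>n. real (b i n) / real n) \<longlonglongrightarrow> 1"
      using assms(4)[of i] i assms(5)[OF i] by (simp add: proportional_growth_def)
  qed auto
  have mean: "(?Op i (\<lambda>_. 1) has_integral 1) {0..1}" if "i \<in> ?L" for i
  proof (cases "i \<in> I 2")
    case True
    then show ?thesis using has_integral_const_real[of "1::real" 0 1] by simp
  next
    case False
    then have "0 < c i" "c i \<le> 1" using assms(4)[of i] that by (auto simp: proportional_growth_def)
    from integral_window_one[OF this] show ?thesis using False by simp
  qed
  have "asymp_traffic_independent M \<Theta> {3, 4} I"
    by (rule full_independent) (use dis full in auto)
  moreover have "asymp_traffic_independent M \<Theta> {3, 2} I"
    by (rule full_independent) (use dis full in auto)
  moreover have "\<not> asymp_traffic_independent M \<Theta> {2, 4} I" if "I 2 \<noteq> {}" "I 4 \<noteq> {}"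
  proof -
    obtain i j where ij: "i \<in> I 2" "j \<in> I 4" using \<open>I 2 \<noteq> {}\<close> \<open>I 4 \<noteq> {}\<close> by blast
    \<comment> \<open>The slow label in the middle separates the two edges of the proper label,
      whose windows are multiplied.\<close>
    define lab :: "nat \<Rightarrow> 'i" where "lab t = (if t = 1 then i else j)" for t
    have j2: "j \<notin> I 2" and i4: "i \<notin> I 4" using ij dis by auto
    interpret path_graph M ?L \<beta> X \<Theta> ?s b ?C ?Op 3 lab "{2, 4}" I
    proof
      show "disjoint_family_on I {2, 4}" using dis by (auto simp: disjoint_family_on_def)
      show "lab (Suc t) \<notin> I k" if "Suc t < 3" "k \<in> {2, 4}" "lab t \<in> I k" for t k
        using that ij j2 i4 by (auto simp: lab_def split: if_splits)
    qed (use ij mean in \<open>auto simp: lab_def\<close>)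
    have "integral {0..1} (\<lambda>x. window (c j) (\<lambda>_. 1) x * window (c j) (\<lambda>_. 1) x) > 1"
      by (rule integral_window_product_gt) (use assms(6)[OF ij(2)] in auto)
    then show ?thesis
      by (intro not_independent[OF path_three]) (use ij j2 in \<open>auto simp: lab_def\<close>)
  qed
  moreover have "\<not> asymp_traffic_independent M \<Theta> (I 4) (\<lambda>i. {i})" if "infinite (I 4) \<or> card (I 4) \<ge> 2"
  proof -
    \<comment> \<open>An infinite set has \<open>card\<close> 0, hence the separate case; either way
      there are two different labels.\<close>
    have "\<exists>i\<in>I 4. \<exists>j\<in>I 4. i \<noteq> j"
    proof (rule ccontr)
      assume no: "\<not> ?thesis"
      then have "I 4 = {} \<or> (\<exists>i. I 4 = {i})" by blast
      then show False using that by auto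
    qed
    then obtain i j where ij: "i \<in> I 4" "j \<in> I 4" "i \<noteq> j" by blast
    \<comment> \<open>Each label is a colour of its own and both windows are proper, so two edges
      suffice.\<close>
    define lab :: "nat \<Rightarrow> 'i" where "lab t = (if t = 1 then i else j)" for t
    have n2: "i \<notin> I 2" "j \<notin> I 2" using ij dis by auto
    interpret path_graph M ?L \<beta> X \<Theta> ?s b ?C ?Op 2 lab "I 4" "\<lambda>i. {i}"
    proof
      show "disjoint_family_on (\<lambda>i. {i}) (I 4)" by (auto simp: disjoint_family_on_def)
    qed (use ij mean in \<open>auto simp: lab_def\<close>)
    have "integral {0..1} (\<lambda>x. window (c i) (\<lambda>_. 1) x * window (c j) (\<lambda>_. 1) x) > 1"
      by (rule integral_window_product_gt) (use assms(6) ij in auto)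
    then show ?thesis
      by (intro not_independent[OF path_two]) (use n2 in \<open>auto simp: lab_def\<close>)
  qed
  ultimately show ?thesis by blast
qed

end
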